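(* Let $k \ge 5$ and let $G$ be a strictly chordality-$k$ ($SC_k$) graph. Then a maximum independent set of $G$ can be found in polynomial time. Further, a minimum vertex cover of $G$ can be computed in polynomial time.
   Context: All graphs are finite, simple and undirected. A graph $G$ is a strictly chordality-$k$ graph ($SC_k$ graph), $k \ge 3$, if either $G$ has no cycle, or every induced cycle of $G$ has length exactly $k$. An independent set is a set of pairwise non-adjacent vertices; a vertex cover is a set of vertices meeting every edge. *)

theory Defs
  imports "Graph_Theory.Graph_Theory" "HOL-Computational_Algebra.Polynomial"
begin

section \<open>Graphs\<close>

text \<open>
  A finite simple undirected graph is a \<^locale>\<open>pair_graph\<close>: finitely many vertices and a
  symmetric, loop-free set of pairs of vertices, each edge being represented by both of its
  orientations.  The library's notion of a cycle in a digraph admits closed walks u, v, u of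
  length 2, so cycles of undirected graphs are defined here, as cyclic sequences of at least three
  distinct vertices.
\<close>

definition ugraph_cycle :: "'a pair_pre_digraph \<Rightarrow> 'a list \<Rightarrow> bool" where
  "ugraph_cycle G vs \<longleftrightarrow>
     3 \<le> length vs \<and> distinct vs \<and> set vs \<subseteq> pverts G \<and>
     (\<forall>i < length vs. (vs ! i, vs ! (Suc i mod length vs)) \<in> parcs G)"

definition induced_cycle :: "'a pair_pre_digraph \<Rightarrow> 'a list \<Rightarrow> bool" where
  "induced_cycle G vs \<longleftrightarrow>
     ugraph_cycle G vs \<and>
     (\<forall>i < length vs. \<forall>j < length vs. (vs ! i, vs ! j) \<in> parcs G \<longrightarrow>
        j = Suc i mod length vs \<or> i = Suc j mod length vs)"

definition SC :: "nat \<Rightarrow> 'a pair_pre_digraph \<Rightarrow> bool" where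
  "SC k G \<longleftrightarrow>
     3 \<le> k \<and> pair_graph G \<and>
     ((\<nexists>vs. ugraph_cycle G vs) \<or> (\<forall>vs. induced_cycle G vs \<longrightarrow> length vs = k))"

definition independent_set :: "'a pair_pre_digraph \<Rightarrow> 'a set \<Rightarrow> bool" where
  "independent_set G S \<longleftrightarrow> S \<subseteq> pverts G \<and> (\<forall>u\<in>S. \<forall>v\<in>S. (u, v) \<notin> parcs G)"

definition maximum_independent_set :: "'a pair_pre_digraph \<Rightarrow> 'a set \<Rightarrow> bool" where
  "maximum_independent_set G S \<longleftrightarrow>
     independent_set G S \<and> (\<forall>T. independent_set G T \<longrightarrow> card T \<le> card S)"

definition vertex_cover :: "'a pair_pre_digraph \<Rightarrow> 'a set \<Rightarrow> bool" where
  "vertex_cover G S \<longleftrightarrow> S \<subseteq> pverts G \<and> (\<forall>(u, v)\<in>parcs G. u \<in> S \<or> v \<in> S)"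

definition minimum_vertex_cover :: "'a pair_pre_digraph \<Rightarrow> 'a set \<Rightarrow> bool" where
  "minimum_vertex_cover G S \<longleftrightarrow>
     vertex_cover G S \<and> (\<forall>T. vertex_cover G T \<longrightarrow> card S \<le> card T)"


section \<open>Model of computation\<close>

text \<open>
  A random access machine with structured control flow: natural-number registers and finitely many
  (in any one program) unbounded arrays of natural numbers, with unit cost per executed assignment
  and per evaluated guard.  Expressions have a size fixed by the program, and arithmetic is limited
  to addition and truncated subtraction.  In particular there is no multiplication, so each
  step lengthens the binary representation of the largest stored number by at most a constant, and
  polynomial time in this model is polynomial time on Turing machines.
\<close>

datatype aexp =
    Const nat
  | Var string
  | Idx string aexp
  | Add aexp aexp
  | Monus aexp aexp

datatype bexp =
    BLess aexp aexp
  | BNot bexp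
  | BAnd bexp bexp

datatype com =
    Skip
  | Assign string aexp
  | Store string aexp aexp
  | Seq com com
  | Cond bexp com com
  | While bexp com

record state =
  reg :: "string \<Rightarrow> nat"
  arr :: "string \<Rightarrow> nat \<Rightarrow> nat"

fun aval :: "aexp \<Rightarrow> state \<Rightarrow> nat" where
  "aval (Const n) s = n"
| "aval (Var x) s = reg s x"
| "aval (Idx a e) s = arr s a (aval e s)"
| "aval (Add e f) s = aval e s + aval f s"
| "aval (Monus e f) s = aval e s - aval f s"

fun bval :: "bexp \<Rightarrow> state \<Rightarrow> bool" where
  "bval (BLess e f) s \<longleftrightarrow> aval e s < aval f s"
| "bval (BNot b) s \<longleftrightarrow> \<not> bval b s"
| "bval (BAnd b c) s \<longleftrightarrow> bval b s \<and> bval c s"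

definition set_reg :: "string \<Rightarrow> nat \<Rightarrow> state \<Rightarrow> state" where
  "set_reg x n s = s\<lparr>reg := (reg s)(x := n)\<rparr>"

definition set_arr :: "string \<Rightarrow> nat \<Rightarrow> nat \<Rightarrow> state \<Rightarrow> state" where
  "set_arr a i n s = s\<lparr>arr := (arr s)(a := (arr s a)(i := n))\<rparr>"

text \<open>\<open>exec c s t s'\<close>: started in \<open>s\<close>, program \<open>c\<close> halts in \<open>s'\<close> after \<open>t\<close> steps.\<close>

inductive exec :: "com \<Rightarrow> state \<Rightarrow> nat \<Rightarrow> state \<Rightarrow> bool" where
  Skip: "exec Skip s 1 s"
| Assign: "exec (Assign x e) s 1 (set_reg x (aval e s) s)"
| Store: "exec (Store a e f) s 1 (set_arr a (aval e s) (aval f s) s)"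
| Seq: "exec c s t s' \<Longrightarrow> exec d s' t' s'' \<Longrightarrow> exec (Seq c d) s (t + t') s''"
| CondTrue: "bval b s \<Longrightarrow> exec c s t s' \<Longrightarrow> exec (Cond b c d) s (1 + t) s'"
| CondFalse: "\<not> bval b s \<Longrightarrow> exec d s t s' \<Longrightarrow> exec (Cond b c d) s (1 + t) s'"
| WhileFalse: "\<not> bval b s \<Longrightarrow> exec (While b c) s 1 s"
| WhileTrue: "bval b s \<Longrightarrow> exec c s t s' \<Longrightarrow> exec (While b c) s' t' s'' \<Longrightarrow>
    exec (While b c) s (1 + t + t') s''"

inductive_cases SeqE: "exec (Seq c d) s t s'"
inductive_cases CondE: "exec (Cond b c d) s t s'"
inductive_cases WhileE: "exec (While b c) s t s'"

lemma exec_deterministic: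
  "exec c s t s' \<Longrightarrow> exec c s u s'' \<Longrightarrow> u = t \<and> s'' = s'"
proof (induction arbitrary: u s'' rule: exec.induct)
  case (Skip s)
  then show ?case by (cases rule: exec.cases) simp_all
next
  case (Assign x e s)
  then show ?case by (cases rule: exec.cases) simp_all
next
  case (Store a e f s)
  then show ?case by (cases rule: exec.cases) simp_all
next
  case (Seq c s t s' d t' s1)
  from Seq.prems show ?case
    by (rule SeqE) (metis Seq.IH)
next
  case (CondTrue b s c t s' d)
  from CondTrue.prems show ?case
    by (rule CondE) (use CondTrue.hyps(1) in \<open>simp_all add: CondTrue.IH\<close>)
next
  case (CondFalse b s d t s' c)
  from CondFalse.prems show ?case
    by (rule CondE) (use CondFalse.hyps(1) in \<open>simp_all add: CondFalse.IH\<close>)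
next
  case (WhileFalse b s c)
  from WhileFalse.prems show ?case
    by (rule WhileE) (use WhileFalse.hyps in simp_all)
next
  case (WhileTrue b s c t s' t' s1)
  from WhileTrue.prems show ?case
  proof (rule WhileE)
    assume "\<not> bval b s"
    with WhileTrue.hyps(1) show ?thesis by simp
  next
    fix v r v'
    assume *: "u = Suc (v + v')" "exec c s v r" "exec (While b c) r v' s''"
    have "v = t \<and> r = s'" using WhileTrue.IH(1) *(2) .
    moreover from this have "v' = t' \<and> s'' = s1" using WhileTrue.IH(2) *(3) by simp
    ultimately show ?thesis using *(1) by simp
  qed
qed


section \<open>Polynomial-time computation of vertex sets\<close>

text \<open>
  The input is the adjacency matrix, stored row by row, with respect to an arbitrary enumeration
  \<open>vs\<close> of the vertices; the output array holds the characteristic vector of the computed set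
  with respect to the same enumeration.  Everything else is initially zero.
\<close>

definition input_state :: "'a pair_pre_digraph \<Rightarrow> 'a list \<Rightarrow> state" where
  "input_state G vs =
     \<lparr> reg = (\<lambda>_. 0)(''n'' := length vs),
       arr = (\<lambda>_ _. 0)(''adj'' :=
         (\<lambda>m. if m < length vs * length vs \<and>
                 (vs ! (m div length vs), vs ! (m mod length vs)) \<in> parcs G
              then 1 else 0)) \<rparr>"

definition output_set :: "'a list \<Rightarrow> state \<Rightarrow> 'a set" where
  "output_set vs s = {vs ! i | i. i < length vs \<and> arr s ''out'' i \<noteq> 0}"

text \<open>
  A single program, with a single polynomial time bound in the number of vertices, computes for
  every graph in \<open>C\<close> some vertex set with property \<open>P\<close>.
\<close>

definition poly_time_computable ::
  "'a pair_pre_digraph set \<Rightarrow> ('a pair_pre_digraph \<Rightarrow> 'a set \<Rightarrow> bool) \<Rightarrow> bool" where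
  "poly_time_computable C P \<longleftrightarrow>
     (\<exists>(c :: com) (p :: nat poly). \<forall>G\<in>C. \<forall>vs. distinct vs \<and> set vs = pverts G \<longrightarrow>
        (\<exists>t s. exec c (input_state G vs) t s \<and> t \<le> poly p (card (pverts G)) \<and>
               P G (output_set vs s)))"

end

theory Submission
  imports Defs
begin

text \<open>
  In a graph all of whose induced cycles have length \<open>k \<ge> 5\<close>, a connected set \<open>K\<close> disjoint from an
  induced cycle \<open>C\<close> has at most two neighbours on \<open>C\<close>.  A minimal counterexample has exactly three;
  deleting a non-cut vertex of \<open>K\<close> detaches one of them, and the remaining two are adjacent or
  antipodal on \<open>C\<close>, because a shortest path through \<open>K\<close> forms induced cycles with both arcs of \<open>C\<close>.
  Doing this for two non-cut vertices leaves few positions for the three points, and these are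
  excluded because every cycle has length \<open>k\<close> or at least \<open>2 * k - 2\<close>.

  The condition on \<open>C\<close> and \<open>K\<close> survives the elimination of a vertex of degree at most two, that is,
  its replacement by an edge joining its neighbours, and it guarantees that such a vertex exists.
  Hence a minimum vertex cover, viewed as the optimum of a sum of cost functions of two binary
  variables each, is found by eliminating one variable at a time and backtracking; its complement
  is a maximum independent set.
\<close>

section \<open>Chordless cycles and attachments\<close>

text \<open>Equal length of induced cycles cannot serve as the induction hypothesis: eliminating a
  vertex shortens only the cycles through it. It is used once, to establish \<open>thin\<close>, and
  there 5 <= k matters twice. A vertex off an induced cycle with two neighbours on it would create
  two cycles of total length k + 4, each of length at least k. And the last configuration to be
  excluded yields a cycle of length k + 2, strictly between k and 2 * k - 2. That gap exists because
  a chord splits a cycle into two cycles of length at least k which share only the two ends of the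
  chord. A vertex of low degree is found by enlarging a connected set K as far as some cycle
  survives outside it. Every outside neighbour of K then lies on every surviving cycle, so
  \<open>thin\<close> allows at most two of them. Degree at most two keeps the optimisation
  pairwise: minimising over the vertex leaves a function of its two neighbours, which fits into the
  matrix block of the new edge. The machine has no multiplication, hence the running counters and
  the table of row offsets.\<close>

definition cycle :: "('a \<Rightarrow> 'a \<Rightarrow> bool) \<Rightarrow> 'a list \<Rightarrow> bool" where
  "cycle E vs \<longleftrightarrow> 3 \<le> length vs \<and> distinct vs \<and> successively E vs \<and> E (last vs) (hd vs)"

definition chordless_path :: "('a \<Rightarrow> 'a \<Rightarrow> bool) \<Rightarrow> 'a list \<Rightarrow> bool" where
  "chordless_path E vs \<longleftrightarrow> distinct vs \<and> successively E vs \<and>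
     (\<forall>xs a ys b zs. vs = xs @ a # ys @ b # zs \<longrightarrow> E a b \<longrightarrow> ys = [])"

text \<open>Chords are expressed by splitting the list, which suits concatenation and rotation
  better than indices. The exempt case \<open>xs = []\<close>, \<open>zs = []\<close> is the closing
  edge. Only pairs with a before b are inspected, which suffices for symmetric
  \<open>E\<close>.\<close>

definition chordless_cycle :: "('a \<Rightarrow> 'a \<Rightarrow> bool) \<Rightarrow> 'a list \<Rightarrow> bool" where
  "chordless_cycle E vs \<longleftrightarrow> cycle E vs \<and>
     (\<forall>xs a ys b zs. vs = xs @ a # ys @ b # zs \<longrightarrow> E a b \<longrightarrow> ys = [] \<or> xs = [] \<and> zs = [])"

lemma chordless_cycleD:
  "chordless_cycle E (xs @ a # ys @ b # zs) \<Longrightarrow> E a b \<Longrightarrow> ys = [] \<or> xs = [] \<and> zs = []"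
  by (auto simp: chordless_cycle_def)

lemma cycle_rotate: "cycle E (xs @ ys) \<Longrightarrow> cycle E (ys @ xs)"
  by (cases "xs = []"; cases "ys = []") (auto simp: cycle_def successively_append_iff)

lemma chordless_cycle_rotate1:
  assumes "symp E" "chordless_cycle E (x # w)"
  shows "chordless_cycle E (w @ [x])"
  unfolding chordless_cycle_def
proof (intro conjI allI impI)
  show "cycle E (w @ [x])"
    using assms(2) cycle_rotate[of E "[x]" w] by (simp add: chordless_cycle_def)
  fix xs a ys b zs assume eq: "w @ [x] = xs @ a # ys @ b # zs" and ab: "E a b"
  show "ys = [] \<or> xs = [] \<and> zs = []"
  proof (cases zs rule: rev_cases)
    case Nil
    then have "w = xs @ a # ys" "x = b" using eq by (auto simp flip: append_assoc append_Cons)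
    then have "x # w = [] @ x # xs @ a # ys" by simp
    with assms have "xs = [] \<or> ys = []"
      using chordless_cycleD[of E "[]" x xs a ys] ab sympD[OF assms(1) ab] \<open>x = b\<close> by auto
    with Nil show ?thesis by auto
  next
    case (snoc zs' z)
    then have "w = xs @ a # ys @ b # zs'" using eq by (auto simp flip: append_assoc append_Cons)
    then have "x # w = (x # xs) @ a # ys @ b # zs'" by simp
    with assms(2) ab show ?thesis using chordless_cycleD[of E "x # xs" a ys b zs'] by auto
  qed
qed

lemma chordless_cycle_rotate:
  assumes "symp E"
  shows "chordless_cycle E (xs @ ys) \<Longrightarrow> chordless_cycle E (ys @ xs)"
proof (induction xs arbitrary: ys)
  case (Cons x xs)
  then show ?case
    using chordless_cycle_rotate1[OF assms, of x "xs @ ys"] Cons.IH[of "ys @ [x]"] by simp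
qed simp

lemma chordless_cycle_rotate_to:
  assumes "symp E" "chordless_cycle E C" "s \<in> set C"
  obtains A where "chordless_cycle E (s # A)" "set (s # A) = set C" "length (s # A) = length C"
proof -
  obtain xs ys where "C = xs @ s # ys" using assms(3) by (meson split_list)
  then have "chordless_cycle E (s # ys @ xs)"
    using chordless_cycle_rotate[of E xs "s # ys"] assms by simp
  then show thesis using that[of "ys @ xs"] \<open>C = _\<close> by auto
qed

lemma chordless_cycle_rotate_to2:
  assumes "symp E" "chordless_cycle E C" "s \<in> set C" "t \<in> set C" "s \<noteq> t"
  obtains A B where "chordless_cycle E (s # A @ t # B)" "set (s # A @ t # B) = set C"
    "length (s # A @ t # B) = length C"
proof -
  obtain D where D: "chordless_cycle E (s # D)" "set (s # D) = set C" "length (s # D) = length C"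
    using chordless_cycle_rotate_to[OF assms(1-3)] by blast
  moreover have "t \<in> set D" using D(2) assms(4,5) by auto
  then obtain A B where "D = A @ t # B" by (meson split_list)
  ultimately show thesis using that by blast
qed

text \<open>Both halves contain the two ends of the chord, hence the \<open>+ 2\<close>.\<close>

lemma chord_splits_cycle:
  assumes "symp E" "cycle E vs" "\<not> chordless_cycle E vs"
  obtains us ws where "cycle E us" "cycle E ws" "length us + length ws = length vs + 2"
    "set us \<subseteq> set vs" "set ws \<subseteq> set vs"
proof -
  have "\<exists>xs a ys b zs. vs = xs @ a # ys @ b # zs \<and> E a b \<and> ys \<noteq> [] \<and> \<not> (xs = [] \<and> zs = [])"
    using assms(2,3) by (simp only: chordless_cycle_def not_all not_imp de_Morgan_disj de_Morgan_conj simp_thms)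
  then obtain xs a ys b zs
    where *: "vs = xs @ a # ys @ b # zs" "E a b" "ys \<noteq> []" "\<not> (xs = [] \<and> zs = [])"
    by (elim exE conjE)
  have c: "cycle E (xs @ a # ys @ b # zs)" using *(1) assms(2) by simp
  have "cycle E (a # ys @ [b])"
    using c *(3) sympD[OF assms(1) \<open>E a b\<close>]
    by (cases ys) (auto simp: cycle_def successively_append_iff successively_Cons hd_append split: if_splits)
  moreover have "1 \<le> length xs + length zs" using *(4) by (cases xs; cases zs; simp)
  then have "cycle E (xs @ a # b # zs)"
    using c *(2) by (auto simp: cycle_def successively_append_iff successively_Cons hd_append split: if_splits)
  ultimately show thesis using that[of "a # ys @ [b]" "xs @ a # b # zs"] *(1) by auto
qed

lemma exists_chordless_cycle:
  assumes "symp E" "cycle E vs"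
  obtains C where "chordless_cycle E C" "set C \<subseteq> set vs" "length C \<le> length vs"
  using assms(2)
proof (induction vs arbitrary: thesis rule: length_induct)
  case (1 vs)
  show ?case
  proof (cases "chordless_cycle E vs")
    case True
    then show ?thesis using 1 by blast
  next
    case False
    then obtain us ws where *: "cycle E us" "cycle E ws" "length us + length ws = length vs + 2"
      "set us \<subseteq> set vs"
      using chord_splits_cycle[OF assms(1)] 1(3) by metis
    \<comment> \<open>The other half \<open>ws\<close> has at least three vertices, which outweighs
      the surplus of two.\<close>
    then have "length us < length vs" by (simp add: cycle_def)
    then obtain C where "chordless_cycle E C" "set C \<subseteq> set us" "length C \<le> length us"
      using 1(1) *(1) by blast
    with * \<open>length us < length vs\<close> show ?thesis by (intro 1(2)[of C]) auto
  qed
qed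

lemma cycle_length_ge:
  assumes "symp E" "\<And>C. chordless_cycle E C \<Longrightarrow> length C = k" "cycle E vs"
  shows "k \<le> length vs"
  using exists_chordless_cycle[OF assms(1,3)] assms(2) by metis

text \<open>A cycle of any other length has a chord, and each of the two resulting cycles has length
  at least k.\<close>

lemma cycle_length_gap:
  assumes "symp E" "\<And>C. chordless_cycle E C \<Longrightarrow> length C = k" "cycle E vs"
  shows "length vs = k \<or> 2 * k \<le> length vs + 2"
proof (cases "chordless_cycle E vs")
  case False
  then obtain us ws where *: "cycle E us" "cycle E ws" "length us + length ws = length vs + 2"
    using chord_splits_cycle[OF assms(1,3)] by metis
  then show ?thesis using cycle_length_ge[OF assms(1,2)] by (metis add_mono mult_2)
qed (use assms(2) in blast)

text \<open>A chord would lie within one path, where chordlessness forbids it, or run between the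
  paths, where \<open>cross\<close> admits only the two joining edges. \<open>Q\<close> may be a
  single vertex; two vertices in \<open>D\<close> guarantee a cycle of length three.\<close>

lemma chordless_path_join:
  assumes D: "chordless_path E D" and Q: "chordless_path E Q"
    and len: "2 \<le> length D" "Q \<noteq> []" and disj: "set D \<inter> set Q = {}"
    and closing: "E (last D) (hd Q)" "E (last Q) (hd D)"
    and cross: "\<And>d q. d \<in> set D \<Longrightarrow> q \<in> set Q \<Longrightarrow> E d q \<Longrightarrow>
      d = last D \<and> q = hd Q \<or> d = hd D \<and> q = last Q"
  shows "chordless_cycle E (D @ Q)"
  unfolding chordless_cycle_def
proof (intro conjI allI impI)
  have D0: "D \<noteq> []" using len by auto
  have "1 \<le> length Q" using len(2) by (cases Q) auto
  then show "cycle E (D @ Q)"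
    using D Q len disj closing D0
    by (auto simp: cycle_def chordless_path_def successively_append_iff)
  fix xs a ys b zs assume eq: "D @ Q = xs @ a # ys @ b # zs" and ab: "E a b"
  have dist: "distinct (xs @ a # ys @ b # zs)"
    using D Q disj by (simp add: chordless_path_def flip: eq)
  consider (DD) us where "D = xs @ a # ys @ b # us" "zs = us @ Q"
    | (QQ) us where "Q = us @ a # ys @ b # zs" 
    | (DQ) us ws where "D = xs @ a # us" "Q = ws @ b # zs" "ys = us @ ws"
    using eq
    by (fastforce simp: append_eq_append_conv2 append_eq_Cons_conv Cons_eq_append_conv)
  then show "ys = [] \<or> xs = [] \<and> zs = []"
  proof cases
    case DD
    then show ?thesis using D ab unfolding chordless_path_def by blast
  next
    case QQ
    then show ?thesis using Q ab unfolding chordless_path_def by blast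
  next
    case DQ
    then have "a = last D \<and> b = hd Q \<or> a = hd D \<and> b = last Q" using cross ab by simp
    then show ?thesis
    proof
      assume *: "a = last D \<and> b = hd Q"
      have "a \<in> set us" if "us \<noteq> []" using last_in_set[OF that] arg_cong[OF DQ(1), of last] * that by simp
      moreover have "b \<in> set ws" if "ws \<noteq> []" using hd_in_set[OF that] arg_cong[OF DQ(2), of hd] * that by simp
      ultimately have "us = []" "ws = []" using dist DQ(3) by auto
      then show ?thesis using DQ by simp
    next
      assume *: "a = hd D \<and> b = last Q"
      have "a \<in> set xs" if "xs \<noteq> []" using hd_in_set[OF that] arg_cong[OF DQ(1), of hd] * that by simp
      moreover have "b \<in> set zs" if "zs \<noteq> []" using last_in_set[OF that] arg_cong[OF DQ(2), of last] * that by simp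
      ultimately have "xs = []" "zs = []" using dist by auto
      then show ?thesis by simp
    qed
  qed
qed

section \<open>Connected sets and shortest connections through them\<close>

definition connected_in :: "('a \<Rightarrow> 'a \<Rightarrow> bool) \<Rightarrow> 'a set \<Rightarrow> bool" where
  "connected_in E X \<longleftrightarrow> (\<forall>u\<in>X. \<forall>v\<in>X. (\<lambda>a b. E a b \<and> a \<in> X \<and> b \<in> X)\<^sup>*\<^sup>* u v)"

text \<open>Only the interior of the walk is listed, so that s and t may lie on a cycle disjoint
  from \<open>X\<close>. A single vertex adjacent to both s and t is a link.\<close>

definition link :: "('a \<Rightarrow> 'a \<Rightarrow> bool) \<Rightarrow> 'a set \<Rightarrow> 'a \<Rightarrow> 'a \<Rightarrow> 'a list \<Rightarrow> bool" where
  "link E X s t Q \<longleftrightarrow> Q \<noteq> [] \<and> set Q \<subseteq> X \<and> successively E Q \<and> E s (hd Q) \<and> E (last Q) t"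

lemma walk_of_rtranclp:
  assumes "(\<lambda>a b. E a b \<and> a \<in> X \<and> b \<in> X)\<^sup>*\<^sup>* u v" "u \<in> X"
  shows "\<exists>Q. Q \<noteq> [] \<and> set Q \<subseteq> X \<and> successively E Q \<and> hd Q = u \<and> last Q = v"
  using assms
proof (induction rule: rtranclp_induct)
  case base
  then show ?case by (intro exI[of _ "[u]"]) simp
next
  case (step v w)
  then obtain Q where "Q \<noteq> []" "set Q \<subseteq> X" "successively E Q" "hd Q = u" "last Q = v" by metis
  with step(2) show ?case by (intro exI[of _ "Q @ [w]"]) (auto simp: successively_append_iff)
qed

lemma shortest_link:
  assumes "connected_in E X" "u \<in> X" "E s u" "v \<in> X" "E v t"
  obtains Q where "link E X s t Q" "\<And>Q'. link E X s t Q' \<Longrightarrow> length Q \<le> length Q'"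
proof -
  obtain P where "P \<noteq> []" "set P \<subseteq> X" "successively E P" "hd P = u" "last P = v"
    using walk_of_rtranclp[of E X u v] assms(1,2,4) unfolding connected_in_def by blast
  then have "link E X s t P" using assms(3,5) by (simp add: link_def)
  then show thesis
    using that[of "arg_min length (link E X s t)"] arg_min_nat_lemma[of "link E X s t" P length]
    by blast
qed

lemma link_rev: "symp E \<Longrightarrow> link E X s t Q \<Longrightarrow> link E X t s (rev Q)"
  by (auto simp: link_def hd_rev last_rev symp_def elim: successively_mono)

text \<open>A repeated vertex, a chord, or a second neighbour of s or t on the walk would each allow
  a shortcut.\<close>

lemma shortest_link_chordless:
  assumes Q: "link E X s t Q" and min: "\<And>Q'. link E X s t Q' \<Longrightarrow> length Q \<le> length Q'"
  shows "chordless_path E Q" "q \<in> set Q \<Longrightarrow> E s q \<Longrightarrow> q = hd Q" "q \<in> set Q \<Longrightarrow> E q t \<Longrightarrow> q = last Q"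
proof -
  have "distinct Q"
  proof (rule ccontr)
    assume "\<not> distinct Q"
    then obtain xs a ys zs where *: "Q = xs @ [a] @ ys @ [a] @ zs"
      using not_distinct_decomp by metis
    then have "link E X s t (xs @ a # zs)"
      using Q by (cases xs; cases zs; auto simp: link_def successively_append_iff successively_Cons hd_append split: if_splits)
    from min[OF this] * show False by simp
  qed
  moreover have "ys = []" if "Q = xs @ a # ys @ b # zs" "E a b" for xs a ys b zs
  proof (rule ccontr)
    assume "ys \<noteq> []"
    have "link E X s t (xs @ a # b # zs)"
      using Q that by (cases xs; cases zs; auto simp: link_def successively_append_iff successively_Cons hd_append split: if_splits)
    from min[OF this] that \<open>ys \<noteq> []\<close> show False by simp
  qed
  ultimately show "chordless_path E Q" using Q by (auto simp: chordless_path_def link_def)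
  show "q = hd Q" if "q \<in> set Q" "E s q"
  proof -
    obtain xs zs where *: "Q = xs @ q # zs" using split_list[OF \<open>q \<in> set Q\<close>] by blast
    then have "link E X s t (q # zs)" using Q that by (auto simp: link_def successively_append_iff)
    from min[OF this] * show ?thesis by simp
  qed
  show "q = last Q" if "q \<in> set Q" "E q t"
  proof -
    obtain xs zs where *: "Q = xs @ q # zs" using split_list[OF \<open>q \<in> set Q\<close>] by blast
    then have "link E X s t (xs @ [q])"
      using Q that by (auto simp: link_def successively_append_iff hd_append split: if_splits)
    from min[OF this] * show ?thesis by simp
  qed
qed

lemma connected_in_insert:
  assumes "symp E" "connected_in E K" "u \<in> K" "E u s"
  shows "connected_in E (insert s K)"
proof -
  let ?R = "\<lambda>a b. E a b \<and> a \<in> insert s K \<and> b \<in> insert s K"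
  have K: "?R\<^sup>*\<^sup>* a b" if "a \<in> K" "b \<in> K" for a b
    by (rule rtranclp_mono[THEN predicate2D, of "\<lambda>a b. E a b \<and> a \<in> K \<and> b \<in> K"])
      (use that assms(2) in \<open>auto simp: connected_in_def\<close>)
  have "?R u s" "?R s u" using assms by (auto dest: sympD)
  then have "?R\<^sup>*\<^sup>* a s" "?R\<^sup>*\<^sup>* s a" if "a \<in> K" for a
    using K[OF that \<open>u \<in> K\<close>] K[OF \<open>u \<in> K\<close> that]
      rtranclp.rtrancl_into_rtrancl[of ?R a u s] converse_rtranclp_into_rtranclp[of ?R s u a]
    by simp_all
  then show ?thesis unfolding connected_in_def using K by auto
qed

lemma connected_in_small [simp]: "connected_in E {}" "connected_in E {v}"
  by (auto simp: connected_in_def)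

text \<open>A maximal connected proper subset containing \<open>w\<close> misses exactly one vertex.\<close>

lemma exists_non_cut_vertex:
  assumes "symp E" "finite K" "connected_in E K" "w \<in> K" "K \<noteq> {w}"
  obtains u where "u \<in> K" "u \<noteq> w" "connected_in E (K - {u})"
proof -
  let ?P = "\<lambda>L. connected_in E L \<and> w \<in> L \<and> L \<subset> K"
  have "?P {w}" using assms by auto
  moreover have "card L \<le> card K" if "?P L" for L using that assms(2) by (simp add: card_mono psubset_imp_subset)
  ultimately obtain L where L: "?P L" and max: "\<And>M. ?P M \<Longrightarrow> card M \<le> card L"
    using ex_has_greatest_nat[of ?P "{w}" card "Suc (card K)"] by (auto simp: le_imp_less_Suc)
  have "\<exists>a\<in>L. \<exists>b\<in>K - L. E a b"
  proof (rule ccontr)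
    assume no: "\<not> ?thesis"
    obtain v where v: "v \<in> K" "v \<notin> L" using L by auto
    have "(\<lambda>a b. E a b \<and> a \<in> K \<and> b \<in> K)\<^sup>*\<^sup>* w v"
      using assms v unfolding connected_in_def by auto
    then have "v \<in> L" by (induction rule: rtranclp_induct) (use L no in auto)
    with v show False by simp
  qed
  then obtain a b where ab: "a \<in> L" "b \<in> K" "b \<notin> L" "E a b" by auto
  have fin: "finite L" using L assms(2) finite_subset by auto
  have "\<not> ?P (insert b L)" using max[of "insert b L"] ab fin by auto
  then have "insert b L = K" using L ab connected_in_insert[OF assms(1), of L a b] by auto
  then have "K - {b} = L" using ab by auto
  then show thesis using that[of b] ab L by auto
qed

definition attachments :: "('a \<Rightarrow> 'a \<Rightarrow> bool) \<Rightarrow> 'a set \<Rightarrow> 'a set \<Rightarrow> 'a set" where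
  "attachments E K S = {c \<in> S. \<exists>u\<in>K. E u c}"

text \<open>Equivalently, there is no \<open>K\<^sub>4\<close> minor; this form is stable under vertex elimination.\<close>

definition thin :: "('a \<Rightarrow> 'a \<Rightarrow> bool) \<Rightarrow> bool" where
  "thin E \<longleftrightarrow> (\<forall>C K. chordless_cycle E C \<longrightarrow> finite K \<longrightarrow> connected_in E K \<longrightarrow> K \<inter> set C = {} \<longrightarrow>
     card (attachments E K (set C)) \<le> 2)"


lemma thinD:
  "thin E \<Longrightarrow> chordless_cycle E C \<Longrightarrow> finite K \<Longrightarrow> connected_in E K \<Longrightarrow> K \<inter> set C = {} \<Longrightarrow>
     card (attachments E K (set C)) \<le> 2"
  unfolding thin_def by blast

section \<open>Graphs all of whose induced cycles have the same length\<close>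

lemma chordless_cycle_arc:
  assumes "chordless_cycle E (xs @ D @ zs)" "xs @ zs \<noteq> []"
  shows "chordless_path E D"
  unfolding chordless_path_def
proof (intro conjI allI impI)
  show "distinct D" "successively E D"
    using assms by (auto simp: chordless_cycle_def cycle_def successively_append_iff)
  fix us a ys b ws assume "D = us @ a # ys @ b # ws" "E a b"
  then show "ys = []"
    using chordless_cycleD[of E "xs @ us" a ys b "ws @ zs"] assms by auto
qed

text \<open>Since \<open>inner\<close> forbids edges between \<open>X\<close> and the interior of
  the arc, the arc and a shortest link close up to a chordless cycle. The summand 2 counts s and
  t.\<close>

lemma ear_length:
  assumes sym: "symp E" and k: "\<And>C. chordless_cycle E C \<Longrightarrow> length C = k"
    and D: "chordless_path E (s # A @ [t])" and X: "X \<inter> set (s # A @ [t]) = {}"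
    and inner: "\<And>u a. u \<in> X \<Longrightarrow> a \<in> set A \<Longrightarrow> \<not> E u a"
    and Q: "link E X t s Q" "\<And>Q'. link E X t s Q' \<Longrightarrow> length Q \<le> length Q'"
  shows "length A + length Q + 2 = k"
proof -
  have "chordless_cycle E ((s # A @ [t]) @ Q)"
  proof (rule chordless_path_join[OF D shortest_link_chordless(1)[OF Q]])
    show "set (s # A @ [t]) \<inter> set Q = {}" using X Q(1) by (auto simp: link_def)
    fix d q assume dq: "d \<in> set (s # A @ [t])" "q \<in> set Q" "E d q"
    then have "q \<in> X" using Q(1) by (auto simp: link_def)
    then have "d \<notin> set A" using inner dq(3) sym by (metis sympD)
    then consider "d = t" | "d = s" using dq(1) by auto
    then show "d = last (s # A @ [t]) \<and> q = hd Q \<or> d = hd (s # A @ [t]) \<and> q = last Q"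
      using shortest_link_chordless(2,3)[OF Q dq(2)] dq(3) sym by cases (auto dest: sympD)
  qed (use Q(1) in \<open>auto simp: link_def\<close>)
  from k[OF this] show ?thesis by simp
qed

text \<open>If both arcs are nonempty, s and t are not adjacent and each arc is a chordless path.
  Shortest links in the two directions have the same length, so \<open>ear_length\<close> gives both
  arcs the same length. An empty arc makes s and t adjacent, and this edge is a chord of the other
  ear.\<close>

lemma pair_attachment_arcs:
  assumes sym: "symp E" and k: "\<And>C. chordless_cycle E C \<Longrightarrow> length C = k"
    and C: "chordless_cycle E (s # A @ t # B)" and X: "connected_in E X" "X \<inter> set (s # A @ t # B) = {}"
    and att: "attachments E X (set (s # A @ t # B)) = {s, t}"
  shows "A = [] \<or> B = [] \<or> length A = length B"
proof (rule ccontr)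
  assume no: "\<not> ?thesis"
  obtain u v where uv: "u \<in> X" "E t u" "v \<in> X" "E v s" "E s v" "E u t"
    using att sym by (auto simp: attachments_def set_eq_iff dest: sympD) (metis sympD)
  obtain Q where Q: "link E X t s Q" "\<And>Q'. link E X t s Q' \<Longrightarrow> length Q \<le> length Q'"
    using shortest_link[OF X(1) uv(1,2,3,4)] by metis
  obtain P where P: "link E X s t P" "\<And>P'. link E X s t P' \<Longrightarrow> length P \<le> length P'"
    using shortest_link[OF X(1) uv(3,5,1,6)] by metis
  have PQ: "length P = length Q"
    using P(2)[OF link_rev[OF sym Q(1)]] Q(2)[OF link_rev[OF sym P(1)]] by simp
  have dist: "distinct (s # A @ t # B)" using C by (simp add: chordless_cycle_def cycle_def)
  have inner: "\<not> E u a" if "u \<in> X" "a \<in> set A \<union> set B" for u a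
    using that att dist by (auto simp: attachments_def set_eq_iff)
  have "length A + length Q + 2 = k"
  proof (rule ear_length[OF sym k _ _ _ Q])
    show "chordless_path E (s # A @ [t])"
      using chordless_cycle_arc[of E "[]" "s # A @ [t]" B] C no by simp
  qed (use X inner in auto)
  moreover have C': "chordless_cycle E (t # B @ s # A)"
    using chordless_cycle_rotate[OF sym, of "s # A" "t # B"] C by simp
  have "length B + length P + 2 = k"
  proof (rule ear_length[OF sym k _ _ _ P])
    show "chordless_path E (t # B @ [s])"
      using chordless_cycle_arc[of E "[]" "t # B @ [s]" A] C' no by simp
  qed (use X inner in auto)
  ultimately show False using no PQ by simp
qed

text \<open>Two neighbours split \<open>C\<close> into arcs with A and B inside; through u they
  close to cycles of lengths |A| + 3 and |B| + 3. Both are at least k, while |A| + |B| + 2 = k, so k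
  <= 4.\<close>

lemma outside_vertex_attachment:
  assumes "symp E" and k: "\<And>C. chordless_cycle E C \<Longrightarrow> length C = k" "5 \<le> k"
    and C: "chordless_cycle E C" and u: "u \<notin> set C" "s \<in> set C" "t \<in> set C" "E u s" "E u t"
  shows "s = t"
proof (rule ccontr)
  assume "s \<noteq> t"
  then obtain A B where AB: "chordless_cycle E (s # A @ t # B)" "set (s # A @ t # B) = set C"
    using chordless_cycle_rotate_to2[OF assms(1) C u(2,3)] by metis
  have uAB: "u \<notin> set (s # A @ t # B)" using AB(2) u(1) by simp
  have cyc: "cycle E (s # A @ t # B)" using AB(1) by (simp add: chordless_cycle_def)
  have "cycle E (u # s # A @ [t])"
    using cyc uAB u sympD[OF assms(1) u(5)]
    by (cases A) (auto simp: cycle_def successively_append_iff successively_Cons hd_append split: if_splits)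
  moreover have "cycle E (u # t # B @ [s])"
    using cyc uAB u sympD[OF assms(1) u(4)]
    by (cases B) (auto simp: cycle_def successively_append_iff successively_Cons hd_append split: if_splits)
  ultimately have "k \<le> length A + 3" "k \<le> length B + 3"
    using cycle_length_ge[OF assms(1) k(1)] by fastforce+
  moreover have "length A + length B + 2 = k" using k(1)[OF AB(1)] by simp
  ultimately show False using k(2) by linarith
qed

text \<open>Write p, d, r for the lengths of \<open>P\<close>, \<open>D\<close>, \<open>R\<close>.
  The set \<open>Y\<close> forces p = 0 or p = d + r + 1, and \<open>X\<close> forces r = 0 or r = p
  + d + 1. A shortest link \<open>Q\<close> through \<open>K\<close> between y and x has length k -
  2 - d. In the surviving cases p + r = d + 1, and replacing \<open>D\<close> by \<open>Q\<close> in
  the cycle gives length k + 2.\<close>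

lemma three_attachments_impossible:
  assumes sym: "symp E" and k: "\<And>C. chordless_cycle E C \<Longrightarrow> length C = k" "5 \<le> k"
    and C: "chordless_cycle E (z # P @ x # D @ y # R)"
    and K: "connected_in E K" "K \<inter> set (z # P @ x # D @ y # R) = {}" "attachments E K (set (z # P @ x # D @ y # R)) = {x, y, z}"
    and X: "connected_in E X" "X \<subseteq> K" "attachments E X (set (z # P @ x # D @ y # R)) = {y, z}"
    and Y: "connected_in E Y" "Y \<subseteq> K" "attachments E Y (set (z # P @ x # D @ y # R)) = {x, z}"
  shows False
proof -
  let ?C = "z # P @ x # D @ y # R"
  have len: "length P + length D + length R + 3 = k" using k(1)[OF C] by simp
  have cyc: "cycle E ?C" using C by (simp add: chordless_cycle_def)
  have "P = [] \<or> D @ y # R = [] \<or> length P = length (D @ y # R)"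
    by (rule pair_attachment_arcs[OF sym k(1), where s = z and t = x and X = Y])
      (use C K Y in \<open>auto simp: insert_commute\<close>)
  then have 1: "P = [] \<or> length P = length D + length R + 1" by auto
  have C': "chordless_cycle E (y # R @ z # (P @ x # D))"
    using chordless_cycle_rotate[OF sym, of "z # P @ x # D" "y # R"] C by simp
  have eq: "set (y # R @ z # (P @ x # D)) = set ?C" by auto
  have "R = [] \<or> P @ x # D = [] \<or> length R = length (P @ x # D)"
    by (rule pair_attachment_arcs[OF sym k(1) C' X(1)])
      (use K X in \<open>auto simp only: eq\<close>)
  then have 2: "R = [] \<or> length R = length P + length D + 1" by auto
  obtain u v where uv: "u \<in> K" "E y u" "v \<in> K" "E v x"
    using K(3) sym by (auto simp: attachments_def set_eq_iff dest: sympD) (metis sympD)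
  obtain Q where Q: "link E K y x Q" "\<And>Q'. link E K y x Q' \<Longrightarrow> length Q \<le> length Q'"
    using shortest_link[OF K(1) uv] by metis
  have Q0: "Q \<noteq> []" "set Q \<subseteq> K" "successively E Q" "E y (hd Q)" "E (last Q) x"
    using Q(1) by (auto simp: link_def)
  have dist: "distinct ?C" using cyc by (simp add: cycle_def)
  have inner: "\<not> E u a" if "u \<in> K" "a \<in> set D" for u a
    using that K(3) dist by (auto simp: attachments_def set_eq_iff)
  have 3: "length D + length Q + 2 = k"
  proof (rule ear_length[OF sym k(1) _ _ _ Q])
    show "chordless_path E (x # D @ [y])"
      using chordless_cycle_arc[of E "z # P" "x # D @ [y]" R] C by simp
  qed (use K inner in auto)
  have "length Q \<noteq> 1"
  proof
    assume "length Q = 1"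
    then obtain q where "Q = [q]" by (auto simp: length_Suc_conv)
    then have "q \<in> K" "E q y" "E q x" using Q0 sym by (auto dest: sympD)
    then show False
      using outside_vertex_attachment[OF sym k C, of q x y] K(2) dist by auto
  qed
  have PR: "P = [] \<and> length R = length D + 1 \<or> R = [] \<and> length P = length D + 1"
  proof (cases "P = []")
    case True
    \<comment> \<open>If \<open>R\<close> were empty too, then d = k - 3 and \<open>Q\<close> would
      be a single vertex with the two neighbours x and y on the cycle.\<close>
    with len 3 \<open>length Q \<noteq> 1\<close> have "R \<noteq> []" by fastforce
    with 2 True show ?thesis by simp
  next
    case False
    with 1 have *: "length P = length D + length R + 1" by simp
    then have "R = []" using 2 by linarith
    with * show ?thesis by simp
  qed
  have dQ: "distinct Q" using shortest_link_chordless(1)[OF Q] by (simp add: chordless_path_def)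
  have QC: "set Q \<inter> set ?C = {}" using Q0 K(2) by auto
  have "cycle E (z # P @ x # rev Q @ y # R)"
  proof -
    have "successively E (rev Q)" using Q0(3) sym by (auto simp: symp_def elim: successively_mono)
    moreover have "successively E (z # P @ [x])" "successively E (y # R)"
      using cyc
      by (auto simp: cycle_def successively_append_iff successively_Cons hd_append split: if_splits)
    moreover have "successively E (rev Q @ y # R)"
      unfolding successively_append_iff
      using calculation Q0(1) sympD[OF sym Q0(4)] by (simp add: last_rev)
    ultimately have "successively E ((z # P @ [x]) @ rev Q @ y # R)"
      unfolding successively_append_iff[of _ "z # P @ [x]"]
      using Q0(1) sympD[OF sym Q0(5)] by (simp add: hd_append hd_rev)
    then show ?thesis using cyc QC dQ by (simp add: cycle_def) auto
  qed
  \<comment> \<open>The length is k + 2, and k + 2 < 2 * k - 2 because 5 <= k.\<close>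
  from cycle_length_gap[OF sym k(1) this] show False using PR len 3 k(2) by auto
qed

theorem thin_if_cycle_length:
  assumes sym: "symp E" and k: "\<And>C. chordless_cycle E C \<Longrightarrow> length C = k" "5 \<le> k"
  shows "thin E"
proof (rule ccontr)
  assume "\<not> thin E"
  then obtain C K0 where C: "chordless_cycle E C" and K0: "finite K0" "connected_in E K0"
    "K0 \<inter> set C = {}" "\<not> card (attachments E K0 (set C)) \<le> 2"
    by (simp only: thin_def not_all not_imp) blast
  let ?bad = "\<lambda>K. finite K \<and> connected_in E K \<and> K \<inter> set C = {} \<and> 3 \<le> card (attachments E K (set C))"
  have "?bad K0" using K0 by simp
  then obtain K where "?bad K" and min: "\<And>L. ?bad L \<Longrightarrow> card K \<le> card L"
    using arg_min_nat_lemma[of ?bad K0 card] by blast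
  then have K: "finite K" "connected_in E K" "K \<inter> set C = {}" "3 \<le> card (attachments E K (set C))"
    by auto
  let ?N = "\<lambda>L. attachments E L (set C)"
  have fin: "finite (?N L)" for L by (simp add: attachments_def)
  have N_Un: "?N (L \<union> M) = ?N L \<union> ?N M" for L M by (auto simp: attachments_def)
  have N1: "\<exists>x. ?N {u} \<subseteq> {x}" if "u \<in> K" for u
  proof (cases "?N {u} = {}")
    case False
    then obtain x where x: "x \<in> set C" "E u x" by (auto simp: attachments_def)
    have "u \<notin> set C" using K(3) that by auto
    then have "?N {u} \<subseteq> {x}"
      using outside_vertex_attachment[OF sym k C _ _ x(1) _ x(2)] by (auto simp: attachments_def)
    then show ?thesis ..
  qed simp
  \<comment> \<open>By minimality \<open>K - {u}\<close> has at most two attachments, and u has at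
    most one. As \<open>K\<close> has at least three, u must contribute exactly one that no other
    vertex of \<open>K\<close> provides.\<close>
  have small: "\<exists>x. ?N {u} = {x} \<and> x \<notin> ?N (K - {u}) \<and> card (?N (K - {u})) = 2 \<and> ?N K = insert x (?N (K - {u}))"
    if u: "u \<in> K" "connected_in E (K - {u})" for u
  proof -
    have "\<not> ?bad (K - {u})" using min[of "K - {u}"] card_Diff1_less[OF K(1) u(1)] by linarith
    then have le: "card (?N (K - {u})) \<le> 2" using u K by auto
    have eq: "?N K = ?N {u} \<union> ?N (K - {u})" using N_Un[of "{u}" "K - {u}"] u by (simp add: insert_absorb)
    obtain x where x: "?N {u} \<subseteq> {x}" using N1[OF u(1)] by auto
    have "\<not> ?N {u} \<subseteq> ?N (K - {u})"
    proof
      assume "?N {u} \<subseteq> ?N (K - {u})"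
      then have "?N K = ?N (K - {u})" using eq by (simp only: Un_absorb1)
      with le K(4) show False by simp
    qed
    then have "?N {u} = {x}" "x \<notin> ?N (K - {u})" using x by auto
    moreover from this have "?N K = insert x (?N (K - {u}))" using eq by simp
    ultimately show ?thesis using K(4) le fin by (intro exI[of _ x]) auto
  qed
  have "K \<noteq> {}" using K(4) by (auto simp: attachments_def)
  then obtain w where w: "w \<in> K" by auto
  have big: "K \<noteq> {v}" for v
  proof
    assume "K = {v}"
    then obtain x where "?N K \<subseteq> {x}" using N1[of v] by auto
    from card_mono[OF _ this] K(4) show False by simp
  qed
  obtain u where u: "u \<in> K" "connected_in E (K - {u})"
    using exists_non_cut_vertex[OF sym K(1,2) w big] by metis
  \<comment> \<open>Keeping u as the protected vertex makes the second non-cut vertex different from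
    the first.\<close>
  obtain v where v: "v \<in> K" "v \<noteq> u" "connected_in E (K - {v})"
    using exists_non_cut_vertex[OF sym K(1,2) u(1) big] by metis
  obtain x where x: "?N {u} = {x}" "x \<notin> ?N (K - {u})" "card (?N (K - {u})) = 2"
    "?N K = insert x (?N (K - {u}))" using small[OF u] by auto
  obtain y where y: "?N {v} = {y}" "y \<notin> ?N (K - {v})" "?N K = insert y (?N (K - {v}))"
    using small[OF v(1,3)] by auto
  \<comment> \<open>The vertex v, to which y is attached, survives the deletion of u; hence y
    differs from x, and z is the third attachment.\<close>
  have "y \<in> ?N (K - {u})" using y(1) v(1,2) by (auto simp: attachments_def set_eq_iff)
  moreover obtain a b where "?N (K - {u}) = {a, b}" "a \<noteq> b" using x(3) by (auto simp: card_2_iff)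
  ultimately obtain z where z: "?N (K - {u}) = {y, z}" "y \<noteq> z"
    by (metis insert_commute insertE singletonD)
  have xyz: "x \<noteq> y" "x \<noteq> z" "?N K = {x, y, z}" using x z by auto
  then have Nv: "?N (K - {v}) = {x, z}" using y(2,3) z(2) by auto
  have "{x, y, z} \<subseteq> set C" using xyz by (auto simp: attachments_def)
  then obtain P S where PS: "chordless_cycle E (z # P @ x # S)" "set (z # P @ x # S) = set C"
    using chordless_cycle_rotate_to2[OF sym C, of z x] xyz by (metis insert_subset)
  \<comment> \<open>The two cyclic orders of x, y, z differ by exchanging the roles of x and y, and
    with them those of u and v.\<close>
  then have "y \<in> set P \<or> y \<in> set S" using \<open>{x, y, z} \<subseteq> set C\<close> xyz z(2) by auto
  then show False
  proof
    assume "y \<in> set S"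
    then obtain D R where S: "S = D @ y # R" by (meson split_list)
    show False
      by (rule three_attachments_impossible[OF sym k, of z P x D y R K "K - {u}" "K - {v}"])
        (use PS K u v xyz z Nv in \<open>simp_all add: S del: set_append set_simps\<close>)
  next
    assume "y \<in> set P"
    then obtain P' D where P: "P = P' @ y # D" by (meson split_list)
    show False
      by (rule three_attachments_impossible[OF sym k, of z P' y D x S K "K - {v}" "K - {u}"])
        (use PS K u v xyz z Nv in \<open>simp_all add: P insert_commute del: set_append set_simps\<close>)
  qed
qed

section \<open>Vertex elimination\<close>

text \<open>The eliminated vertex is not removed from the type but isolated, so the relation keeps
  its carrier; \<open>x \<noteq> y\<close> prevents a loop at a neighbour of v.\<close>

definition eliminate :: "('a \<Rightarrow> 'a \<Rightarrow> bool) \<Rightarrow> 'a \<Rightarrow> 'a \<Rightarrow> 'a \<Rightarrow> bool" where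
  "eliminate E v x y \<longleftrightarrow> x \<noteq> v \<and> y \<noteq> v \<and> x \<noteq> y \<and> (E x y \<or> E x v \<and> E v y)"

lemma symp_eliminate: "symp E \<Longrightarrow> symp (eliminate E v)"
  by (auto simp: symp_def eliminate_def)

lemma irreflp_eliminate: "irreflp (eliminate E v)"
  by (auto simp: irreflp_def eliminate_def)

text \<open>An edge between two vertices of a chordless cycle belongs to the cycle, so a rotation
  turns it into the closing edge. This brings an edge created by elimination to the seam of the
  list, where v can be inserted.\<close>

lemma chordless_cycle_successive:
  assumes sym: "symp E" and C: "chordless_cycle E C" and xy: "x \<in> set C" "y \<in> set C" "E x y" "x \<noteq> y"
  obtains D where "chordless_cycle E (x # D)" "set (x # D) = set C" "last D = y" "D \<noteq> []"
    | D where "chordless_cycle E (y # D)" "set (y # D) = set C" "last D = x" "D \<noteq> []"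
proof -
  obtain A B where AB: "chordless_cycle E (x # A @ y # B)" "set (x # A @ y # B) = set C"
    using chordless_cycle_rotate_to2[OF sym C xy(1,2,4)] by metis
  then have "A = [] \<or> B = []" using chordless_cycleD[of E "[]" x A y B] xy(3) by simp
  then show thesis
  proof
    assume "B = []"
    then show thesis using that(1)[of "A @ [y]"] AB by simp
  next
    assume "A = []"
    then have "chordless_cycle E (y # B @ [x])" "set (y # B @ [x]) = set C"
      using chordless_cycle_rotate[OF sym, of "[x]" "y # B"] AB by auto
    then show thesis using that(2)[of "B @ [x]"] by simp
  qed
qed

text \<open>A step along a new edge is rerouted through v, which \<open>L\<close> contains whenever
  \<open>K\<close> has such a pair of vertices.\<close>

lemma connected_in_eliminate:
  assumes sym: "symp E" and K: "connected_in (eliminate E v) K"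
    and L: "K \<subseteq> L" "\<And>x y. x \<in> K \<Longrightarrow> y \<in> K \<Longrightarrow> E x v \<Longrightarrow> E v y \<Longrightarrow> x \<noteq> y \<Longrightarrow> v \<in> L"
    and x: "x \<in> K" "y \<in> K"
  shows "(\<lambda>a b. E a b \<and> a \<in> L \<and> b \<in> L)\<^sup>*\<^sup>* x y"
proof -
  let ?R = "\<lambda>a b. E a b \<and> a \<in> L \<and> b \<in> L"
  have "(\<lambda>a b. eliminate E v a b \<and> a \<in> K \<and> b \<in> K)\<^sup>*\<^sup>* x y"
    using K x by (simp add: connected_in_def)
  then show ?thesis
  proof (induction rule: rtranclp_induct)
    case (step y z)
    have "?R\<^sup>*\<^sup>* y z"
    proof (cases "E y z")
      case True
      then show ?thesis using step(2) L(1) by (intro r_into_rtranclp) auto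
    next
      case False
      then have yz: "E y v" "E v z" "y \<in> K" "z \<in> K" "y \<noteq> z" using step(2) by (auto simp: eliminate_def)
      then have "v \<in> L" using L(2) by blast
      then have "?R y v" "?R v z" using yz L(1) by auto
      then show ?thesis
        using converse_rtranclp_into_rtranclp[of ?R y v z, OF _ r_into_rtranclp[of ?R v z]] by simp
    qed
    then show ?case using step.IH by (meson rtranclp_trans)
  qed simp
qed

text \<open>If \<open>C\<close> uses a new edge pq, subdividing it by v gives a chordless cycle of
  \<open>E\<close>. As p and q are all the neighbours of v, the set \<open>K\<close> gains no edge
  from v and stays connected in \<open>E\<close>. Otherwise \<open>C\<close> is chordless in
  \<open>E\<close> already, and v is added to \<open>K\<close> when adjacent to it. In both cases no
  attachment is lost.\<close>

lemma thin_eliminate: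
  assumes sym: "symp E" and irr: "irreflp E" and thin: "thin E"
    and deg: "finite {j. E v j}" "card {j. E v j} \<le> 2"
  shows "thin (eliminate E v)"
  unfolding thin_def
proof (intro allI impI)
  fix C K
  let ?F = "eliminate E v"
  assume C: "chordless_cycle ?F C" and K: "finite K" "connected_in ?F K" "K \<inter> set C = {}"
  note symF = symp_eliminate[OF sym, of v]
  have vC: "v \<notin> set C"
  proof
    assume "v \<in> set C"
    then obtain A where A: "chordless_cycle ?F (v # A)" using chordless_cycle_rotate_to[OF symF C] by metis
    then have "?F v (hd A)" "A \<noteq> []"
      by (auto simp: chordless_cycle_def cycle_def successively_Cons)
    then show False by (simp add: eliminate_def)
  qed
  have sub: "?F x y" if "E x y" "x \<noteq> v" "y \<noteq> v" for x y
    using that irr by (auto simp: eliminate_def irreflp_def)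
  show "card (attachments ?F K (set C)) \<le> 2"
  proof (cases "v \<in> K")
    case True
    have "K = {v}"
    proof (rule ccontr)
      assume "K \<noteq> {v}"
      then obtain u where "u \<in> K" "u \<noteq> v" using True by auto
      then have "(\<lambda>a b. ?F a b \<and> a \<in> K \<and> b \<in> K)\<^sup>*\<^sup>* v u" using K True by (auto simp: connected_in_def)
      then show False
        by (cases rule: converse_rtranclpE) (use \<open>u \<noteq> v\<close> in \<open>auto simp: eliminate_def\<close>)
    qed
    then have "attachments ?F K (set C) = {}" by (auto simp: attachments_def eliminate_def)
    then show ?thesis by simp
  next
    case vK: False
    show ?thesis
    proof (cases "\<exists>p\<in>set C. \<exists>q\<in>set C. ?F p q \<and> \<not> E p q")
      case True
      then obtain p0 q0 where pq0: "p0 \<in> set C" "q0 \<in> set C" "?F p0 q0" "\<not> E p0 q0" by blast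
      then have "p0 \<noteq> q0" by (simp add: eliminate_def)
      obtain p q D where D: "chordless_cycle ?F (q # D)" "set (q # D) = set C" "last D = p" "D \<noteq> []"
        and pq: "?F p q" "\<not> E p q"
        using chordless_cycle_successive[OF symF C pq0(1-3) \<open>p0 \<noteq> q0\<close>] pq0(3,4) sym symF
        by (metis sympD)
      have Evpq: "E p v" "E v q" "E v p" "E q v" "p \<noteq> q"
        using pq sym by (auto simp: eliminate_def dest: sympD)
      have nbr: "{j. E v j} = {p, q}"
      proof (rule card_seteq[symmetric])
        show "card {j. E v j} \<le> card {p, q}" using deg Evpq by simp
      qed (use deg Evpq in auto)
      have pC: "p \<in> set C" using D(2,3,4) last_in_set by fastforce
      have qC: "q \<in> set C" using D(2) by auto
      have dist: "distinct (q # D)" using D(1) by (simp add: chordless_cycle_def cycle_def)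
      \<comment> \<open>With only two neighbours of v, elimination creates no edge other than
        pq.\<close>
      have FE: "E x y" if "?F x y" "{x, y} \<noteq> {p, q}" for x y
        using that nbr sym irr
        by (auto simp: eliminate_def irreflp_def set_eq_iff doubleton_eq_iff dest: sympD)
      have len: "2 \<le> length D" using D(1) by (simp add: chordless_cycle_def cycle_def)
      obtain D' where D': "D = D' @ [p]" using D(3,4) by (metis append_butlast_last_id)
      have "D' \<noteq> []" using len D' by auto
      have E: "successively E (q # D)"
      proof -
        have "successively ?F ((q # D') @ [p])"
          using D(1) D' by (simp add: chordless_cycle_def cycle_def)
        then have "successively ?F (q # D')" "?F (last D') p"
          using \<open>D' \<noteq> []\<close> unfolding successively_append_iff by simp_all
        moreover have "successively E (q # D')"
          by (rule successively_mono[OF calculation(1)])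
            (use FE dist D' Evpq in \<open>auto simp: doubleton_eq_iff\<close>)
        moreover have "last D' \<noteq> q" "last D' \<noteq> p"
          using dist D' last_in_set[OF \<open>D' \<noteq> []\<close>] by auto
        then have "E (last D') p" using FE calculation(2) by (auto simp: doubleton_eq_iff)
        ultimately have "successively E ((q # D') @ [p])"
          unfolding successively_append_iff using \<open>D' \<noteq> []\<close> by simp
        then show ?thesis using D' by simp
      qed
      have "chordless_path E (q # D)"
        unfolding chordless_path_def
      proof (intro conjI allI impI)
        show "distinct (q # D)" "successively E (q # D)" by fact+
        fix xs a ys b zs assume eq: "q # D = xs @ a # ys @ b # zs" and ab: "E a b"
        have abC: "a \<in> set C" "b \<in> set C" unfolding D(2)[symmetric] eq by auto
        then have "?F a b" using sub ab vC by auto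
        then have or: "ys = [] \<or> xs = [] \<and> zs = []" using D(1) chordless_cycleD eq by metis
        show "ys = []"
        proof (rule ccontr)
          assume "ys \<noteq> []"
          with or have "q # D = a # ys @ [b]" using eq by simp
          then have "a = q" "b = p" using D(3) by auto
          then show False using ab pq sym by (auto dest: sympD)
        qed
      qed
      moreover have "chordless_path E [v]" by (auto simp: chordless_path_def Cons_eq_append_conv)
      ultimately have "chordless_cycle E ((q # D) @ [v])"
      proof (rule chordless_path_join)
        show "set (q # D) \<inter> set [v] = {}" using D(2) vC by auto
        fix d j assume dj: "d \<in> set (q # D)" "j \<in> set [v]" "E d j"
        then have "d = p \<or> d = q" using nbr sym by (auto dest: sympD)
        then show "d = last (q # D) \<and> j = hd [v] \<or> d = hd (q # D) \<and> j = last [v]"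
          using dj D(3,4) by auto
      qed (use D Evpq len in auto)
      moreover have "connected_in E K"
        unfolding connected_in_def
      proof (intro ballI)
        fix x y assume xy: "x \<in> K" "y \<in> K"
        show "(\<lambda>a b. E a b \<and> a \<in> K \<and> b \<in> K)\<^sup>*\<^sup>* x y"
        proof (rule connected_in_eliminate[OF sym K(2) subset_refl _ xy])
          fix x y assume "x \<in> K" "E x v"
          then have "x \<in> {p, q}" using nbr sym by (auto dest: sympD)
          then show "v \<in> K" using \<open>x \<in> K\<close> K(3) pC qC by auto
        qed
      qed
      ultimately have le: "card (attachments E K (set ((q # D) @ [v]))) \<le> 2"
        using thinD[OF thin, of "(q # D) @ [v]" K] K vK D(2) by auto
      have "attachments ?F K (set C) \<subseteq> attachments E K (set ((q # D) @ [v]))"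
      proof
        fix c assume "c \<in> attachments ?F K (set C)"
        then obtain u where u: "u \<in> K" "c \<in> set C" "?F u c" by (auto simp: attachments_def)
        then have "{u, c} \<noteq> {p, q}" using K(3) pC qC by (auto simp: doubleton_eq_iff)
        then show "c \<in> attachments E K (set ((q # D) @ [v]))"
          using FE u D(2) by (auto simp: attachments_def)
      qed
      from card_mono[OF _ this] le show ?thesis by (auto simp: attachments_def)
    next
      case False
      then have FE: "E p q \<longleftrightarrow> ?F p q" if "p \<in> set C" "q \<in> set C" for p q
        using that sub vC by metis
      have "chordless_cycle E C"
        unfolding chordless_cycle_def
      proof (intro conjI allI impI)
        have "successively E C"
          by (rule successively_mono[of ?F]) (use C FE in \<open>auto simp: chordless_cycle_def cycle_def\<close>)
        moreover have "C \<noteq> []" using C by (auto simp: chordless_cycle_def cycle_def)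
        ultimately show "cycle E C"
          using C FE[of "last C" "hd C"] by (auto simp: chordless_cycle_def cycle_def)
        fix xs a ys b zs assume eq: "C = xs @ a # ys @ b # zs" and ab: "E a b"
        then have "?F a b" using FE[of a b] by auto
        then show "ys = [] \<or> xs = [] \<and> zs = []" using C chordless_cycleD eq by metis
      qed
      \<comment> \<open>An attachment of \<open>K\<close> along a new edge becomes an attachment of
        v itself, and connections of \<open>K\<close> through v are restored.\<close>
      moreover define L where "L = (if \<exists>u\<in>K. E u v then insert v K else K)"
      have R: "(\<lambda>a b. E a b \<and> a \<in> L \<and> b \<in> L)\<^sup>*\<^sup>* x y" if "x \<in> K" "y \<in> K" for x y
        by (rule connected_in_eliminate[OF sym K(2) _ _ that]) (auto simp: L_def)
      have "connected_in E L"
      proof (cases "\<exists>u\<in>K. E u v")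
        case True
        then obtain u where u: "u \<in> K" "E u v" by auto
        let ?R = "\<lambda>a b. E a b \<and> a \<in> L \<and> b \<in> L"
        have "?R u v" "?R v u" using u sym True by (auto simp: L_def dest: sympD)
        then have "?R\<^sup>*\<^sup>* a v" "?R\<^sup>*\<^sup>* v a" if "a \<in> K" for a
          using R[OF that u(1)] R[OF u(1) that] rtranclp.rtrancl_into_rtrancl[of ?R a u v]
            converse_rtranclp_into_rtranclp[of ?R v u a]
          by simp_all
        then show ?thesis unfolding connected_in_def using R True by (auto simp: L_def)
      next
        case False
        then have "L = K" by (simp add: L_def)
        then show ?thesis using R by (simp add: connected_in_def)
      qed
      ultimately have le: "card (attachments E L (set C)) \<le> 2"
        using thinD[OF thin, of C L] K vC by (auto simp: L_def)
      have "attachments ?F K (set C) \<subseteq> attachments E L (set C)"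
        by (auto simp: attachments_def L_def eliminate_def)
      from card_mono[OF _ this] le show ?thesis by (auto simp: attachments_def)
    qed
  qed
qed

section \<open>Vertices of degree at most two\<close>

lemma longest_path:
  assumes "finite F" "distinct P0" "successively E P0" "set P0 \<subseteq> F"
  obtains P where "distinct P" "successively E P" "set P \<subseteq> F" "length P0 \<le> length P"
    "\<And>Q. distinct Q \<Longrightarrow> successively E Q \<Longrightarrow> set Q \<subseteq> F \<Longrightarrow> length Q \<le> length P"
proof -
  let ?P = "\<lambda>P. distinct P \<and> successively E P \<and> set P \<subseteq> F"
  have "length P < Suc (card F)" if "?P P" for P
    using that assms(1) distinct_card[of P] card_mono[of F "set P"] by simp
  then obtain P where "?P P" "\<And>Q. ?P Q \<Longrightarrow> length Q \<le> length P"
    using ex_has_greatest_nat[of ?P P0 length "Suc (card F)"] assms by auto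
  then show thesis using that assms by blast
qed

text \<open>All neighbours of the first vertex of a longest path lie on the path, and one that is
  not its second vertex closes a cycle. The exempt vertex b can be at only one end, so reversing the
  path avoids it.\<close>

lemma exists_cycle:
  assumes sym: "symp E" and irr: "irreflp E" and F: "finite F" "F \<noteq> {}" "F \<noteq> {b}"
    and deg: "\<And>v. v \<in> F \<Longrightarrow> v \<noteq> b \<Longrightarrow> 2 \<le> card {j \<in> F. E v j}"
  obtains C where "cycle E C" "set C \<subseteq> F"
proof -
  obtain v where v: "v \<in> F" "v \<noteq> b" using F by auto
  have "{j \<in> F. E v j} \<noteq> {}"
  proof
    assume "{j \<in> F. E v j} = {}"
    with deg[OF v] show False by simp
  qed
  then obtain j where j: "j \<in> F" "E v j" by auto
  have "distinct [v, j]" "successively E [v, j]" "set [v, j] \<subseteq> F"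
    using v j irr by (auto simp: irreflp_def)
  then obtain P0 where P0: "distinct P0" "successively E P0" "set P0 \<subseteq> F" "2 \<le> length P0"
    "\<And>Q. distinct Q \<Longrightarrow> successively E Q \<Longrightarrow> set Q \<subseteq> F \<Longrightarrow> length Q \<le> length P0"
    using longest_path[OF F(1), of "[v, j]" E] by (metis length_Cons list.size(3) numeral_2_eq_2)
  define P where "P = (if hd P0 = b then rev P0 else P0)"
  have succ: "successively E (rev P0)" using P0(2) sym by (auto simp: symp_def elim: successively_mono)
  have P: "distinct P" "successively E P" "set P \<subseteq> F" "2 \<le> length P"
    "\<And>Q. distinct Q \<Longrightarrow> successively E Q \<Longrightarrow> set Q \<subseteq> F \<Longrightarrow> length Q \<le> length P"
    using P0 succ by (auto simp: P_def)
  obtain x y zs where xy: "P0 = x # y # zs" using P0(4) by (auto simp: Suc_le_length_iff numeral_2_eq_2)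
  have "last P0 \<noteq> hd P0" using P0(1) xy by auto
  then have "hd P \<noteq> b" by (auto simp: P_def hd_rev)
  obtain h p T where hT: "P = h # p # T" using P(4) by (auto simp: Suc_le_length_iff numeral_2_eq_2)
  have h: "h \<in> F" "h \<noteq> b" using P(3) hT \<open>hd P \<noteq> b\<close> by auto
  have "\<not> {j \<in> F. E h j} \<subseteq> {p}"
  proof
    assume "{j \<in> F. E h j} \<subseteq> {p}"
    from card_mono[OF _ this] deg[OF h] show False by simp
  qed
  then obtain w where w: "w \<in> F" "E h w" "w \<noteq> p" by auto
  have "w \<in> set P"
  proof (rule ccontr)
    assume "w \<notin> set P"
    then have "length (w # P) \<le> length P"
      using P w hT sympD[OF sym w(2)] by (intro P(5)) auto
    then show False by simp
  qed
  moreover have "w \<noteq> h" using w(2) irr by (auto simp: irreflp_def)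
  ultimately have "w \<in> set T" using hT w by simp
  then obtain ys zs where T: "T = ys @ w # zs" by (meson split_list)
  have "successively E ((h # p # ys @ [w]) @ zs)" using P(2) hT T by simp
  then have "cycle E (h # p # ys @ [w])"
    unfolding successively_append_iff
    using P(1) hT T sympD[OF sym w(2)] by (auto simp: cycle_def)
  then show thesis using that P(3) hT T by auto
qed

theorem thin_low_degree:
  assumes sym: "symp E" and irr: "irreflp E" and thin: "thin E" and V: "finite V" "V \<noteq> {}"
  shows "\<exists>v\<in>V. card {j \<in> V. E v j} \<le> 2"
  using V
proof (induction "card V" arbitrary: V rule: less_induct)
  case less
  show ?case
  proof (rule ccontr)
    assume "\<not> ?thesis"
    then have deg: "3 \<le> card {j \<in> V. E v j}" if "v \<in> V" for v using that by force
    \<comment> \<open>The largest such K is used: absorbing any further vertex that keeps it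
      connected destroys all cycles outside.\<close>
    let ?P = "\<lambda>K. K \<subseteq> V \<and> connected_in E K \<and> (\<exists>C. cycle E C \<and> set C \<subseteq> V - K)"
    \<comment> \<open>Here \<open>undefined\<close> merely fills the slot of the exempt vertex in
      \<open>exists_cycle\<close>, as all degrees are large enough.\<close>
    have "V \<noteq> {b}" for b using deg irr by (auto simp: irreflp_def card_gt_0_iff Collect_conv_if)
    then have "V \<noteq> {undefined}" .
    moreover have "2 \<le> card {j \<in> V. E v j}" if "v \<in> V" for v using deg[OF that] by simp
    ultimately obtain C0 where "cycle E C0" "set C0 \<subseteq> V"
      using exists_cycle[OF sym irr less(2,3), of undefined] by blast
    then have "?P {}" by auto
    moreover have "card K < Suc (card V)" if "?P K" for K using that less(2) by (simp add: card_mono le_imp_less_Suc)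
    ultimately obtain K where "?P K" and max: "\<And>L. ?P L \<Longrightarrow> card L \<le> card K"
      using ex_has_greatest_nat[of ?P "{}" card "Suc (card V)"] by blast
    then obtain C1 where K: "K \<subseteq> V" "connected_in E K" and C1: "cycle E C1" "set C1 \<subseteq> V - K" by auto
    have finK: "finite K" using K less(2) finite_subset by auto
    obtain C where C: "chordless_cycle E C" "set C \<subseteq> V - K"
      using exists_chordless_cycle[OF sym C1(1)] C1(2) by (metis subset_trans)
    have cyc: "cycle E C" using C by (simp add: chordless_cycle_def)
    have no_cycle: "\<not> (cycle E C' \<and> set C' \<subseteq> V - insert s K)"
      if "s \<in> V - K" "connected_in E (insert s K)" for s C'
      using max[of "insert s K"] that K finK by auto
    let ?S = "attachments E K (V - K)"
    \<comment> \<open>If \<open>C\<close> avoided a neighbour s of \<open>K\<close>, it would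
      survive the absorption of s.\<close>
    have SC: "?S \<subseteq> set C"
    proof
      fix s assume "s \<in> ?S"
      then obtain u where u: "s \<in> V - K" "u \<in> K" "E u s" by (auto simp: attachments_def)
      then have "connected_in E (insert s K)" using connected_in_insert[OF sym K(2)] by blast
      from no_cycle[OF u(1) this, of C] cyc C(2) show "s \<in> set C" by auto
    qed
    have "attachments E K (set C) = ?S" using SC C(2) by (auto simp: attachments_def)
    then have S2: "card ?S \<le> 2" using thinD[OF thin C(1) finK K(2)] C(2) by auto
    have finS: "finite ?S" using SC finite_subset by auto
    have nbrs: "{j \<in> V - K. E v j} = {j \<in> V. E v j}" if "v \<in> V - K" "v \<notin> ?S" for v
      using that sym by (auto simp: attachments_def dest: sympD)
    \<comment> \<open>A vertex not adjacent to \<open>K\<close> has all its neighbours, at least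
      three, outside \<open>K\<close> and loses at most s.\<close>
    have del: "2 \<le> card {j \<in> V - insert s K. E v j}" if "v \<in> V - K" "v \<notin> ?S" for v s
    proof -
      have "{j \<in> V - insert s K. E v j} = {j \<in> V. E v j} - {s}" using nbrs[OF that] by auto
      moreover have "card {j \<in> V. E v j} - 1 \<le> card ({j \<in> V. E v j} - {s})"
        using less(2) diff_card_le_card_Diff[of "{s}" "{j \<in> V. E v j}"] by simp
      ultimately show ?thesis using deg[of v] that by auto
    qed
    consider (S) s where "s \<in> ?S" | (K) "?S = {}" "K \<noteq> {}" | (E) "K = {}" by auto
    then show False
    proof cases
      case S
      then obtain u where u: "s \<in> V - K" "u \<in> K" "E u s" by (auto simp: attachments_def)
      have conn: "connected_in E (insert s K)" using connected_in_insert[OF sym K(2)] u by blast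
      \<comment> \<open>Besides s at most one vertex b is adjacent to \<open>K\<close>; it becomes
        the exempt vertex for a cycle in the rest, against maximality.\<close>
      have "card (?S - {s}) \<le> 1" using S2 S finS by (simp add: card_Diff_singleton)
      then obtain b where b: "?S - {s} \<subseteq> {b}"
        using finS by (metis One_nat_def card_le_Suc0_iff_eq finite_Diff insertI1 subsetI equals0D)
      \<comment> \<open>\<open>C\<close> has a vertex other than s and b, so the rest is neither
        empty nor just b.\<close>
      have "3 \<le> card (set C)" using cyc distinct_card[of C] by (simp add: cycle_def)
      have "\<not> set C \<subseteq> {s, b}"
      proof
        assume "set C \<subseteq> {s, b}"
        from card_mono[OF _ this] \<open>3 \<le> card (set C)\<close> show False by (cases "s = b") auto
      qed
      then obtain c where c: "c \<in> V - insert s K" "c \<noteq> b" using C(2) by auto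
      obtain C' where "cycle E C'" "set C' \<subseteq> V - insert s K"
        using exists_cycle[OF sym irr, of "V - insert s K" b] less(2) c del b by blast
      with no_cycle[OF u(1) conn] show False by blast
    next
      case K
      \<comment> \<open>No edge leaves \<open>K\<close>, so degrees in \<open>V - K\<close> are
        degrees in \<open>V\<close> and the induction hypothesis applies.\<close>
      have "card (V - K) < card V" using K \<open>K \<subseteq> V\<close> by (intro psubset_card_mono[OF less(2)]) auto
      moreover have "V - K \<noteq> {}" using C(2) cyc by (cases C) (auto simp: cycle_def)
      ultimately obtain v where "v \<in> V - K" "card {j \<in> V - K. E v j} \<le> 2"
        using less(1)[of "V - K"] less(2) by blast
      with nbrs[of v] K deg[of v] show False by auto
    next
      case E
      \<comment> \<open>A single vertex is connected, so maximality of the empty set would make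
        \<open>V - {s}\<close> acyclic, although degrees there are still at least two.\<close>
      obtain s where s: "s \<in> V" using less(3) by auto
      have S: "?S = {}" using E by (auto simp: attachments_def)
      have "\<not> set C \<subseteq> {s, undefined}"
      proof
        assume "set C \<subseteq> {s, undefined}"
        from card_mono[OF _ this] cyc distinct_card[of C] show False
          by (cases "s = undefined") (auto simp: cycle_def)
      qed
      then obtain c where c: "c \<in> V - insert s K" "c \<noteq> undefined" using C(2) E by auto
      obtain C' where "cycle E C'" "set C' \<subseteq> V - insert s K"
        using exists_cycle[OF sym irr, of "V - insert s K" undefined] less(2) c del S by blast
      with no_cycle[of s C'] s E show False by auto
    qed
  qed
qed

section \<open>Minimising a sum of binary cost functions\<close>

text \<open>
  Assigning the value \<open>z \<in> {0, 1}\<close> to the variable \<open>i\<close> selects the index \<open>2 * i + z\<close>;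
  a matrix indexed in this way stores a cost for every pair of assignments, and the costs of single
  assignments on its diagonal.
\<close>

definition cost :: "nat set \<Rightarrow> (nat \<Rightarrow> nat \<Rightarrow> nat) \<Rightarrow> (nat \<Rightarrow> nat) \<Rightarrow> nat" where
  "cost R W x = (\<Sum>i\<in>R. \<Sum>j\<in>R. W (2 * i + x i) (2 * j + x j))"

definition binary :: "(nat \<Rightarrow> nat) \<Rightarrow> bool" where
  "binary x \<longleftrightarrow> (\<forall>i. x i < 2)"

definition optimal :: "nat set \<Rightarrow> (nat \<Rightarrow> nat \<Rightarrow> nat) \<Rightarrow> (nat \<Rightarrow> nat) \<Rightarrow> bool" where
  "optimal R W x \<longleftrightarrow> binary x \<and> (\<forall>y. binary y \<longrightarrow> cost R W x \<le> cost R W y)"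

text \<open>The part of \<open>cost\<close> depending on the value z of v. Both orientations are
  read because the matrix is not symmetric: a message is stored for one ordered pair only.\<close>

definition local_cost :: "(nat \<Rightarrow> nat \<Rightarrow> nat) \<Rightarrow> nat \<Rightarrow> nat \<Rightarrow> nat \<Rightarrow> nat \<Rightarrow> nat \<Rightarrow> nat \<Rightarrow> nat" where
  "local_cost W v a d z p q =
     W (2 * v + z) (2 * v + z) + W (2 * v + z) (2 * a + p) + W (2 * a + p) (2 * v + z) +
     W (2 * v + z) (2 * d + q) + W (2 * d + q) (2 * v + z)"

text \<open>The message of min-sum variable elimination (nonserial dynamic programming).\<close>

definition message :: "(nat \<Rightarrow> nat \<Rightarrow> nat) \<Rightarrow> nat \<Rightarrow> nat \<Rightarrow> nat \<Rightarrow> nat \<Rightarrow> nat \<Rightarrow> nat" where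
  "message W v a d p q = min (local_cost W v a d 0 p q) (local_cost W v a d 1 p q)"

definition choice :: "(nat \<Rightarrow> nat \<Rightarrow> nat) \<Rightarrow> nat \<Rightarrow> nat \<Rightarrow> nat \<Rightarrow> (nat \<Rightarrow> nat) \<Rightarrow> nat" where
  "choice W v a d x =
     (if local_cost W v a d 1 (x a) (x d) < local_cost W v a d 0 (x a) (x d) then 1 else 0)"

definition add_message ::
  "(nat \<Rightarrow> nat \<Rightarrow> nat) \<Rightarrow> nat \<Rightarrow> nat \<Rightarrow> (nat \<Rightarrow> nat \<Rightarrow> nat) \<Rightarrow> nat \<Rightarrow> nat \<Rightarrow> nat" where
  "add_message W a b m l k =
     W l k + (if l div 2 = a \<and> k div 2 = b then m (l mod 2) (k mod 2) else 0)"

text \<open>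
  The message of an eliminated variable with neighbours \<open>N\<close> is stored at \<open>(a, b)\<close> and computed
  from the matrix entries at \<open>a\<close> and \<open>d\<close>.  The index \<open>n\<close> is a dummy: its matrix entries
  shared with genuine variables vanish.
\<close>

definition neighbourhood :: "nat \<Rightarrow> nat set \<Rightarrow> nat \<Rightarrow> nat \<Rightarrow> nat \<Rightarrow> bool" where
  "neighbourhood n N a b d \<longleftrightarrow>
     N = {} \<and> a = n \<and> b = n \<and> d = n \<or> N = {a} \<and> b = a \<and> d = n \<or> N = {a, b} \<and> a < b \<and> d = b"

text \<open>The diagonal block of i is left free, since it holds costs of single assignments. The
  block of n with itself is also free: it collects the messages of variables eliminated without
  neighbours.\<close>

definition supported :: "nat \<Rightarrow> nat set \<Rightarrow> (nat \<Rightarrow> nat \<Rightarrow> bool) \<Rightarrow> (nat \<Rightarrow> nat \<Rightarrow> nat) \<Rightarrow> bool" where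
  "supported n R E W \<longleftrightarrow> (\<forall>i\<in>R. \<forall>p<2. \<forall>q<2.
     (\<forall>j\<in>R. i \<noteq> j \<longrightarrow> \<not> E i j \<longrightarrow> W (2 * i + p) (2 * j + q) = 0) \<and>
     W (2 * i + p) (2 * n + q) = 0 \<and> W (2 * n + q) (2 * i + p) = 0)"

lemma supportedD:
  assumes "supported n R E W" "i \<in> R" "p < 2" "q < 2"
  shows "j \<in> R \<Longrightarrow> i \<noteq> j \<Longrightarrow> \<not> E i j \<Longrightarrow> W (2 * i + p) (2 * j + q) = 0"
    "W (2 * i + p) (2 * n + q) = 0" "W (2 * n + q) (2 * i + p) = 0"
  using assms unfolding supported_def by blast+

lemma binaryD: "binary x \<Longrightarrow> x i < 2"
  by (simp add: binary_def)

lemma index_div_mod [simp]: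
  fixes p :: nat
  assumes "p < 2"
  shows "(2 * i + p) div 2 = i" "(2 * i + p) mod 2 = p"
  using assms less_2_cases[OF assms] by auto

lemma index_le: "i \<le> n \<Longrightarrow> p < 2 \<Longrightarrow> 2 * i + p \<le> 2 * n + (1::nat)"
  by linarith

lemma cost_remove:
  assumes "finite R" "v \<in> R"
  shows "cost R W x = cost (R - {v}) W x + W (2 * v + x v) (2 * v + x v) +
    (\<Sum>j\<in>R - {v}. W (2 * v + x v) (2 * j + x j) + W (2 * j + x j) (2 * v + x v))"
proof -
  define R' where "R' = R - {v}"
  have R: "R = insert v R'" "v \<notin> R'" "finite R'" using assms by (auto simp: R'_def)
  have "cost R W x = cost (R - {v}) W x + W (2 * v + x v) (2 * v + x v) +
    (\<Sum>j\<in>R - {v}. W (2 * v + x v) (2 * j + x j) + W (2 * j + x j) (2 * v + x v))"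
    using R(2,3) by (simp add: cost_def sum.distrib R(1))
  then show ?thesis .
qed

text \<open>Non-neighbours of v contribute nothing by support, and neither does the dummy, so the
  three shapes of a neighbourhood share one formula.\<close>

lemma cost_local:
  assumes R: "finite R" "v \<in> R" "n \<notin> R" and E: "symp E" "\<And>i j. E i j \<Longrightarrow> j \<in> R" "\<not> E v v"
    and supp: "supported n R E W" and nb: "neighbourhood n {j. E v j} a b d" and x: "binary x"
  shows "cost R W x = cost (R - {v}) W x + local_cost W v a d (x v) (x a) (x d)"
proof -
  let ?f = "\<lambda>j. W (2 * v + x v) (2 * j + x j) + W (2 * j + x j) (2 * v + x v)"
  define N where "N = {j. E v j}"
  have N: "N \<subseteq> R - {v}" using E by (auto simp: N_def)
  have "?f j = 0" if "j \<in> R - {v} - N" for j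
    using that supportedD(1)[OF supp, of v "x v" "x j" j] supportedD(1)[OF supp, of j "x j" "x v" v]
      R binaryD[OF x] sympD[OF E(1), of j v] by (auto simp: N_def)
  then have "sum ?f (R - {v}) = sum ?f N"
    using R N by (intro sum.mono_neutral_right) auto
  moreover have "?f n = 0" using supportedD(2,3)[OF supp R(2), of "x v" "x n"] x by (simp add: binaryD)
  then have "W (2 * v + x v) (2 * v + x v) + sum ?f N = local_cost W v a d (x v) (x a) (x d)"
    using nb unfolding N_def[symmetric] by (auto simp: neighbourhood_def local_cost_def)
  ultimately show ?thesis using cost_remove[OF R(1,2), of W x] by simp
qed

lemma cost_add_message:
  assumes "finite R" "binary x"
  shows "cost R (add_message W a b m) x = cost R W x + (if a \<in> R \<and> b \<in> R then m (x a) (x b) else 0)"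
proof -
  have "(\<Sum>i\<in>R. \<Sum>j\<in>R. if i = a \<and> j = b then m (x i) (x j) else 0) =
      (\<Sum>i\<in>R. if i = a then (\<Sum>j\<in>R. if j = b then m (x i) (x j) else 0) else 0)"
    by (intro sum.cong refl) simp
  also have "\<dots> = (if a \<in> R \<and> b \<in> R then m (x a) (x b) else 0)"
    using assms(1) by (simp add: sum.delta)
  finally have eq: "(\<Sum>i\<in>R. \<Sum>j\<in>R. if i = a \<and> j = b then m (x i) (x j) else 0) =
      (if a \<in> R \<and> b \<in> R then m (x a) (x b) else 0)" .
  have "add_message W a b m (2 * i + x i) (2 * j + x j) =
      W (2 * i + x i) (2 * j + x j) + (if i = a \<and> j = b then m (x i) (x j) else 0)" for i j
    using binaryD[OF assms(2)] by (simp only: add_message_def index_div_mod)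
  then show ?thesis by (simp add: cost_def sum.distrib eq)
qed

lemma local_cost_choice:
  "local_cost W v a d (choice W v a d x) (x a) (x d) = message W v a d (x a) (x d)"
  by (simp add: choice_def message_def min_def)

lemma message_le: "z < 2 \<Longrightarrow> message W v a d p q \<le> local_cost W v a d z p q"
  by (drule less_2_cases) (auto simp: message_def)

text \<open>For a fixed assignment of the other variables, the best value of v adds exactly its
  message. Minimising the remaining cost with the message added, and then choosing v, is therefore
  optimal.\<close>

lemma optimal_eliminate:
  assumes R: "finite R" "v \<in> R" "n \<notin> R" and E: "symp E" "\<And>i j. E i j \<Longrightarrow> j \<in> R" "\<not> E v v"
    and supp: "supported n R E W" and nb: "neighbourhood n {j. E v j} a b d"
    and opt: "optimal (R - {v}) (add_message W a b (message W v a d)) x"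
  shows "optimal R W (x(v := choice W v a d x))"
proof -
  let ?W = "add_message W a b (message W v a d)" and ?m = "message W v a d"
  have v: "v \<noteq> a" "v \<noteq> b" "v \<noteq> d" and ab: "a \<in> R - {v} \<and> b \<in> R - {v} \<or> a = n \<and> d = n"
    and abd: "a \<in> R - {v} \<Longrightarrow> d = b \<or> d = n"
    using nb R E by (auto simp: neighbourhood_def)
  \<comment> \<open>With a single neighbour, b = a while d is the dummy; the last argument then has
    no influence, so reading the message at b or at d is the same.\<close>
  have dummy: "local_cost W v a n z p q = local_cost W v a n z p 0"
    if "z < 2" "q < 2" for z p q
    using supportedD(2,3)[OF supp R(2) \<open>z < 2\<close>, of q] supportedD(2,3)[OF supp R(2) \<open>z < 2\<close>, of 0] that
    by (simp add: local_cost_def)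
  have dummy2: "local_cost W v n n z p q = local_cost W v n n z 0 0"
    if "z < 2" "p < 2" "q < 2" for z p q
    using supportedD(2,3)[OF supp R(2) \<open>z < 2\<close>, of p] supportedD(2,3)[OF supp R(2) \<open>z < 2\<close>, of q]
      supportedD(2,3)[OF supp R(2) \<open>z < 2\<close>, of 0] that
    by (simp add: local_cost_def)
  \<comment> \<open>The message of an isolated variable goes to the dummy block, which
    \<open>cost\<close> over \<open>R - {v}\<close> does not see; it is a constant that does not
    affect optimality.\<close>
  define c where "c = (if a \<in> R - {v} then 0 else ?m 0 0)"
  have m: "cost (R - {v}) ?W y + c = cost (R - {v}) W y + ?m (y a) (y d)" if y: "binary y" for y
  proof (cases "a \<in> R - {v}")
    case True
    then have "?m (y a) (y b) = ?m (y a) (y d)"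
      using abd[OF True] dummy[of _ "y b"] dummy[of _ "y d"] y by (auto simp: message_def binaryD)
    then show ?thesis using True ab R by (auto simp: cost_add_message[OF _ y] c_def)
  next
    case False
    then have "a = n" "d = n" using ab by auto
    then have "?m (y a) (y d) = ?m 0 0" using dummy2[of _ "y a" "y d"] y by (simp add: message_def binaryD)
    then show ?thesis using False R by (auto simp: cost_add_message[OF _ y] c_def)
  qed
  let ?x = "x(v := choice W v a d x)"
  have x: "binary x" using opt by (simp add: optimal_def)
  have x': "binary ?x" using x by (simp add: binary_def choice_def)
  have "cost R W ?x = cost (R - {v}) W ?x + local_cost W v a d (?x v) (?x a) (?x d)"
    using cost_local[OF R E(1) _ E(3) supp nb x'] E(2) by blast
  also have "cost (R - {v}) W ?x = cost (R - {v}) W x"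
    unfolding cost_def by (intro sum.cong) auto
  also have "local_cost W v a d (?x v) (?x a) (?x d) = ?m (x a) (x d)"
    using local_cost_choice v by simp
  also have "cost (R - {v}) W x + ?m (x a) (x d) = cost (R - {v}) ?W x + c" using m[OF x] by simp
  finally have eq: "cost R W ?x = cost (R - {v}) ?W x + c" .
  have "cost R W ?x \<le> cost R W y" if y: "binary y" for y
  proof -
    have "cost R W ?x \<le> cost (R - {v}) ?W y + c" using eq opt y by (simp add: optimal_def)
    also have "\<dots> \<le> cost (R - {v}) W y + local_cost W v a d (y v) (y a) (y d)"
      using m[OF y] message_le[OF binaryD[OF y]] by simp
    also have "\<dots> = cost R W y" using cost_local[OF R E(1) _ E(3) supp nb y] E(2) by simp
    finally show ?thesis .
  qed
  then show ?thesis using x' by (simp add: optimal_def)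
qed

text \<open>The message occupies the block of an edge created or already present, a diagonal block,
  or the dummy block, all of which support permits.\<close>

lemma supported_eliminate:
  assumes R: "v \<in> R" "n \<notin> R" and E: "symp E" "\<And>i j. E i j \<Longrightarrow> j \<in> R" "\<not> E v v"
    and supp: "supported n R E W" and nb: "neighbourhood n {j. E v j} a b d"
  shows "supported n (R - {v}) (eliminate E v) (add_message W a b m)"
  unfolding supported_def
proof (intro ballI allI impI conjI)
  fix i p q :: nat assume i: "i \<in> R - {v}" "p < 2" "q < 2"
  have ab: "a \<in> R \<and> b \<in> R \<or> a = n \<and> b = n" using nb E by (auto simp: neighbourhood_def)
  show "add_message W a b m (2 * i + p) (2 * n + q) = 0" "add_message W a b m (2 * n + q) (2 * i + p) = 0"
    using i ab R supportedD(2,3)[OF supp, of i p q] by (auto simp: add_message_def)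
  fix j assume j: "j \<in> R - {v}" "i \<noteq> j" "\<not> eliminate E v i j"
  then have "\<not> E i j" using i by (auto simp: eliminate_def)
  moreover have "\<not> (i = a \<and> j = b)"
    using nb i j R E(1) by (auto simp: neighbourhood_def eliminate_def set_eq_iff dest: sympD)
  ultimately show "add_message W a b m (2 * i + p) (2 * j + q) = 0"
    using i j supportedD(1)[OF supp, of i p q j] by (auto simp: add_message_def)
qed

section \<open>Backtracking and the invariant of elimination\<close>

text \<open>The list runs from the last eliminated variable to the first, so the neighbours of each
  variable are assigned before it. One final matrix serves all choices, because messages never
  change entries of eliminated variables.\<close>

fun backtrack ::
  "(nat \<Rightarrow> nat \<Rightarrow> nat) \<Rightarrow> (nat \<Rightarrow> nat) \<Rightarrow> (nat \<Rightarrow> nat) \<Rightarrow> nat list \<Rightarrow> (nat \<Rightarrow> nat) \<Rightarrow> (nat \<Rightarrow> nat)" where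
  "backtrack W A D [] x = x"
| "backtrack W A D (v # vs) x = backtrack W A D vs (x(v := choice W v (A v) (D v) x))"

lemma local_cost_cong:
  assumes "\<And>l k. l \<le> 2 * n + 1 \<Longrightarrow> k \<le> 2 * n + 1 \<Longrightarrow> l div 2 = v \<or> k div 2 = v \<Longrightarrow> W l k = W' l k"
    "v \<le> n" "a \<le> n" "d \<le> n" "z < 2" "p < 2" "q < 2"
  shows "local_cost W v a d z p q = local_cost W' v a d z p q"
proof -
  have "W l k = W' l k" if "l \<in> {2 * v + z, 2 * a + p, 2 * d + q}" "k \<in> {2 * v + z, 2 * a + p, 2 * d + q}"
    "l = 2 * v + z \<or> k = 2 * v + z" for l k
    using that assms(2-) by (intro assms(1)) (auto intro: index_le)
  then show ?thesis by (simp add: local_cost_def)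
qed

lemma backtrack_cong:
  assumes "\<And>v l k. v \<in> set vs \<Longrightarrow> l \<le> 2 * n + 1 \<Longrightarrow> k \<le> 2 * n + 1 \<Longrightarrow>
      l div 2 = v \<or> k div 2 = v \<Longrightarrow> W l k = W' l k"
    "\<And>v. v \<in> set vs \<Longrightarrow> v \<le> n \<and> A v = A' v \<and> D v = D' v \<and> A' v \<le> n \<and> D' v \<le> n" "binary x"
  shows "backtrack W A D vs x = backtrack W' A' D' vs x"
  using assms
proof (induction vs arbitrary: x)
  case (Cons v vs)
  have "local_cost W v (A' v) (D' v) z (x (A' v)) (x (D' v)) =
      local_cost W' v (A' v) (D' v) z (x (A' v)) (x (D' v))" if "z < 2" for z
    by (rule local_cost_cong[of n]) (use Cons.prems that in \<open>auto simp: binaryD\<close>)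
  then have "choice W v (A v) (D v) x = choice W' v (A' v) (D' v) x"
    using Cons.prems(2)[of v] by (simp add: choice_def)
  moreover have "binary (x(v := choice W' v (A' v) (D' v) x))"
    using Cons.prems(3) by (simp add: binary_def choice_def)
  moreover have "backtrack W A D vs y = backtrack W' A' D' vs y" if "binary y" for y
    by (rule Cons.IH) (use Cons.prems that in auto)
  ultimately show ?case using Cons.prems(2)[of v] by simp
qed simp

lemma cost_cong:
  assumes "R \<subseteq> {..<n}" "binary x"
    and "\<And>l k. l \<le> 2 * n + 1 \<Longrightarrow> k \<le> 2 * n + 1 \<Longrightarrow> W l k = W' l k"
  shows "cost R W x = cost R W' x"
  unfolding cost_def
proof (intro sum.cong refl assms(3))
  show "2 * i + x i \<le> 2 * n + 1" if "i \<in> R" for i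
    using index_le[of i n "x i"] that assms(1) binaryD[OF assms(2)] by (auto simp: less_imp_le)
  then show "2 * i + x i \<le> 2 * n + 1" if "i \<in> R" for i using that .
qed

text \<open>\<open>E\<close> is the current graph on the live vertices \<open>R\<close>. Optimality
  is an implication from the residual problem, which becomes trivial when \<open>R\<close> is
  empty.\<close>

definition elimination_invariant where
  "elimination_invariant n W\<^sub>0 R E W A D vs \<longleftrightarrow>
     R \<subseteq> {..<n} \<and> symp E \<and> irreflp E \<and> thin E \<and> (\<forall>i j. E i j \<longrightarrow> j \<in> R) \<and> supported n R E W \<and>
     set vs \<subseteq> {..<n} - R \<and> (\<forall>v\<in>set vs. A v \<le> n \<and> D v \<le> n) \<and>
     (\<forall>x. optimal R W x \<longrightarrow> optimal {..<n} W\<^sub>0 (backtrack W A D vs x))"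

lemma elimination_step:
  assumes inv: "elimination_invariant n W\<^sub>0 R E W A D vs" and v: "v \<in> R"
    and nb: "neighbourhood n {j. E v j} a b d"
    and W': "\<And>l k. l \<le> 2 * n + 1 \<Longrightarrow> k \<le> 2 * n + 1 \<Longrightarrow> W' l k = add_message W a b (message W v a d) l k"
  shows "elimination_invariant n W\<^sub>0 (R - {v}) (eliminate E v) W' (A(v := a)) (D(v := d)) (v # vs)"
proof -
  let ?W = "add_message W a b (message W v a d)"
  have R4: "R \<subseteq> {..<n}" and E: "symp E" "irreflp E" "thin E" "\<And>i j. E i j \<Longrightarrow> j \<in> R"
    and supp: "supported n R E W" and vs: "set vs \<subseteq> {..<n} - R" "\<And>v. v \<in> set vs \<Longrightarrow> A v \<le> n \<and> D v \<le> n"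
    and opt: "\<And>x. optimal R W x \<Longrightarrow> optimal {..<n} W\<^sub>0 (backtrack W A D vs x)"
    using inv unfolding elimination_invariant_def by blast+
  have R: "finite R" "n \<notin> R" "v < n" "R \<subseteq> {..<n}" using R4 v finite_subset by auto
  have vv: "\<not> E v v" using E(2) by (simp add: irreflp_def)
  have MR: "{j. E v j} \<subseteq> R" using E(4) by auto
  have N: "{j. E v j} \<subseteq> {..<n}" using E(4) R(4) by auto
  define M where "M = {j. E v j}"
  have M: "M \<subseteq> {..<n}" "v \<notin> M" "neighbourhood n M a b d" using N vv nb by (auto simp: M_def)
  note MR = MR[folded M_def]
  have abd: "a \<le> n" "d \<le> n" "v \<noteq> a" "v \<noteq> d" using M R(3) by (auto simp: neighbourhood_def)
  have deg: "card {j. E v j} \<le> 2"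
    using M(3) unfolding M_def[symmetric] by (auto simp: neighbourhood_def card_insert_if)
  have "thin (eliminate E v)"
    using thin_eliminate[OF E(1-3)] deg N finite_subset by auto
  have cost_eq: "cost (R - {v}) W' y = cost (R - {v}) ?W y" if "binary y" for y
    by (rule cost_cong[OF _ that W']) (use R(4) in auto)
  have "optimal {..<n} W\<^sub>0 (backtrack W' (A(v := a)) (D(v := d)) (v # vs) x)"
    if x: "optimal (R - {v}) W' x" for x
  proof -
    have "optimal (R - {v}) ?W x" using x by (auto simp: optimal_def cost_eq)
    then have "optimal R W (x(v := choice W v a d x))"
      using optimal_eliminate[OF R(1) v R(2) E(1) _ vv supp nb] E(4) by blast
    from opt[OF this] have *: "optimal {..<n} W\<^sub>0 (backtrack W A D vs (x(v := choice W v a d x)))" .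
    have xb: "binary x" using x by (simp add: optimal_def)
    \<comment> \<open>The new message is stored between live variables other than v, or in the dummy
      block, so rows and columns of v and of earlier eliminated variables are untouched.\<close>
    have agree: "W' l k = W l k"
      if "u \<in> insert v (set vs)" "l \<le> 2 * n + 1" "k \<le> 2 * n + 1" "l div 2 = u \<or> k div 2 = u" for u l k
    proof -
      have "a \<in> R - {v} \<and> b \<in> R - {v} \<or> a = n \<and> b = n"
        using M(2,3) MR by (auto simp: neighbourhood_def)
      then have "\<not> (l div 2 = a \<and> k div 2 = b)" using that vs(1) v R by auto
      then show ?thesis using W'[OF that(2,3)] by (auto simp: add_message_def)
    qed
    have "local_cost W' v a d z (x a) (x d) = local_cost W v a d z (x a) (x d)" if "z < 2" for z
      by (rule local_cost_cong[of n]) (use agree abd R(3) that xb in \<open>auto simp: binaryD\<close>)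
    then have "choice W' v a d x = choice W v a d x" by (simp add: choice_def)
    moreover have "backtrack W' (A(v := a)) (D(v := d)) vs y = backtrack W A D vs y" if "binary y" for y
      by (rule backtrack_cong[of _ n]) (use agree vs v that in \<open>auto simp: subset_eq\<close>)
    moreover have "binary (x(v := choice W v a d x))" using xb by (simp add: binary_def choice_def)
    ultimately show ?thesis using * by simp
  qed
  moreover have "supported n (R - {v}) (eliminate E v) ?W"
    using supported_eliminate[OF v R(2) E(1) _ vv supp nb] E(4) by blast
  then have "supported n (R - {v}) (eliminate E v) W'"
  proof -
    have "W' (2 * i + p) (2 * j + q) = ?W (2 * i + p) (2 * j + q)" if "i \<le> n" "j \<le> n" "p < 2" "q < 2" for i j p q
      using that by (intro W' index_le)
    moreover have "i \<le> n" if "i \<in> R - {v}" for i using that R(4) by auto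
    ultimately show ?thesis
      using \<open>supported n (R - {v}) (eliminate E v) ?W\<close> unfolding supported_def by auto
  qed
  ultimately show ?thesis
    using R E vs v abd \<open>thin (eliminate E v)\<close> symp_eliminate irreflp_eliminate
    unfolding elimination_invariant_def by (auto simp: eliminate_def dest: sympD)
qed

section \<open>Vertex cover as cost minimisation\<close>

text \<open>An odd index puts the vertex into the cover at cost 1; two even indices on an edge leave
  it uncovered. The penalty n + 1 exceeds the cost n of taking all vertices. The bound
  \<open>l < 2 * n\<close> excludes the dummy index.\<close>

definition cover_cost :: "nat \<Rightarrow> (nat \<Rightarrow> nat \<Rightarrow> bool) \<Rightarrow> nat \<Rightarrow> nat \<Rightarrow> nat" where
  "cover_cost n E l k =
     (if l = k \<and> odd l \<and> l < 2 * n then 1 else if even l \<and> even k \<and> E (l div 2) (k div 2) then n + 1 else 0)"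

lemma elimination_invariant_init:
  assumes "symp E" "irreflp E" "thin E" "\<And>i j. E i j \<Longrightarrow> j < n" 
    and W: "\<And>l k. l \<le> 2 * n + 1 \<Longrightarrow> k \<le> 2 * n + 1 \<Longrightarrow> W l k = cover_cost n E l k"
  shows "elimination_invariant n (cover_cost n E) {..<n} E W A D []"
proof -
  have "cost {..<n} W y = cost {..<n} (cover_cost n E) y" if "binary y" for y
    by (rule cost_cong[OF subset_refl that]) (rule W)
  then have "optimal {..<n} (cover_cost n E) x" if "optimal {..<n} W x" for x
    using that by (auto simp: optimal_def)
  moreover have "supported n {..<n} E W"
    unfolding supported_def
  proof (intro ballI allI impI conjI)
    fix i p q :: nat assume i: "i \<in> {..<n}" "p < 2" "q < 2"
    have no: "\<not> E i n" "\<not> E n i" using assms(1,4) by (auto dest: sympD)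
    have n: "2 * i + p \<noteq> 2 * n + q" using i by auto
    show "W (2 * i + p) (2 * n + q) = 0" "W (2 * n + q) (2 * i + p) = 0"
      using i no n W[of "2 * i + p" "2 * n + q"] W[of "2 * n + q" "2 * i + p"]
      by (auto simp: cover_cost_def)
    fix j assume j: "j \<in> {..<n}" "i \<noteq> j" "\<not> E i j"
    have "2 * i + p \<noteq> 2 * j + q"
      using j(2) index_div_mod(1)[OF i(2), of i] index_div_mod(1)[OF i(3), of j] by metis
    then show "W (2 * i + p) (2 * j + q) = 0"
      using i j W[of "2 * i + p" "2 * j + q"] by (auto simp: cover_cost_def)
  qed
  ultimately show ?thesis using assms(1-4) by (auto simp: elimination_invariant_def)
qed

text \<open>An uncovered edge would already cost more than the cover by all vertices. The cost of a
  cover is its cardinality, and every assignment costs at least its number of ones.\<close>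

lemma optimal_cover:
  assumes opt: "optimal {..<n} (cover_cost n E) x"
    and E: "irreflp E" "\<And>i j. E i j \<Longrightarrow> i < n \<and> j < n"
  shows "E i j \<Longrightarrow> x i = 1 \<or> x j = 1"
    and "T \<subseteq> {..<n} \<Longrightarrow> (\<And>i j. E i j \<Longrightarrow> i \<in> T \<or> j \<in> T) \<Longrightarrow> card {i. i < n \<and> x i = 1} \<le> card T"
proof -
  define f where "f y i j = (if i = j then y i else if y i = 0 \<and> y j = 0 \<and> E i j then n + 1 else 0)"
    for y :: "nat \<Rightarrow> nat" and i j :: nat
  have cost: "cost {..<n} (cover_cost n E) y = (\<Sum>i<n. \<Sum>j<n. f y i j)" if y: "binary y" for y
    unfolding cost_def
  proof (intro sum.cong refl)
    fix i j assume ij: "i \<in> {..<n}" "j \<in> {..<n}"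
    have b: "y i = 0 \<or> y i = 1" "y j = 0 \<or> y j = 1" using binaryD[OF y, of i] binaryD[OF y, of j] by auto
    have "2 * i + 1 < 2 * n" using ij(1) by simp
    then show "cover_cost n E (2 * i + y i) (2 * j + y j) = f y i j"
      using b E(1) by (auto simp: cover_cost_def f_def irreflp_def; presburger)
  qed
  have x: "binary x" and le: "\<And>y. binary y \<Longrightarrow> cost {..<n} (cover_cost n E) x \<le> cost {..<n} (cover_cost n E) y"
    using opt by (auto simp: optimal_def)
  have cover: "cost {..<n} (cover_cost n E) (\<lambda>i. of_bool (i \<in> T)) = card T"
    if T: "T \<subseteq> {..<n}" "\<And>i j. E i j \<Longrightarrow> i \<in> T \<or> j \<in> T" for T
  proof -
    have "(\<Sum>j<n. f (\<lambda>i. of_bool (i \<in> T)) i j) = of_bool (i \<in> T)" if "i < n" for i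
    proof -
      have "(\<Sum>j<n. f (\<lambda>i. of_bool (i \<in> T)) i j) = (\<Sum>j<n. if i = j then of_bool (i \<in> T) else 0)"
        using T(2) by (intro sum.cong refl) (auto simp: f_def)
      then show ?thesis using that by simp
    qed
    then have "cost {..<n} (cover_cost n E) (\<lambda>i. of_bool (i \<in> T)) = (\<Sum>i<n. of_bool (i \<in> T))"
      by (simp add: cost binary_def)
    also have "\<dots> = card ({..<n} \<inter> {i. i \<in> T})" by (simp add: sum_of_bool_eq)
    finally show ?thesis using T(1) by (simp add: Int_absorb1)
  qed
  have fin: "f y i j \<le> (\<Sum>j<n. f y i j)" if "j < n" for y i j
    using that by (intro member_le_sum) auto
  have fin2: "(\<Sum>j<n. f y i j) \<le> (\<Sum>i<n. \<Sum>j<n. f y i j)" if "i < n" for y i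
    using that by (intro member_le_sum) auto
  show "x i = 1 \<or> x j = 1" if ij: "E i j"
  proof (rule ccontr)
    assume "\<not> ?thesis"
    then have "x i = 0" "x j = 0" using binaryD[OF x, of i] binaryD[OF x, of j] by auto
    moreover have "i \<noteq> j" using ij E(1) by (auto simp: irreflp_def)
    ultimately have "f x i j = n + 1" using ij by (simp add: f_def)
    moreover have "f x i j \<le> cost {..<n} (cover_cost n E) x"
      using fin[of j x i] fin2[of i x] E(2)[OF ij] cost[OF x] by simp
    moreover have "cost {..<n} (cover_cost n E) x \<le> cost {..<n} (cover_cost n E) (\<lambda>i. of_bool (i \<in> {..<n}))"
      by (rule le) (simp add: binary_def)
    moreover have "cost {..<n} (cover_cost n E) (\<lambda>i. of_bool (i \<in> {..<n})) = n" using cover[of "{..<n}"] E(2) by simp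
    ultimately show False by simp
  qed
  show "card {i. i < n \<and> x i = 1} \<le> card T" if T: "T \<subseteq> {..<n}" "\<And>i j. E i j \<Longrightarrow> i \<in> T \<or> j \<in> T"
  proof -
    have "card {i. i < n \<and> x i = 1} = (\<Sum>i<n. of_bool (x i = 1))"
      by (simp add: sum_of_bool_eq Int_def)
    also have "\<dots> \<le> (\<Sum>i<n. \<Sum>j<n. f x i j)"
    proof (rule sum_mono)
      fix i assume "i \<in> {..<n}"
      then show "of_bool (x i = 1) \<le> (\<Sum>j<n. f x i j)"
        using fin[of i x i] by (simp add: f_def)
    qed
    also have "\<dots> = cost {..<n} (cover_cost n E) x" using cost[OF x] by simp
    also have "\<dots> \<le> cost {..<n} (cover_cost n E) (\<lambda>i. of_bool (i \<in> T))" by (rule le) (simp add: binary_def)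
    finally show ?thesis using cover[OF T] by simp
  qed
qed

section \<open>Reasoning about programs\<close>

text \<open>Total correctness with a time bound. The start state is a parameter, so postconditions
  can refer to it for frame conditions.\<close>

definition run :: "com \<Rightarrow> nat \<Rightarrow> state \<Rightarrow> (state \<Rightarrow> bool) \<Rightarrow> bool" where
  "run c T s Q \<longleftrightarrow> (\<exists>t s'. exec c s t s' \<and> t \<le> T \<and> Q s')"

lemma run_mono: "run c T s P \<Longrightarrow> T \<le> T' \<Longrightarrow> (\<And>s'. P s' \<Longrightarrow> Q s') \<Longrightarrow> run c T' s Q"
  unfolding run_def by (meson order_trans)

lemma run_seq:
  assumes "run c T s P" "\<And>s'. P s' \<Longrightarrow> run d U s' Q"
  shows "run (Seq c d) (T + U) s Q"
proof -
  obtain t s' where c: "exec c s t s'" "t \<le> T" "P s'" using assms(1) by (auto simp: run_def)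
  from assms(2)[OF this(3)] obtain u s'' where "exec d s' u s''" "u \<le> U" "Q s''"
    by (auto simp: run_def)
  with c show ?thesis unfolding run_def by (meson exec.Seq add_mono)
qed

lemma run_cond:
  assumes "bval b s \<Longrightarrow> run c T s Q" "\<not> bval b s \<Longrightarrow> run d T s Q"
  shows "run (Cond b c d) (Suc T) s Q"
proof (cases "bval b s")
  case True
  with assms obtain t s' where "exec c s t s'" "t \<le> T" "Q s'" by (auto simp: run_def)
  then show ?thesis
    unfolding run_def using exec.CondTrue[OF True] by (intro exI[of _ "1 + t"] exI[of _ s']) auto
next
  case False
  with assms obtain t s' where "exec d s t s'" "t \<le> T" "Q s'" by (auto simp: run_def)
  then show ?thesis
    unfolding run_def using exec.CondFalse[OF False] by (intro exI[of _ "1 + t"] exI[of _ s']) auto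
qed

text \<open>Loop-free code is executed symbolically: \<open>effect\<close> gives the final state by
  rewriting and \<open>steps\<close> a static time bound. Their values on loops are placeholders,
  excluded by \<open>straight\<close>.\<close>

fun straight :: "com \<Rightarrow> bool" where
  "straight (Seq c d) \<longleftrightarrow> straight c \<and> straight d"
| "straight (Cond b c d) \<longleftrightarrow> straight c \<and> straight d"
| "straight (While b c) \<longleftrightarrow> False"
| "straight c \<longleftrightarrow> True"

fun steps :: "com \<Rightarrow> nat" where
  "steps (Seq c d) = steps c + steps d"
| "steps (Cond b c d) = Suc (max (steps c) (steps d))"
| "steps c = 1"

fun effect :: "com \<Rightarrow> state \<Rightarrow> state" where
  "effect (Assign x e) s = set_reg x (aval e s) s"
| "effect (Store a e f) s = set_arr a (aval e s) (aval f s) s"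
| "effect (Seq c d) s = effect d (effect c s)"
| "effect (Cond b c d) s = (if bval b s then effect c s else effect d s)"
| "effect c s = s"

lemma exec_straight: "straight c \<Longrightarrow> \<exists>t\<le>steps c. exec c s t (effect c s)"
proof (induction c arbitrary: s)
  case (Seq c d)
  then obtain t u where "t \<le> steps c" "exec c s t (effect c s)"
    "u \<le> steps d" "exec d (effect c s) u (effect d (effect c s))" by fastforce
  then show ?case by (intro exI[of _ "t + u"]) (auto intro: exec.Seq)
next
  case (Cond b c d)
  then obtain t u where "t \<le> steps c" "exec c s t (effect c s)" "u \<le> steps d" "exec d s u (effect d s)"
    by fastforce
  then show ?case
    using exec.CondTrue[of b s c t "effect c s" d] exec.CondFalse[of b s d u "effect d s" c]
    by (cases "bval b s") (auto intro: exI[of _ "Suc t"] exI[of _ "Suc u"])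
qed (auto intro: exI[of _ "Suc 0"] exec.intros[unfolded One_nat_def])

lemma run_straight: "straight c \<Longrightarrow> steps c \<le> T \<Longrightarrow> Q (effect c s) \<Longrightarrow> run c T s Q"
  using exec_straight[of c s] unfolding run_def by (meson order_trans)

definition for_loop :: "string \<Rightarrow> aexp \<Rightarrow> com \<Rightarrow> com" where
  "for_loop x e c =
     Seq (Assign x (Const 0)) (While (BLess (Var x) e) (Seq c (Assign x (Add (Var x) (Const 1)))))"

lemma reg_set_reg [simp]: "reg (set_reg x n s) = (reg s)(x := n)"
  and arr_set_reg [simp]: "arr (set_reg x n s) = arr s"
  and reg_set_arr [simp]: "reg (set_arr a i n s) = reg s"
  and arr_set_arr [simp]: "arr (set_arr a i n s) = (arr s)(a := (arr s a)(i := n))"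
  by (simp_all add: set_reg_def set_arr_def)

text \<open>Each iteration pays T for the body, one step for the guard and one for the increment;
  the final 1 is the failing guard. The invariant is demanded after the increment, hence the
  \<open>set_reg\<close>.\<close>

lemma run_while_upto:
  assumes step: "\<And>m s. m < N \<Longrightarrow> I m s \<Longrightarrow> reg s x = m \<Longrightarrow>
      run c T s (\<lambda>s'. reg s' x = m \<and> I (Suc m) (set_reg x (Suc m) s'))"
    and guard: "\<And>m s. m \<le> N \<Longrightarrow> I m s \<Longrightarrow> aval e s = N"
  shows "m \<le> N \<Longrightarrow> I m s \<Longrightarrow> reg s x = m \<Longrightarrow>
    run (While (BLess (Var x) e) (Seq c (Assign x (Add (Var x) (Const 1))))) ((N - m) * (T + 2) + 1) s
      (\<lambda>s'. I N s' \<and> reg s' x = N)"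
proof (induction "N - m" arbitrary: m s)
  case 0
  then have "exec (While (BLess (Var x) e) (Seq c (Assign x (Add (Var x) (Const 1))))) s 1 s"
    using guard[of m s] by (intro exec.WhileFalse) simp
  with 0 show ?case by (auto simp: run_def)
next
  case (Suc j)
  then have m: "m < N" by simp
  obtain t s' where c: "exec c s t s'" "t \<le> T" "reg s' x = m" "I (Suc m) (set_reg x (Suc m) s')"
    using step[OF m Suc.prems(2,3)] by (auto simp: run_def)
  have "exec (Assign x (Add (Var x) (Const 1))) s' 1 (set_reg x (Suc m) s')"
    using exec.Assign[of x "Add (Var x) (Const 1)" s'] c(3) by simp
  then have body: "exec (Seq c (Assign x (Add (Var x) (Const 1)))) s (t + 1) (set_reg x (Suc m) s')"
    using c(1) by (rule exec.Seq[rotated])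
  have "j = N - Suc m" "Suc m \<le> N" using Suc m by auto
  from Suc(1)[OF this c(4)] obtain u s'' where
    u: "exec (While (BLess (Var x) e) (Seq c (Assign x (Add (Var x) (Const 1))))) (set_reg x (Suc m) s') u s''"
    "u \<le> (N - Suc m) * (T + 2) + 1" "I N s''" "reg s'' x = N" by (auto simp: run_def)
  have "bval (BLess (Var x) e) s" using m Suc.prems guard[of m s] by simp
  from exec.WhileTrue[OF this body u(1)] have
    "exec (While (BLess (Var x) e) (Seq c (Assign x (Add (Var x) (Const 1))))) s (1 + (t + 1) + u) s''" .
  moreover have "1 + (t + 1) + u \<le> (N - m) * (T + 2) + 1"
  proof -
    have "N - m = Suc (N - Suc m)" using m by simp
    then show ?thesis using c(2) u(2) by simp
  qed
  ultimately show ?case using u(3,4) unfolding run_def by blast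
qed

lemma run_for:
  assumes "I 0 (set_reg x 0 s)"
    and "\<And>m s. m < N \<Longrightarrow> I m s \<Longrightarrow> reg s x = m \<Longrightarrow>
      run c T s (\<lambda>s'. reg s' x = m \<and> I (Suc m) (set_reg x (Suc m) s'))"
    and "\<And>m s. m \<le> N \<Longrightarrow> I m s \<Longrightarrow> aval e s = N"
    and "N * (T + 2) + 2 \<le> U"
  shows "run (for_loop x e c) U s (I N)"
  unfolding for_loop_def
proof (rule run_mono[OF run_seq])
  show "run (Assign x (Const 0)) 1 s (\<lambda>s'. I 0 s' \<and> reg s' x = 0)"
    by (rule run_straight) (use assms(1) in simp_all)
  show "run (While (BLess (Var x) e) (Seq c (Assign x (Add (Var x) (Const 1))))) ((N - 0) * (T + 2) + 1) s'
      (\<lambda>s'. I N s' \<and> reg s' x = N)" if "I 0 s' \<and> reg s' x = 0" for s'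
    by (rule run_while_upto[of N I x c T e 0 s']) (use assms(2,3) that in auto)
qed (use assms(4) in auto)

section \<open>The program\<close>

text \<open>Two-dimensional arrays have rows of length \<open>2 * n + 2\<close>; the row offsets are tabulated.\<close>

definition addr :: "nat \<Rightarrow> nat \<Rightarrow> nat \<Rightarrow> nat" where
  "addr n l k = l * (2 * n + 2) + k"

definition env :: "nat \<Rightarrow> state \<Rightarrow> bool" where
  "env n s \<longleftrightarrow> reg s ''n'' = n \<and> (\<forall>l \<le> 2 * n + 1. arr s ''row'' l = addr n l 0)"

abbreviation cell :: "string \<Rightarrow> aexp \<Rightarrow> aexp \<Rightarrow> aexp" where
  "cell a l k \<equiv> Idx a (Add (Idx ''row'' l) k)"

abbreviation set_cell :: "string \<Rightarrow> aexp \<Rightarrow> aexp \<Rightarrow> aexp \<Rightarrow> com" where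
  "set_cell a l k e \<equiv> Store a (Add (Idx ''row'' l) k) e"

definition index :: "aexp \<Rightarrow> aexp \<Rightarrow> aexp" where
  "index v z = Add (Add v v) z"

text \<open>Truncated subtraction yields the minimum without a conditional.\<close>

definition min_exp :: "aexp \<Rightarrow> aexp \<Rightarrow> aexp" where
  "min_exp e f = Monus e (Monus e f)"

definition local_cost_exp :: "aexp \<Rightarrow> aexp \<Rightarrow> aexp \<Rightarrow> aexp \<Rightarrow> aexp \<Rightarrow> aexp \<Rightarrow> aexp" where
  "local_cost_exp v a d z p q =
     (let i = index v z; j = index a p; k = index d q in
      Add (Add (Add (Add (cell ''W'' i i) (cell ''W'' i j)) (cell ''W'' j i)) (cell ''W'' i k)) (cell ''W'' k i))"

definition read_rows :: com where
  "read_rows =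
     Seq (Assign ''L'' (Add (Add (Var ''n'') (Var ''n'')) (Const 2)))
    (Seq (Assign ''r'' (Const 0))
         (for_loop ''l'' (Var ''L'')
           (Seq (Store ''row'' (Var ''l'') (Var ''r'')) (Assign ''r'' (Add (Var ''r'') (Var ''L''))))))"

text \<open>The register p is a running counter for the input address i * n + j; rows of the input
  have length n, unlike those of the internal arrays.\<close>

definition read_edge :: com where
  "read_edge =
     Seq (Cond (BLess (Const 0) (Idx ''adj'' (Var ''p'')))
           (Seq (set_cell ''e'' (Var ''i'') (Var ''j'') (Const 1))
                (set_cell ''W'' (index (Var ''i'') (Const 0)) (index (Var ''j'') (Const 0))
                   (Add (Var ''n'') (Const 1))))
           Skip)
         (Assign ''p'' (Add (Var ''p'') (Const 1)))"

definition read_graph :: com where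
  "read_graph =
     Seq (Assign ''p'' (Const 0))
         (for_loop ''i'' (Var ''n'')
           (Seq (set_cell ''W'' (index (Var ''i'') (Const 1)) (index (Var ''i'') (Const 1)) (Const 1))
                (for_loop ''j'' (Var ''n'') read_edge)))"

text \<open>As j increases, a keeps the first live neighbour, b the latest, and d is set from the
  second on, which produces \<open>neighbourhood\<close> with a < b. Beyond two neighbours b and d
  are meaningless, and the count c lets \<open>select\<close> reject the vertex.\<close>

definition scan_neighbour :: com where
  "scan_neighbour =
     Cond (BAnd (BLess (Const 0) (cell ''e'' (Var ''v'') (Var ''j''))) (BLess (Idx ''dead'' (Var ''j'')) (Const 1)))
       (Seq (Cond (BLess (Var ''c'') (Const 1)) (Assign ''a'' (Var ''j'')) (Assign ''d'' (Var ''j'')))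
       (Seq (Assign ''b'' (Var ''j''))
            (Assign ''c'' (Add (Var ''c'') (Const 1)))))
       Skip"

definition find_neighbours :: com where
  "find_neighbours =
     Seq (Seq (Assign ''c'' (Const 0))
         (Seq (Assign ''a'' (Var ''n''))
         (Seq (Assign ''b'' (Var ''n''))
              (Assign ''d'' (Var ''n'')))))
         (for_loop ''j'' (Var ''n'') scan_neighbour)"

text \<open>There is no early exit: the last suitable vertex wins. Its data are saved in separate
  registers because later scans overwrite a, b and d.\<close>

definition select :: com where
  "select =
     for_loop ''v'' (Var ''n'')
       (Cond (BLess (Idx ''dead'' (Var ''v'')) (Const 1))
         (Seq find_neighbours
              (Cond (BLess (Var ''c'') (Const 3))
                (Seq (Assign ''sv'' (Var ''v''))
                (Seq (Assign ''sa'' (Var ''a''))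
                (Seq (Assign ''sb'' (Var ''b''))
                     (Assign ''sd'' (Var ''d'')))))
                Skip))
         Skip)"

text \<open>One entry of the message is added at a time. The entries read all involve the eliminated
  vertex, the entry written does not, so the order of the four updates is immaterial.\<close>

definition send_message :: "nat \<Rightarrow> nat \<Rightarrow> com" where
  "send_message p q =
     (let l = index (Var ''sa'') (Const p); k = index (Var ''sb'') (Const q);
          e = (\<lambda>z. local_cost_exp (Var ''sv'') (Var ''sa'') (Var ''sd'') (Const z) (Const p) (Const q)) in
      set_cell ''W'' l k (Add (cell ''W'' l k) (min_exp (e 0) (e 1))))"

text \<open>By \<open>neighbourhood\<close>, a < b holds exactly when there are two neighbours.
  Edges at dead vertices stay in the array and are masked by the dead flags.\<close>

definition record_elimination :: com where
  "record_elimination =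
     Seq (Store ''dead'' (Var ''sv'') (Const 1))
    (Seq (Store ''ord'' (Var ''t'') (Var ''sv''))
    (Seq (Store ''A'' (Var ''sv'') (Var ''sa''))
    (Seq (Store ''D'' (Var ''sv'') (Var ''sd''))
         (Cond (BLess (Var ''sa'') (Var ''sb''))
           (Seq (set_cell ''e'' (Var ''sa'') (Var ''sb'') (Const 1))
                (set_cell ''e'' (Var ''sb'') (Var ''sa'') (Const 1)))
           Skip))))"

definition send_messages :: com where
  "send_messages =
     Seq (send_message 0 0) (Seq (send_message 0 1) (Seq (send_message 1 0) (send_message 1 1)))"

definition eliminate_all :: com where
  "eliminate_all = for_loop ''t'' (Var ''n'') (Seq select (Seq record_elimination send_messages))"

text \<open>The output array doubles as the current assignment. Its cell n may be read for the dummy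
  neighbour, which is why \<open>binary\<close> speaks of all cells.\<close>

definition backtrack_step :: com where
  "backtrack_step =
     Seq (Assign ''v'' (Idx ''ord'' (Monus (Monus (Var ''n'') (Const 1)) (Var ''t''))))
    (Seq (Assign ''a'' (Idx ''A'' (Var ''v'')))
    (Seq (Assign ''d'' (Idx ''D'' (Var ''v'')))
         (let e = (\<lambda>z. local_cost_exp (Var ''v'') (Var ''a'') (Var ''d'') (Const z)
                        (Idx ''out'' (Var ''a'')) (Idx ''out'' (Var ''d''))) in
          Cond (BLess (e 1) (e 0)) (Store ''out'' (Var ''v'') (Const 1)) (Store ''out'' (Var ''v'') (Const 0)))))"

definition cover_program :: com where
  "cover_program =
     Seq read_rows (Seq read_graph (Seq eliminate_all (for_loop ''t'' (Var ''n'') backtrack_step)))"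

definition independent_program :: com where
  "independent_program =
     Seq cover_program
       (for_loop ''i'' (Var ''n'')
         (Store ''out'' (Var ''i'') (Monus (Const 1) (Idx ''out'' (Var ''i'')))))"

section \<open>Addresses, and reading the graph\<close>

lemma addr_inject [simp]:
  assumes "k \<le> 2 * n + 1" "k' \<le> 2 * n + 1"
  shows "addr n l k = addr n l' k' \<longleftrightarrow> l = l' \<and> k = k'"
proof
  assume "addr n l k = addr n l' k'"
  moreover from this have "addr n l k div (2 * n + 2) = addr n l' k' div (2 * n + 2)" by simp
  moreover have "(l * m + k) div m = l" if "k < m" for l k m :: nat using that by simp
  then have "addr n l k div (2 * n + 2) = l" if "k \<le> 2 * n + 1" for l k
    using that unfolding addr_def by (metis add_Suc_right le_imp_less_Suc nat_1_add_1 plus_1_eq_Suc add.commute)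
  ultimately have "l = l'" using assms by metis
  with \<open>addr n l k = addr n l' k'\<close> have "l = l' \<and> k = k'" by (simp add: addr_def)
  then show "l = l' \<and> k = k'" .
qed simp

lemma env_row: "env n s \<Longrightarrow> l \<le> 2 * n + 1 \<Longrightarrow> arr s ''row'' l + k = addr n l k"
  by (simp add: env_def addr_def)

lemma env_n: "env n s \<Longrightarrow> reg s ''n'' = n"
  by (simp add: env_def)

lemma env_set [simp]:
  "x \<noteq> ''n'' \<Longrightarrow> env n (set_reg x i s) \<longleftrightarrow> env n s"
  "a \<noteq> ''row'' \<Longrightarrow> env n (set_arr a i j s) \<longleftrightarrow> env n s"
  by (simp_all add: env_def)

lemma aval_index [simp]: "aval (index v z) s = 2 * aval v s + aval z s"
  by (simp add: index_def)

lemma aval_min_exp [simp]: "aval (min_exp e f) s = min (aval e s) (aval f s)"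
  by (simp add: min_exp_def min_def)

definition matrix :: "nat \<Rightarrow> state \<Rightarrow> nat \<Rightarrow> nat \<Rightarrow> nat" where
  "matrix n s l k = arr s ''W'' (addr n l k)"

lemma aval_local_cost_exp:
  assumes "env n s" "aval v s \<le> n" "aval a s \<le> n" "aval d s \<le> n"
    "aval z s < 2" "aval p s < 2" "aval q s < 2"
  shows "aval (local_cost_exp v a d z p q) s =
    local_cost (matrix n s) (aval v s) (aval a s) (aval d s) (aval z s) (aval p s) (aval q s)"
proof -
  have le: "2 * aval v s + aval z s \<le> 2 * n + 1" "2 * aval a s + aval p s \<le> 2 * n + 1"
    "2 * aval d s + aval q s \<le> 2 * n + 1"
    using assms(2-) by (auto intro: index_le)
  note row = env_row[OF assms(1) le(1)] env_row[OF assms(1) le(2)] env_row[OF assms(1) le(3)]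
  show ?thesis by (simp add: local_cost_exp_def local_cost_def matrix_def row Let_def)
qed

lemma run_read_rows:
  assumes "reg s ''n'' = n"
  shows "run read_rows (10 * n + 20) s (\<lambda>s'. env n s' \<and> (\<forall>a. a \<noteq> ''row'' \<longrightarrow> arr s' a = arr s a))"
  unfolding read_rows_def
proof (rule run_mono[OF run_seq[OF _ run_seq]])
  let ?P = "\<lambda>s' :: state. reg s' ''n'' = n \<and> reg s' ''L'' = 2 * n + 2 \<and> arr s' = arr s"
  show "run (Assign ''L'' (Add (Add (Var ''n'') (Var ''n'')) (Const 2))) 1 s ?P"
    by (rule run_straight) (use assms in simp_all)
  show "run (Assign ''r'' (Const 0)) 1 s' (\<lambda>s'. ?P s' \<and> reg s' ''r'' = 0)" if "?P s'" for s'
    by (rule run_straight) (use that in simp_all)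
  fix s' assume s': "?P s' \<and> reg s' ''r'' = 0"
  let ?I = "\<lambda>m (s' :: state). reg s' ''n'' = n \<and> reg s' ''L'' = 2 * n + 2 \<and> reg s' ''r'' = addr n m 0 \<and>
    (\<forall>l<m. arr s' ''row'' l = addr n l 0) \<and> (\<forall>a. a \<noteq> ''row'' \<longrightarrow> arr s' a = arr s a)"
  show "run (for_loop ''l'' (Var ''L'')
     (Seq (Store ''row'' (Var ''l'') (Var ''r'')) (Assign ''r'' (Add (Var ''r'') (Var ''L'')))))
     ((2 * n + 2) * (2 + 2) + 2) s' (?I (2 * n + 2))"
  proof (rule run_for[where I = ?I and T = 2])
    fix m s assume "m < 2 * n + 2" "?I m s" "reg s ''l'' = m"
    then show "run (Seq (Store ''row'' (Var ''l'') (Var ''r'')) (Assign ''r'' (Add (Var ''r'') (Var ''L'')))) 2 s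
        (\<lambda>s'. reg s' ''l'' = m \<and> ?I (Suc m) (set_reg ''l'' (Suc m) s'))"
      by (intro run_straight) (auto simp: addr_def less_Suc_eq)
  qed (use s' in \<open>auto simp: addr_def\<close>)
next
  fix s' :: state assume "reg s' ''n'' = n \<and> reg s' ''L'' = 2 * n + 2 \<and> reg s' ''r'' = addr n (2 * n + 2) 0 \<and>
    (\<forall>l<2 * n + 2. arr s' ''row'' l = addr n l 0) \<and> (\<forall>a. a \<noteq> ''row'' \<longrightarrow> arr s' a = arr s a)"
  then show "env n s' \<and> (\<forall>a. a \<noteq> ''row'' \<longrightarrow> arr s' a = arr s a)" by (auto simp: env_def)
qed simp


lemma index_inject [simp]:
  fixes p q :: nat
  assumes "p < 2" "q < 2"
  shows "2 * i + p = 2 * j + q \<longleftrightarrow> i = j \<and> p = q"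
  using assms by presburger

lemma index_inject_0 [simp]:
  fixes p :: nat
  assumes "p < 2"
  shows "2 * i + p = 2 * j \<longleftrightarrow> i = j \<and> p = 0"
  using assms by presburger

lemma matrix_set [simp]:
  "matrix n (set_reg x i s) = matrix n s"
  "a \<noteq> ''W'' \<Longrightarrow> matrix n (set_arr a i j s) = matrix n s"
  by (simp_all add: matrix_def fun_eq_iff)

lemma matrix_set_cell:
  "k \<le> 2 * n + 1 \<Longrightarrow> k' \<le> 2 * n + 1 \<Longrightarrow>
    matrix n (set_arr ''W'' (addr n l' k') x s) l k = (if l = l' \<and> k = k' then x else matrix n s l k)"
  by (simp add: matrix_def)

text \<open>
  The state after the first \<open>d\<close> diagonal entries have been set and the first \<open>i\<close> rows of the
  adjacency matrix and \<open>j\<close> entries of the next one have been read.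
\<close>

definition graph_read :: "nat \<Rightarrow> (nat \<Rightarrow> nat \<Rightarrow> bool) \<Rightarrow> nat \<Rightarrow> nat \<Rightarrow> nat \<Rightarrow> state \<Rightarrow> bool" where
  "graph_read n E d i j s \<longleftrightarrow>
     env n s \<and> (\<forall>i'<n. \<forall>j'<n. 0 < arr s ''adj'' (i' * n + j') \<longleftrightarrow> E i' j') \<and>
     reg s ''p'' = i * n + j \<and> arr s ''dead'' = (\<lambda>_. 0) \<and> arr s ''out'' = (\<lambda>_. 0) \<and>
     (\<forall>i'<n. \<forall>j'<n. arr s ''e'' (addr n i' j') \<noteq> 0 \<longleftrightarrow> (i' < i \<or> i' = i \<and> j' < j) \<and> E i' j') \<and>
     (\<forall>i'\<le>n. \<forall>j'\<le>n. \<forall>p<2. \<forall>q<2. matrix n s (2 * i' + p) (2 * j' + q) =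
        (if p = 0 then if q = 0 \<and> (i' < i \<or> i' = i \<and> j' < j) \<and> E i' j' then n + 1 else 0
         else if q = 1 \<and> i' = j' \<and> i' < d then 1 else 0))"

lemma read_edge_effect:
  assumes s: "graph_read n E d i j s" and ij: "reg s ''i'' = i" "reg s ''j'' = j" "i < n" "j < n"
  shows "graph_read n E d i (Suc j) (effect read_edge s)"
proof -
  have env: "env n s" and adj: "0 < arr s ''adj'' (i * n + j) \<longleftrightarrow> E i j" and p: "reg s ''p'' = i * n + j"
    using s ij unfolding graph_read_def by blast+
  have row: "arr s ''row'' i + j = addr n i j" "arr s ''row'' (2 * i) + 2 * j = addr n (2 * i) (2 * j)"
    using env_row[OF env, of i j] env_row[OF env, of "2 * i" "2 * j"] ij by auto
  show ?thesis
  proof (cases "E i j")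
    case True
    then have eff: "effect read_edge s = set_reg ''p'' (Suc (i * n + j))
        (set_arr ''W'' (addr n (2 * i) (2 * j)) (n + 1) (set_arr ''e'' (addr n i j) 1 s))"
      using ij p adj row env_n[OF env] by (simp add: read_edge_def)
    have le: "2 * j \<le> 2 * n + 1" using ij by simp
    show ?thesis
      unfolding graph_read_def eff
    proof (intro conjI)
      show "\<forall>i'<n. \<forall>j'<n. (arr (set_reg ''p'' (Suc (i * n + j)) (set_arr ''W'' (addr n (2 * i) (2 * j))
          (n + 1) (set_arr ''e'' (addr n i j) 1 s))) ''e'' (addr n i' j') \<noteq> 0) =
         ((i' < i \<or> i' = i \<and> j' < Suc j) \<and> E i' j')"
        using s ij True unfolding graph_read_def by (auto simp: less_Suc_eq)
      show "\<forall>i'\<le>n. \<forall>j'\<le>n. \<forall>p<2. \<forall>q<2. matrix n (set_reg ''p'' (Suc (i * n + j))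
          (set_arr ''W'' (addr n (2 * i) (2 * j)) (n + 1) (set_arr ''e'' (addr n i j) 1 s)))
          (2 * i' + p) (2 * j' + q) =
        (if p = 0 then if q = 0 \<and> (i' < i \<or> i' = i \<and> j' < Suc j) \<and> E i' j' then n + 1 else 0
         else if q = 1 \<and> i' = j' \<and> i' < d then 1 else 0)"
      proof (intro allI impI)
        fix i' j' p q :: nat assume *: "i' \<le> n" "j' \<le> n" "p < 2" "q < 2"
        have "2 * j' + q \<le> 2 * n + 1" using index_le * by blast
        then have "matrix n (set_reg ''p'' (Suc (i * n + j)) (set_arr ''W'' (addr n (2 * i) (2 * j)) (n + 1)
            (set_arr ''e'' (addr n i j) 1 s))) (2 * i' + p) (2 * j' + q) =
          (if i' = i \<and> p = 0 \<and> j' = j \<and> q = 0 then n + 1 else matrix n s (2 * i' + p) (2 * j' + q))"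
          using * le by (simp add: matrix_set_cell)
        also have "matrix n s (2 * i' + p) (2 * j' + q) =
          (if p = 0 then if q = 0 \<and> (i' < i \<or> i' = i \<and> j' < j) \<and> E i' j' then n + 1 else 0
           else if q = 1 \<and> i' = j' \<and> i' < d then 1 else 0)"
          using s * unfolding graph_read_def by blast
        finally show "matrix n (set_reg ''p'' (Suc (i * n + j)) (set_arr ''W'' (addr n (2 * i) (2 * j)) (n + 1)
            (set_arr ''e'' (addr n i j) 1 s))) (2 * i' + p) (2 * j' + q) =
          (if p = 0 then if q = 0 \<and> (i' < i \<or> i' = i \<and> j' < Suc j) \<and> E i' j' then n + 1 else 0
           else if q = 1 \<and> i' = j' \<and> i' < d then 1 else 0)"
          using True by (auto simp: less_Suc_eq)
      qed
    qed (use s in \<open>auto simp: graph_read_def\<close>)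
  next
    case False
    then have eff: "effect read_edge s = set_reg ''p'' (Suc (i * n + j)) s"
      using ij p adj by (simp add: read_edge_def)
    have "(i' < i \<or> i' = i \<and> j' < Suc j) \<and> E i' j' \<longleftrightarrow> (i' < i \<or> i' = i \<and> j' < j) \<and> E i' j'" for i' j'
      using False by (auto simp: less_Suc_eq)
    then show ?thesis using s unfolding eff graph_read_def by simp
  qed
qed

lemma read_edge_frame: "x \<noteq> ''p'' \<Longrightarrow> reg (effect read_edge s) x = reg s x"
  by (simp add: read_edge_def)

lemma graph_read_set_reg [simp]:
  "x \<noteq> ''n'' \<Longrightarrow> x \<noteq> ''p'' \<Longrightarrow> graph_read n E d i j (set_reg x y s) \<longleftrightarrow> graph_read n E d i j s"
  by (simp add: graph_read_def)

lemma graph_read_row: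
  assumes "\<And>i j. E i j \<Longrightarrow> j < n"
  shows "graph_read n E d i n s \<Longrightarrow> graph_read n E d (Suc i) 0 s"
proof -
  assume s: "graph_read n E d i n s"
  have "(i' < i \<or> i' = i \<and> j' < n) \<and> E i' j' \<longleftrightarrow> (i' < Suc i \<or> i' = Suc i \<and> j' < 0) \<and> E i' j'" for i' j'
    using assms by (auto simp: less_Suc_eq)
  then have eq: "(i' < i \<or> i' = i \<and> j' < n) \<and> E i' j' \<longleftrightarrow> (i' < Suc i \<or> i' = Suc i \<and> j' < 0) \<and> E i' j'" for i' j' .
  have "i * n + n = Suc i * n + 0" by simp
  then show ?thesis using s unfolding graph_read_def eq by simp
qed

lemma set_diagonal:
  assumes s: "graph_read n E i i 0 s" and i: "reg s ''i'' = i" "i < n"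
  shows "graph_read n E (Suc i) i 0
    (effect (set_cell ''W'' (index (Var ''i'') (Const 1)) (index (Var ''i'') (Const 1)) (Const 1)) s)"
proof -
  have env: "env n s" using s by (simp add: graph_read_def)
  have le: "2 * i + 1 \<le> 2 * n + 1" using i by simp
  have eff: "effect (set_cell ''W'' (index (Var ''i'') (Const 1)) (index (Var ''i'') (Const 1)) (Const 1)) s =
      set_arr ''W'' (addr n (2 * i + 1) (2 * i + 1)) 1 s"
    using env_row[OF env le, of "2 * i + 1"] i by simp
  have "matrix n (set_arr ''W'' (addr n (2 * i + 1) (2 * i + 1)) 1 s) (2 * i' + p) (2 * j' + q) =
      (if i' = i \<and> p = 1 \<and> j' = i \<and> q = 1 then 1 else matrix n s (2 * i' + p) (2 * j' + q))"
    if *: "i' \<le> n" "j' \<le> n" "p < 2" "q < 2" for i' j' p q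
  proof -
    have "2 * j' + q \<le> 2 * n + 1" using index_le * by blast
    then show ?thesis using * le by (simp only: matrix_set_cell index_inject) auto
  qed
  moreover have "matrix n s (2 * i' + p) (2 * j' + q) =
      (if p = 0 then if q = 0 \<and> (i' < i \<or> i' = i \<and> j' < 0) \<and> E i' j' then n + 1 else 0
       else if q = 1 \<and> i' = j' \<and> i' < i then 1 else 0)"
    if "i' \<le> n" "j' \<le> n" "p < 2" "q < 2" for i' j' p q
    using s that unfolding graph_read_def by blast
  ultimately have "matrix n (set_arr ''W'' (addr n (2 * i + 1) (2 * i + 1)) 1 s) (2 * i' + p) (2 * j' + q) =
      (if p = 0 then if q = 0 \<and> (i' < i \<or> i' = i \<and> j' < 0) \<and> E i' j' then n + 1 else 0
       else if q = 1 \<and> i' = j' \<and> i' < Suc i then 1 else 0)"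
    if "i' \<le> n" "j' \<le> n" "p < 2" "q < 2" for i' j' p q
    using that by (auto simp only: less_Suc_eq split: if_splits)
  then show ?thesis using s unfolding eff graph_read_def by simp
qed

lemma run_read_graph:
  assumes env: "env n s" and E: "\<And>i j. E i j \<Longrightarrow> i < n \<and> j < n" "irreflp E"
    and adj: "\<And>i j. i < n \<Longrightarrow> j < n \<Longrightarrow> 0 < arr s ''adj'' (i * n + j) \<longleftrightarrow> E i j"
    and zero: "\<And>a. a \<in> {''dead'', ''out'', ''e'', ''W''} \<Longrightarrow> arr s a = (\<lambda>_. 0)"
  shows "run read_graph (n * (n * 6 + 5) + 3) s (\<lambda>s'. env n s' \<and> arr s' ''dead'' = (\<lambda>_. 0) \<and>
     arr s' ''out'' = (\<lambda>_. 0) \<and> (\<forall>i<n. \<forall>j<n. arr s' ''e'' (addr n i j) \<noteq> 0 \<longleftrightarrow> E i j) \<and>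
     (\<forall>l\<le>2 * n + 1. \<forall>k\<le>2 * n + 1. matrix n s' l k = cover_cost n E l k))"
  unfolding read_graph_def
proof (rule run_mono[OF run_seq])
  show "run (Assign ''p'' (Const 0)) 1 s (graph_read n E 0 0 0)"
    by (rule run_straight) (use assms in \<open>simp_all add: graph_read_def matrix_def\<close>)
  fix s' assume s': "graph_read n E 0 0 0 s'"
  show "run (for_loop ''i'' (Var ''n'')
      (Seq (set_cell ''W'' (index (Var ''i'') (Const 1)) (index (Var ''i'') (Const 1)) (Const 1))
        (for_loop ''j'' (Var ''n'') read_edge))) (n * ((1 + (n * (4 + 2) + 2)) + 2) + 2) s'
      (graph_read n E n n 0)"
  proof (rule run_for[where I = "\<lambda>i. graph_read n E i i 0"])
    fix i s assume i: "i < n" "graph_read n E i i 0 s" "reg s ''i'' = i"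
    let ?I = "\<lambda>j s. graph_read n E (Suc i) i j s \<and> reg s ''i'' = i"
    show "run (Seq (set_cell ''W'' (index (Var ''i'') (Const 1)) (index (Var ''i'') (Const 1)) (Const 1))
        (for_loop ''j'' (Var ''n'') read_edge)) (1 + (n * (4 + 2) + 2)) s
      (\<lambda>s'. reg s' ''i'' = i \<and> graph_read n E (Suc i) (Suc i) 0 (set_reg ''i'' (Suc i) s'))"
    proof (rule run_mono[OF run_seq])
      show "run (set_cell ''W'' (index (Var ''i'') (Const 1)) (index (Var ''i'') (Const 1)) (Const 1)) 1 s (?I 0)"
        by (rule run_straight) (use set_diagonal[OF i(2,3,1)] i(3) in simp_all)
      fix s' assume I0: "?I 0 s'"
      show "run (for_loop ''j'' (Var ''n'') read_edge) (n * (4 + 2) + 2) s' (?I n)"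
      proof (rule run_for[where I = ?I])
        fix j s assume "j < n" "?I j s" "reg s ''j'' = j"
        then show "run read_edge 4 s (\<lambda>s'. reg s' ''j'' = j \<and> ?I (Suc j) (set_reg ''j'' (Suc j) s'))"
          using read_edge_effect[of n E "Suc i" i j s] i(1) read_edge_frame[of _ s]
          by (intro run_straight) (auto simp: read_edge_def)
      qed (use I0 in \<open>auto simp: graph_read_def env_n\<close>)
    qed (use graph_read_row[of E n "Suc i" i] E in auto)
  qed (use s' in \<open>auto simp: graph_read_def env_n\<close>)
next
  fix s' assume s': "graph_read n E n n 0 s'"
  \<comment> \<open>Each index is split into vertex and value by division by 2, the form in which
    \<open>graph_read\<close> describes the matrix.\<close>
  have "matrix n s' l k = cover_cost n E l k" if "l \<le> 2 * n + 1" "k \<le> 2 * n + 1" for l k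
  proof -
    have lk: "l div 2 \<le> n" "k div 2 \<le> n" "l mod 2 < 2" "k mod 2 < 2" using that by auto
    then have "matrix n s' (2 * (l div 2) + l mod 2) (2 * (k div 2) + k mod 2) =
      (if l mod 2 = 0 then if k mod 2 = 0 \<and> (l div 2 < n \<or> l div 2 = n \<and> k div 2 < 0) \<and> E (l div 2) (k div 2)
         then n + 1 else 0
       else if k mod 2 = 1 \<and> l div 2 = k div 2 \<and> l div 2 < n then 1 else 0)"
      using s' unfolding graph_read_def by blast
    note entry = this
    have m: "matrix n s' l k =
      (if l mod 2 = 0 then if k mod 2 = 0 \<and> E (l div 2) (k div 2) then n + 1 else 0
       else if k mod 2 = 1 \<and> l div 2 = k div 2 \<and> l div 2 < n then 1 else 0)"
    proof (cases "E (l div 2) (k div 2)")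
      case True
      then have "l div 2 < n" using E(1) by blast
      then show ?thesis using entry by (simp only: mult_div_mod_eq simp_thms True)
    next
      case False
      then show ?thesis using entry lk(1) by (simp only: mult_div_mod_eq simp_thms False not_less_zero le_less if_cancel)
    qed
    show ?thesis
    proof (cases "even l")
      case True
      then have "l mod 2 = 0" by presburger
      moreover have "k mod 2 = 0 \<longleftrightarrow> even k" by presburger
      ultimately show ?thesis using True by (simp add: m cover_cost_def)
    next
      case False
      then obtain i where l: "l = 2 * i + 1" by (rule oddE)
      have "k = 2 * i + 1" if "k mod 2 = 1" "k div 2 = i" using that mult_div_mod_eq[of 2 k] by simp
      then have iff: "k mod 2 = 1 \<and> i = k div 2 \<and> i < n \<longleftrightarrow> l = k \<and> l < 2 * n" unfolding l by auto
      have lm: "l mod 2 = 1" "l div 2 = i" using l by auto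
      have "matrix n s' l k = (if l = k \<and> l < 2 * n then 1 else 0)"
        by (simp only: m lm iff one_neq_zero if_False)
      then show ?thesis using False by (simp add: cover_cost_def)
    qed
  qed
  then show "env n s' \<and> arr s' ''dead'' = (\<lambda>_. 0) \<and>
     arr s' ''out'' = (\<lambda>_. 0) \<and> (\<forall>i<n. \<forall>j<n. arr s' ''e'' (addr n i j) \<noteq> 0 \<longleftrightarrow> E i j) \<and>
     (\<forall>l\<le>2 * n + 1. \<forall>k\<le>2 * n + 1. matrix n s' l k = cover_cost n E l k)"
    using s' unfolding graph_read_def by simp
qed (simp add: algebra_simps)

section \<open>Choosing and eliminating a vertex\<close>

definition live_neighbours :: "nat \<Rightarrow> state \<Rightarrow> nat \<Rightarrow> nat set" where
  "live_neighbours n s v = {j. j < n \<and> arr s ''e'' (addr n v j) \<noteq> 0 \<and> arr s ''dead'' j = 0}"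

lemma finite_live_neighbours [simp]: "finite (live_neighbours n s v)"
  by (simp add: live_neighbours_def)

text \<open>The new j exceeds all of \<open>N\<close>, so with one earlier neighbour the pair comes
  out ordered as required.\<close>

lemma neighbourhood_insert:
  assumes nb: "card N \<le> 2 \<Longrightarrow> neighbourhood n N a b d" and N: "finite N" "N \<subseteq> {..<j}" 
    and card: "card (insert j N) \<le> 2"
  shows "neighbourhood n (insert j N) (if card N < 1 then j else a) j (if card N < 1 then d else j)"
proof -
  have "j \<notin> N" using N by auto
  then have "card N \<le> 1" using card N by simp
  then consider "N = {}" | x where "N = {x}" using N(1)
    by (metis One_nat_def card_0_eq card_1_singletonE le_Suc_eq le_zero_eq)
  then show ?thesis
  proof cases
    case 1
    then show ?thesis using nb by (auto simp: neighbourhood_def)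
  next
    case 2
    then have "a = x" using nb by (auto simp: neighbourhood_def)
    moreover have "x < j" using 2 N by auto
    ultimately show ?thesis using 2 by (auto simp: neighbourhood_def)
  qed
qed

lemma run_find_neighbours:
  assumes env: "env n s" and v: "reg s ''v'' = v" "v < n"
  shows "run find_neighbours (n * 7 + 6) s (\<lambda>s'. (arr s' = arr s \<and>
     (\<forall>x. x \<notin> {''c'', ''a'', ''b'', ''d'', ''j''} \<longrightarrow> reg s' x = reg s x)) \<and>
     reg s' ''c'' = card (live_neighbours n s v) \<and>
     (card (live_neighbours n s v) \<le> 2 \<longrightarrow>
        neighbourhood n (live_neighbours n s v) (reg s' ''a'') (reg s' ''b'') (reg s' ''d'')))"
proof -
  define N where "N j = live_neighbours n s v \<inter> {..<j}" for j
  let ?F = "\<lambda>s' :: state. arr s' = arr s \<and> (\<forall>x. x \<notin> {''c'', ''a'', ''b'', ''d'', ''j''} \<longrightarrow> reg s' x = reg s x)"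
  let ?I = "\<lambda>j (s' :: state). ?F s' \<and> reg s' ''c'' = card (N j) \<and>
     (card (N j) \<le> 2 \<longrightarrow> neighbourhood n (N j) (reg s' ''a'') (reg s' ''b'') (reg s' ''d''))"
  show ?thesis
    unfolding find_neighbours_def
  proof (rule run_mono[OF run_seq])
  show "run (Seq (Assign ''c'' (Const 0)) (Seq (Assign ''a'' (Var ''n'')) (Seq (Assign ''b'' (Var ''n''))
      (Assign ''d'' (Var ''n''))))) 4 s (?I 0)"
    by (rule run_straight) (use env_n[OF env] in \<open>auto simp: neighbourhood_def N_def\<close>)
  fix s' :: state assume s': "?I 0 s'"
  show "run (for_loop ''j'' (Var ''n'') scan_neighbour) (n * (5 + 2) + 2) s' (?I n)"
  proof (rule run_for[where I = ?I and T = 5])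
    fix j and s' :: state assume j: "j < n" and I: "?I j s'" and rj: "reg s' ''j'' = j"
    have env': "env n s'" using env I by (simp add: env_def)
    have row: "arr s ''row'' v + j = addr n v j" using env_row[OF env] v by simp
    have guard: "bval (BAnd (BLess (Const 0) (cell ''e'' (Var ''v'') (Var ''j'')))
        (BLess (Idx ''dead'' (Var ''j'')) (Const 1))) s' \<longleftrightarrow> j \<in> live_neighbours n s v"
      using I rj v j row by (simp add: live_neighbours_def)
    show "run scan_neighbour 5 s' (\<lambda>s'. reg s' ''j'' = j \<and> ?I (Suc j) (set_reg ''j'' (Suc j) s'))"
    proof (rule run_straight)
      show "reg (effect scan_neighbour s') ''j'' = j \<and> ?I (Suc j) (set_reg ''j'' (Suc j) (effect scan_neighbour s'))"
      proof (cases "j \<in> live_neighbours n s v")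
        case True
        then have N: "N (Suc j) = insert j (N j)" "j \<notin> N j" by (auto simp: N_def less_Suc_eq)
        have fin: "finite (N j)" "N j \<subseteq> {..<j}" by (auto simp: N_def)
        have card: "card (N (Suc j)) = Suc (card (N j))" using N fin by simp
        have eff: "effect scan_neighbour s' = set_reg ''c'' (Suc (card (N j))) (set_reg ''b'' j
            (if card (N j) < 1 then set_reg ''a'' j s' else set_reg ''d'' j s'))"
        proof -
          have "effect scan_neighbour s' =
              effect (Seq (Cond (BLess (Var ''c'') (Const 1)) (Assign ''a'' (Var ''j'')) (Assign ''d'' (Var ''j'')))
                (Seq (Assign ''b'' (Var ''j'')) (Assign ''c'' (Add (Var ''c'') (Const 1))))) s'"
            using True by (simp only: scan_neighbour_def effect.simps(4) guard if_True)
          then show ?thesis using I rj by simp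
        qed
        have nb: "neighbourhood n (N (Suc j)) (if card (N j) < 1 then j else reg s' ''a'') j
            (if card (N j) < 1 then reg s' ''d'' else j)" if "card (N (Suc j)) \<le> 2"
          unfolding N(1) by (rule neighbourhood_insert[of _ _ _ "reg s' ''b''"]) (use I that N fin in auto)
        show ?thesis
        proof (cases "card (N j) < 1")
          case True
          then show ?thesis using I rj nb unfolding eff by (simp add: card)
        next
          case False
          then show ?thesis using I rj nb unfolding eff by (simp add: card)
        qed
      next
        case False
        then have "N (Suc j) = N j" by (auto simp: N_def less_Suc_eq)
        moreover have "effect scan_neighbour s' = s'"
          using False by (simp only: scan_neighbour_def effect.simps guard if_False)
        ultimately show ?thesis using I rj by simp
      qed
    qed (simp_all add: scan_neighbour_def)
  qed (use s' env_n[OF env] in auto)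
  next
    have "N n = live_neighbours n s v" by (auto simp: N_def live_neighbours_def)
    then show "?F s' \<and> reg s' ''c'' = card (live_neighbours n s v) \<and>
       (card (live_neighbours n s v) \<le> 2 \<longrightarrow>
          neighbourhood n (live_neighbours n s v) (reg s' ''a'') (reg s' ''b'') (reg s' ''d''))"
      if "?I n s'" for s' :: state
      using that by simp
  qed simp
qed

lemma run_select:
  assumes env: "env n s"
    and ex: "v\<^sub>0 < n" "arr s ''dead'' v\<^sub>0 = 0" "card (live_neighbours n s v\<^sub>0) \<le> 2"
  shows "run select (n * (n * 7 + 14) + 2) s (\<lambda>s'. arr s' = arr s \<and> env n s' \<and> reg s' ''t'' = reg s ''t'' \<and>
     reg s' ''sv'' < n \<and> arr s ''dead'' (reg s' ''sv'') = 0 \<and>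
     neighbourhood n (live_neighbours n s (reg s' ''sv'')) (reg s' ''sa'') (reg s' ''sb'') (reg s' ''sd''))"
proof -
  define good where "good v \<longleftrightarrow> arr s ''dead'' v = 0 \<and> card (live_neighbours n s v) \<le> 2" for v
  have good_Suc: "(\<exists>u<Suc v. good u) \<longleftrightarrow> (\<exists>u<v. good u) \<or> good v" for v
    by (auto simp: less_Suc_eq)
  let ?F = "\<lambda>s' :: state. arr s' = arr s \<and> env n s' \<and> reg s' ''t'' = reg s ''t''"
  let ?S = "\<lambda>s'. reg s' ''sv'' < n \<and> arr s ''dead'' (reg s' ''sv'') = 0 \<and>
     neighbourhood n (live_neighbours n s (reg s' ''sv'')) (reg s' ''sa'') (reg s' ''sb'') (reg s' ''sd'')"
  let ?I = "\<lambda>m s'. ?F s' \<and> ((\<exists>v<m. good v) \<longrightarrow> ?S s')"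
  have "run select (n * (n * 7 + 14) + 2) s (?I n)"
    unfolding select_def
  proof (rule run_for[where T = "Suc (n * 7 + 6 + 5)" and I = ?I])
    fix v and s' :: state assume v: "v < n" and I: "?I v s'" and rv: "reg s' ''v'' = v"
    let ?Q = "\<lambda>s'. reg s' ''v'' = v \<and> ?I (Suc v) (set_reg ''v'' (Suc v) s')"
    have live: "live_neighbours n s' v = live_neighbours n s v" using I by (simp add: live_neighbours_def)
    show "run (Cond (BLess (Idx ''dead'' (Var ''v'')) (Const 1))
         (Seq find_neighbours
              (Cond (BLess (Var ''c'') (Const 3))
                (Seq (Assign ''sv'' (Var ''v''))
                (Seq (Assign ''sa'' (Var ''a''))
                (Seq (Assign ''sb'' (Var ''b''))
                     (Assign ''sd'' (Var ''d'')))))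
                Skip))
         Skip) (Suc (n * 7 + 6 + 5)) s' ?Q"
    proof (rule run_cond)
      assume "bval (BLess (Idx ''dead'' (Var ''v'')) (Const 1)) s'"
      then have dead: "arr s ''dead'' v = 0" using I rv by simp
      show "run (Seq find_neighbours
              (Cond (BLess (Var ''c'') (Const 3))
                (Seq (Assign ''sv'' (Var ''v''))
                (Seq (Assign ''sa'' (Var ''a''))
                (Seq (Assign ''sb'' (Var ''b''))
                     (Assign ''sd'' (Var ''d'')))))
                Skip)) (n * 7 + 6 + 5) s' ?Q"
      proof (rule run_seq[OF run_find_neighbours[OF _ rv v]])
        show "env n s'" using I by simp
        fix s'' :: state assume s'': "(arr s'' = arr s' \<and>
           (\<forall>x. x \<notin> {''c'', ''a'', ''b'', ''d'', ''j''} \<longrightarrow> reg s'' x = reg s' x)) \<and>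
           reg s'' ''c'' = card (live_neighbours n s' v) \<and>
           (card (live_neighbours n s' v) \<le> 2 \<longrightarrow>
              neighbourhood n (live_neighbours n s' v) (reg s'' ''a'') (reg s'' ''b'') (reg s'' ''d''))"
        then have "reg s'' ''n'' = reg s' ''n''" "arr s'' = arr s'" by simp_all
        moreover have "env n s'" using I by blast
        ultimately have env'': "env n s''" by (simp add: env_def)
        show "run (Cond (BLess (Var ''c'') (Const 3))
                (Seq (Assign ''sv'' (Var ''v''))
                (Seq (Assign ''sa'' (Var ''a''))
                (Seq (Assign ''sb'' (Var ''b''))
                     (Assign ''sd'' (Var ''d'')))))
                Skip) 5 s'' ?Q"
        proof (rule run_straight)
          have regs: "reg s'' ''t'' = reg s ''t''" "reg s'' ''v'' = v" "arr s'' = arr s"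
            "reg s'' ''sv'' = reg s' ''sv''" "reg s'' ''sa'' = reg s' ''sa''"
            "reg s'' ''sb'' = reg s' ''sb''" "reg s'' ''sd'' = reg s' ''sd''"
            "reg s'' ''c'' = card (live_neighbours n s v)"
            using s'' I rv live by simp_all
          show "?Q (effect (Cond (BLess (Var ''c'') (Const 3))
                (Seq (Assign ''sv'' (Var ''v''))
                (Seq (Assign ''sa'' (Var ''a''))
                (Seq (Assign ''sb'' (Var ''b''))
                     (Assign ''sd'' (Var ''d'')))))
                Skip) s'')"
          proof (cases "card (live_neighbours n s v) \<le> 2")
            case True
            then have "neighbourhood n (live_neighbours n s v) (reg s'' ''a'') (reg s'' ''b'') (reg s'' ''d'')"
              using s'' live by simp
            then show ?thesis using True regs v dead env'' by simp
          next
            case False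
            then have "(\<exists>u<Suc v. good u) \<longleftrightarrow> (\<exists>u<v. good u)" using good_Suc by (simp add: good_def)
            then show ?thesis using False I regs env'' by simp
          qed
        qed simp_all
      qed
    next
      assume "\<not> bval (BLess (Idx ''dead'' (Var ''v'')) (Const 1)) s'"
      then have "arr s ''dead'' v \<noteq> 0" using I rv by simp
      then have "(\<exists>u<Suc v. good u) \<longleftrightarrow> (\<exists>u<v. good u)" using good_Suc by (simp add: good_def)
      then show "run Skip (n * 7 + 6 + 5) s' ?Q"
        using I rv by (intro run_straight) simp_all
    qed
  qed (use env in \<open>auto simp: env_n\<close>)
  moreover have "\<exists>v<n. good v" using ex by (auto simp: good_def)
  ultimately show ?thesis by (elim run_mono) simp_all
qed

text \<open>\<open>P\<close> is the set of value pairs already sent; a partial message is modelled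
  as a full one that vanishes outside \<open>P\<close>.\<close>

lemma run_send_message:
  assumes env: "env n s" and r: "reg s ''sv'' = v" "reg s ''sa'' = a" "reg s ''sb'' = b" "reg s ''sd'' = d"
    and le: "v < n" "a \<le> n" "b \<le> n" "d \<le> n" and v: "v \<noteq> a" "v \<noteq> b"
    and pq: "p < 2" "q < 2"
    and M: "\<forall>l\<le>2 * n + 1. \<forall>k\<le>2 * n + 1. matrix n s l k =
      add_message W a b (\<lambda>p q. if (p, q) \<in> P then message W v a d p q else 0) l k"
    and P: "(p, q) \<notin> P"
  shows "run (send_message p q) 1 s (\<lambda>s'. env n s' \<and> reg s' = reg s \<and>
     (\<forall>a. a \<noteq> ''W'' \<longrightarrow> arr s' a = arr s a) \<and>
     (\<forall>l\<le>2 * n + 1. \<forall>k\<le>2 * n + 1. matrix n s' l k =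
      add_message W a b (\<lambda>p' q'. if (p', q') \<in> insert (p, q) P then message W v a d p' q' else 0) l k))"
proof (rule run_straight)
  let ?M = "\<lambda>P. add_message W a b (\<lambda>p q. if (p, q) \<in> P then message W v a d p q else 0)"
  let ?l = "2 * a + p" and ?k = "2 * b + q"
  have lk: "?l \<le> 2 * n + 1" "?k \<le> 2 * n + 1" using le pq by (auto intro: index_le)
  \<comment> \<open>As v differs from a and b, the updates made so far leave every entry involving v
    as in \<open>W\<close>.\<close>
  have loc: "local_cost (matrix n s) v a d z p q = local_cost W v a d z p q" if "z < 2" for z
  proof (rule local_cost_cong[of n])
    fix l k assume *: "l \<le> 2 * n + 1" "k \<le> 2 * n + 1" "l div 2 = v \<or> k div 2 = v"
    then have "\<not> (l div 2 = a \<and> k div 2 = b)" using v by auto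
    then show "matrix n s l k = W l k" using M * by (auto simp: add_message_def)
  qed (use le pq that in auto)
  have eff: "effect (send_message p q) s =
      set_arr ''W'' (addr n ?l ?k) (matrix n s ?l ?k + message W v a d p q) s"
    using r env_row[OF env lk(1), of ?k] le pq loc[of 0] loc[of 1]
    by (simp add: send_message_def Let_def aval_local_cost_exp[OF env] matrix_def[symmetric] message_def)
  have "matrix n (effect (send_message p q) s) l k = ?M (insert (p, q) P) l k"
    if *: "l \<le> 2 * n + 1" "k \<le> 2 * n + 1" for l k
  proof (cases "l = ?l \<and> k = ?k")
    case True
    then show ?thesis
      using M P lk pq by (simp add: eff matrix_set_cell add_message_def)
  next
    case False
    then have "matrix n (effect (send_message p q) s) l k = ?M P l k"
      unfolding eff using M * lk by (simp only: matrix_set_cell) simp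
    moreover have "\<not> (l div 2 = a \<and> k div 2 = b \<and> l mod 2 = p \<and> k mod 2 = q)" using False by auto
    ultimately show ?thesis by (auto simp: add_message_def)
  qed
  then show "env n (effect (send_message p q) s) \<and> reg (effect (send_message p q) s) = reg s \<and>
     (\<forall>a. a \<noteq> ''W'' \<longrightarrow> arr (effect (send_message p q) s) a = arr s a) \<and>
     (\<forall>l\<le>2 * n + 1. \<forall>k\<le>2 * n + 1. matrix n (effect (send_message p q) s) l k = ?M (insert (p, q) P) l k)"
    using env by (simp add: eff)
qed (simp_all add: send_message_def Let_def)

lemma run_send_messages:
  assumes env: "env n s" and r: "reg s ''sv'' = v" "reg s ''sa'' = a" "reg s ''sb'' = b" "reg s ''sd'' = d"
    and le: "v < n" "a \<le> n" "b \<le> n" "d \<le> n" and v: "v \<noteq> a" "v \<noteq> b"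
  shows "run send_messages 4 s (\<lambda>s'. env n s' \<and> reg s' = reg s \<and>
     (\<forall>a. a \<noteq> ''W'' \<longrightarrow> arr s' a = arr s a) \<and>
     (\<forall>l\<le>2 * n + 1. \<forall>k\<le>2 * n + 1. matrix n s' l k =
      add_message (matrix n s) a b (message (matrix n s) v a d) l k))"
proof -
  let ?W = "matrix n s"
  let ?M = "\<lambda>P. add_message ?W a b (\<lambda>p q. if (p, q) \<in> P then message ?W v a d p q else 0)"
  let ?Q = "\<lambda>P s'. env n s' \<and> reg s' = reg s \<and> (\<forall>a. a \<noteq> ''W'' \<longrightarrow> arr s' a = arr s a) \<and>
     (\<forall>l\<le>2 * n + 1. \<forall>k\<le>2 * n + 1. matrix n s' l k = ?M P l k)"
  have step: "run (send_message p q) 1 s' (?Q (insert (p, q) P))"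
    if "?Q P s'" "p < 2" "q < 2" "(p, q) \<notin> P" for p q P s'
  proof (rule run_mono[OF run_send_message[where n = n and s = s' and W = ?W and P = P and v = v and a = a
          and b = b and d = d and p = p and q = q]])
  qed (use that r le v in auto)
  have "run send_messages (1 + (1 + (1 + 1))) s (?Q {(1, 1), (1, 0), (0, 1), (0, 0)})"
    unfolding send_messages_def
    by (intro run_seq[where P = "?Q {(0, 0)}"] run_seq[where P = "?Q {(0, 1), (0, 0)}"]
        run_seq[where P = "?Q {(1, 0), (0, 1), (0, 0)}"] step)
      (use env in \<open>simp_all add: add_message_def\<close>)
  moreover have "?M {(1, 1), (1, 0), (0, 1), (0, 0)} l k = add_message ?W a b (message ?W v a d) l k" for l k
    using less_2_cases[of "l mod 2"] less_2_cases[of "k mod 2"] by (auto simp: add_message_def)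
  ultimately show ?thesis by (elim run_mono) auto
qed

text \<open>\<open>R\<close> and \<open>E\<close> exist only in the proof: the dead flags determine
  \<open>R\<close>, and the edge array represents \<open>E\<close> on \<open>R\<close> alone. The
  cardinality makes \<open>R\<close> empty after n rounds.\<close>

definition eliminated :: "nat \<Rightarrow> (nat \<Rightarrow> nat \<Rightarrow> nat) \<Rightarrow> nat \<Rightarrow> state \<Rightarrow> bool" where
  "eliminated n W\<^sub>0 t s \<longleftrightarrow> env n s \<and> arr s ''out'' = (\<lambda>_. 0) \<and>
     (\<exists>R E. elimination_invariant n W\<^sub>0 R E (matrix n s) (arr s ''A'') (arr s ''D'')
              (map (arr s ''ord'') (rev [0..<t])) \<and>
        card R = n - t \<and> (\<forall>i<n. arr s ''dead'' i = 0 \<longleftrightarrow> i \<in> R) \<and>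
        (\<forall>i\<in>R. \<forall>j\<in>R. arr s ''e'' (addr n i j) \<noteq> 0 \<longleftrightarrow> E i j))"

lemma eliminated_set_reg [simp]: "x \<noteq> ''n'' \<Longrightarrow> eliminated n W\<^sub>0 t (set_reg x y s) \<longleftrightarrow> eliminated n W\<^sub>0 t s"
  by (simp add: eliminated_def)

lemma run_elimination_round:
  assumes s: "eliminated n W\<^sub>0 t s" and t: "t < n" "reg s ''t'' = t"
  shows "run (Seq select (Seq record_elimination send_messages)) (n * (n * 7 + 14) + 13) s
     (\<lambda>s'. reg s' ''t'' = t \<and> eliminated n W\<^sub>0 (Suc t) s')"
proof -
  obtain R E where inv: "elimination_invariant n W\<^sub>0 R E (matrix n s) (arr s ''A'') (arr s ''D'')
              (map (arr s ''ord'') (rev [0..<t]))"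
    and card: "card R = n - t" and dead: "\<And>i. i < n \<Longrightarrow> arr s ''dead'' i = 0 \<longleftrightarrow> i \<in> R"
    and e: "\<And>i j. i \<in> R \<Longrightarrow> j \<in> R \<Longrightarrow> arr s ''e'' (addr n i j) \<noteq> 0 \<longleftrightarrow> E i j"
    using s unfolding eliminated_def by blast
  have env: "env n s" and out: "arr s ''out'' = (\<lambda>_. 0)" using s by (simp_all add: eliminated_def)
  have R: "R \<subseteq> {..<n}" and sym: "symp E" and irr: "irreflp E" and thin: "thin E"
    and ER: "\<And>i j. E i j \<Longrightarrow> j \<in> R"
    and ord: "set (map (arr s ''ord'') (rev [0..<t])) \<subseteq> {..<n} - R"
    using inv unfolding elimination_invariant_def by blast+
  have live: "live_neighbours n s v = {j. E v j}" if "v \<in> R" for v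
  proof -
    have "j < n \<and> arr s ''e'' (addr n v j) \<noteq> 0 \<and> arr s ''dead'' j = 0 \<longleftrightarrow> E v j" for j
      using e[OF that, of j] dead[of j] ER[of v j] R by blast
    then show ?thesis by (simp add: live_neighbours_def)
  qed
  have "finite R" "R \<noteq> {}" using R finite_subset card t by auto
  \<comment> \<open>Thinness of the current graph guarantees that the search succeeds in every
    round.\<close>
  then obtain v\<^sub>0 where "v\<^sub>0 \<in> R" "card {j \<in> R. E v\<^sub>0 j} \<le> 2"
    using thin_low_degree[OF sym irr thin] by blast
  moreover have "{j \<in> R. E v j} = {j. E v j}" for v using ER by blast
  ultimately have v0: "v\<^sub>0 < n" "arr s ''dead'' v\<^sub>0 = 0" "card (live_neighbours n s v\<^sub>0) \<le> 2"
    using live R dead by auto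
  have "run (Seq select (Seq record_elimination send_messages)) ((n * (n * 7 + 14) + 2) + (7 + 4)) s
     (\<lambda>s'. reg s' ''t'' = t \<and> eliminated n W\<^sub>0 (Suc t) s')"
  proof (rule run_seq[OF run_select[OF env v0] run_seq])
    fix s1 assume "arr s1 = arr s \<and> env n s1 \<and> reg s1 ''t'' = reg s ''t'' \<and>
     reg s1 ''sv'' < n \<and> arr s ''dead'' (reg s1 ''sv'') = 0 \<and>
     neighbourhood n (live_neighbours n s (reg s1 ''sv'')) (reg s1 ''sa'') (reg s1 ''sb'') (reg s1 ''sd'')"
    moreover define v a b d where "v = reg s1 ''sv''" "a = reg s1 ''sa''" "b = reg s1 ''sb''" "d = reg s1 ''sd''"
    ultimately have s1: "arr s1 = arr s" "env n s1" "reg s1 ''t'' = t" "v < n" "v \<in> R"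
      and nb: "neighbourhood n {j. E v j} a b d"
      using t(2) dead live by auto
    define N where "N = {j. E v j}"
    have N: "N \<subseteq> R - {v}" "neighbourhood n N a b d"
      using ER irr nb by (auto simp: N_def irreflp_def)
    have ab: "a \<in> R - {v} \<and> b \<in> R - {v} \<or> a = n \<and> b = n" "d \<in> R - {v} \<or> d = n"
      using N by (auto simp: neighbourhood_def)
    have le: "a \<le> n" "b \<le> n" "d \<le> n" "v \<noteq> a" "v \<noteq> b" using ab R s1(4) by auto
    \<comment> \<open>The two guarded stores into the edge array realise exactly the elimination of
      v.\<close>
    have edge: "eliminate E v i j \<longleftrightarrow> E i j \<or> a < b \<and> (i = a \<and> j = b \<or> i = b \<and> j = a)"
      if "i \<in> R - {v}" "j \<in> R - {v}" for i j
    proof -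
      have "E i v \<and> E v j \<and> i \<noteq> j \<longleftrightarrow> i \<in> N \<and> j \<in> N \<and> i \<noteq> j"
        using sym by (auto simp: N_def dest: sympD)
      also have "\<dots> \<longleftrightarrow> a < b \<and> (i = a \<and> j = b \<or> i = b \<and> j = a)"
        using N that by (auto simp: neighbourhood_def)
      finally show ?thesis using that irr by (auto simp: eliminate_def irreflp_def)
    qed
    let ?s = "set_arr ''D'' v d (set_arr ''A'' v a (set_arr ''ord'' t v (set_arr ''dead'' v 1 s1)))"
    let ?Q = "\<lambda>s' :: state. env n s' \<and> reg s' = reg s1 \<and> matrix n s' = matrix n s \<and>
      arr s' ''dead'' = (arr s ''dead'')(v := 1) \<and> arr s' ''ord'' = (arr s ''ord'')(t := v) \<and>
      arr s' ''A'' = (arr s ''A'')(v := a) \<and> arr s' ''D'' = (arr s ''D'')(v := d) \<and>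
      arr s' ''out'' = (\<lambda>_. 0) \<and>
      (\<forall>i\<in>R - {v}. \<forall>j\<in>R - {v}. arr s' ''e'' (addr n i j) \<noteq> 0 \<longleftrightarrow> eliminate E v i j)"
    show "run record_elimination 7 s1 ?Q"
    proof (rule run_straight)
      have row: "arr s ''row'' a + b = addr n a b" "arr s ''row'' b + a = addr n b a"
        using env_row[OF env, of a b] env_row[OF env, of b a] le by auto
      have eff: "effect record_elimination s1 =
          (if a < b then set_arr ''e'' (addr n b a) 1 (set_arr ''e'' (addr n a b) 1 ?s) else ?s)"
        using s1 row by (simp add: record_elimination_def v_a_b_d_def)
      have "arr (effect record_elimination s1) ''e'' (addr n i j) \<noteq> 0 \<longleftrightarrow> eliminate E v i j"
        if ij: "i \<in> R - {v}" "j \<in> R - {v}" for i j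
      proof -
        have "j \<le> 2 * n + 1" "a \<le> 2 * n + 1" "b \<le> 2 * n + 1" using ij le R by auto
        then have "arr (effect record_elimination s1) ''e'' (addr n i j) \<noteq> 0 \<longleftrightarrow>
            arr s ''e'' (addr n i j) \<noteq> 0 \<or> a < b \<and> (i = a \<and> j = b \<or> i = b \<and> j = a)"
          unfolding eff using s1(1) by auto
        then show ?thesis using edge[OF ij] e[of i j] ij by simp
      qed
      then show "?Q (effect record_elimination s1)"
        using s1 out by (auto simp: eff matrix_def fun_eq_iff)
    qed (simp_all add: record_elimination_def)
    fix s2 assume s2: "?Q s2"
    show "run send_messages 4 s2 (\<lambda>s'. reg s' ''t'' = t \<and> eliminated n W\<^sub>0 (Suc t) s')"
    proof (rule run_mono[OF run_send_messages[of n s2 v a b d]])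
      fix s3 assume s3: "env n s3 \<and> reg s3 = reg s2 \<and> (\<forall>a. a \<noteq> ''W'' \<longrightarrow> arr s3 a = arr s2 a) \<and>
         (\<forall>l\<le>2 * n + 1. \<forall>k\<le>2 * n + 1. matrix n s3 l k =
            add_message (matrix n s2) a b (message (matrix n s2) v a d) l k)"
      have arrs: "arr s3 ''A'' = (arr s ''A'')(v := a)" "arr s3 ''D'' = (arr s ''D'')(v := d)"
        "arr s3 ''ord'' = (arr s ''ord'')(t := v)" "arr s3 ''dead'' = (arr s ''dead'')(v := 1)"
        "arr s3 ''out'' = (\<lambda>_. 0)"
        "arr s3 ''e'' = arr s2 ''e''"
        using s2 s3 by simp_all
      have ord_eq: "map (arr s3 ''ord'') (rev [0..<Suc t]) = v # map (arr s ''ord'') (rev [0..<t])"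
        by (simp add: arrs)
      have "elimination_invariant n W\<^sub>0 (R - {v}) (eliminate E v) (matrix n s3) (arr s3 ''A'') (arr s3 ''D'')
          (map (arr s3 ''ord'') (rev [0..<Suc t]))"
        unfolding ord_eq arrs(1,2)
        by (rule elimination_step[OF inv s1(5) nb]) (use s2 s3 in simp)
      moreover have "card (R - {v}) = n - Suc t" using card s1(5) \<open>finite R\<close> by simp
      moreover have "\<forall>i<n. arr s3 ''dead'' i = 0 \<longleftrightarrow> i \<in> R - {v}" using dead by (simp add: arrs)
      moreover have "\<forall>i\<in>R - {v}. \<forall>j\<in>R - {v}. arr s3 ''e'' (addr n i j) \<noteq> 0 \<longleftrightarrow> eliminate E v i j"
        using s2 by (simp add: arrs)
      ultimately have "eliminated n W\<^sub>0 (Suc t) s3"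
        unfolding eliminated_def using s3 arrs(5) by blast
      then show "reg s3 ''t'' = t \<and> eliminated n W\<^sub>0 (Suc t) s3" using s1 s2 s3 by simp
    qed (use s2 s1 le in \<open>auto simp: v_a_b_d_def\<close>)
  qed
  then show ?thesis by (rule run_mono) simp_all
qed

lemma run_eliminate_all:
  assumes "eliminated n W\<^sub>0 0 s"
  shows "run eliminate_all (n * (n * (n * 7 + 14) + 15) + 2) s (eliminated n W\<^sub>0 n)"
  unfolding eliminate_all_def
proof (rule run_for[where I = "eliminated n W\<^sub>0" and T = "n * (n * 7 + 14) + 13"])
  fix t s assume "t < n" "eliminated n W\<^sub>0 t s" "reg s ''t'' = t"
  then show "run (Seq select (Seq record_elimination send_messages)) (n * (n * 7 + 14) + 13) s
     (\<lambda>s'. reg s' ''t'' = t \<and> eliminated n W\<^sub>0 (Suc t) (set_reg ''t'' (Suc t) s'))"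
    using run_elimination_round by simp
qed (use assms in \<open>auto simp: eliminated_def env_n\<close>)

section \<open>Backtracking on the machine\<close>

lemma run_backtrack:
  assumes s: "eliminated n W\<^sub>0 n s"
  shows "run (for_loop ''t'' (Var ''n'') backtrack_step) (n * 7 + 2) s
     (\<lambda>s'. optimal {..<n} W\<^sub>0 (arr s' ''out'') \<and> reg s' ''n'' = n)"
proof -
  obtain R E where inv: "elimination_invariant n W\<^sub>0 R E (matrix n s) (arr s ''A'') (arr s ''D'')
              (map (arr s ''ord'') (rev [0..<n]))"
    and card: "card R = n - n"
    using s unfolding eliminated_def by blast
  have env: "env n s" and out: "arr s ''out'' = (\<lambda>_. 0)" using s by (simp_all add: eliminated_def)
  have mem: "arr s ''ord'' t \<in> set (map (arr s ''ord'') (rev [0..<n]))" if "t < n" for t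
    using that by simp
  have ord: "arr s ''ord'' t < n"
    and AD: "arr s ''A'' (arr s ''ord'' t) \<le> n \<and> arr s ''D'' (arr s ''ord'' t) \<le> n" if "t < n" for t
    using inv mem[OF that] unfolding elimination_invariant_def by blast+
  have "R \<subseteq> {..<n}" using inv unfolding elimination_invariant_def by blast
  then have R: "R = {}" using card finite_subset[of R "{..<n}"] by simp
  let ?back = "\<lambda>t. backtrack (matrix n s) (arr s ''A'') (arr s ''D'') (map (arr s ''ord'') (rev [0..<t]))"
  \<comment> \<open>With no variable left every binary assignment is optimal, and the zero initial
    contents of the output array are one.\<close>
  have "optimal R (matrix n s) (\<lambda>_. 0)" by (simp add: optimal_def R cost_def binary_def)
  then have opt: "optimal {..<n} W\<^sub>0 (?back n (\<lambda>_. 0))"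
    using inv unfolding elimination_invariant_def by blast
  \<comment> \<open>Backtracking through the remaining variables from the current array gives the
    same result as the whole backtracking from zero.\<close>
  let ?I = "\<lambda>t s' :: state. env n s' \<and> (\<forall>a. a \<noteq> ''out'' \<longrightarrow> arr s' a = arr s a) \<and> binary (arr s' ''out'') \<and>
     ?back (n - t) (arr s' ''out'') = ?back n (\<lambda>_. 0)"
  have "run (for_loop ''t'' (Var ''n'') backtrack_step) (n * 7 + 2) s (?I n)"
  proof (rule run_for[where I = ?I and T = 5])
    fix t and s' :: state assume t: "t < n" "reg s' ''t'' = t" and I: "?I t s'"
    define v where "v = arr s ''ord'' (n - Suc t)"
    have v: "v < n" "arr s ''A'' v \<le> n" "arr s ''D'' v \<le> n"
      using ord[of "n - Suc t"] AD[of "n - Suc t"] t by (auto simp: v_def)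
    let ?x = "arr s' ''out''"
    let ?s = "set_reg ''d'' (arr s ''D'' v) (set_reg ''a'' (arr s ''A'' v) (set_reg ''v'' v s'))"
    have M: "matrix n s' = matrix n s" using I by (simp add: matrix_def fun_eq_iff)
    have x: "?x i < 2" for i using I by (simp add: binaryD)
    have "env n ?s" using I by simp
    then have loc: "aval (local_cost_exp (Var ''v'') (Var ''a'') (Var ''d'') (Const z)
        (Idx ''out'' (Var ''a'')) (Idx ''out'' (Var ''d''))) ?s =
        local_cost (matrix n s) v (arr s ''A'' v) (arr s ''D'' v) z (?x (arr s ''A'' v)) (?x (arr s ''D'' v))"
      if "z < 2" for z
      using aval_local_cost_exp[of n ?s "Var ''v''" "Var ''a''" "Var ''d''" "Const z" "Idx ''out'' (Var ''a'')"
          "Idx ''out'' (Var ''d'')"] v x that M by simp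
    have n: "reg s' ''n'' = n" using I env_n by blast
    have arrs: "arr s' ''ord'' = arr s ''ord''" "arr s' ''A'' = arr s ''A''" "arr s' ''D'' = arr s ''D''"
      using I by auto
    let ?c = "choice (matrix n s) v (arr s ''A'' v) (arr s ''D'' v) ?x"
    have eff: "effect backtrack_step s' = set_arr ''out'' v ?c ?s"
      using t n loc[of 0] loc[of 1]
      by (simp add: backtrack_step_def Let_def arrs v_def[symmetric] choice_def)
    have "n - t = Suc (n - Suc t)" using t by simp
    then have "?back (n - t) ?x = ?back (n - Suc t) (?x(v := ?c))" by (simp add: v_def)
    moreover have "binary (?x(v := ?c))" using I by (simp add: binary_def choice_def)
    ultimately show "run backtrack_step 5 s' (\<lambda>s'. reg s' ''t'' = t \<and> ?I (Suc t) (set_reg ''t'' (Suc t) s'))"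
    proof (intro run_straight)
      show "straight backtrack_step" "steps backtrack_step \<le> 5" by (simp_all add: backtrack_step_def Let_def)
    qed (use I t in \<open>simp add: eff\<close>)
  qed (use env out in \<open>auto simp: env_n binary_def\<close>)
  then show ?thesis by (rule run_mono) (use opt in \<open>auto simp: env_n\<close>)
qed

section \<open>Correctness\<close>

definition index_graph :: "'a pair_pre_digraph \<Rightarrow> 'a list \<Rightarrow> nat \<Rightarrow> nat \<Rightarrow> bool" where
  "index_graph G vs i j \<longleftrightarrow> i < length vs \<and> j < length vs \<and> (vs ! i, vs ! j) \<in> parcs G"

lemma index_graph_props:
  assumes "pair_graph G"
  shows "symp (index_graph G vs)" "irreflp (index_graph G vs)"
proof -
  interpret pair_graph G by fact
  show "symp (index_graph G vs)" unfolding symp_def index_graph_def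
    using arcs_symmetric by blast
  show "irreflp (index_graph G vs)" unfolding irreflp_def index_graph_def
    using no_loops' by auto
qed

lemma chordless_cycle_index_graph:
  assumes G: "pair_graph G" and vs: "distinct vs" "set vs = pverts G"
    and C: "chordless_cycle (index_graph G vs) C"
  shows "induced_cycle G (map ((!) vs) C)"
proof -
  let ?E = "index_graph G vs" and ?C = "map ((!) vs) C"
  have len: "3 \<le> length C" "distinct C" "successively ?E C" "?E (last C) (hd C)"
    using C by (auto simp: chordless_cycle_def cycle_def)
  have C0: "C \<noteq> []" using len by auto
  have nxt: "?E (C ! i) (C ! (Suc i mod length C))" if "i < length C" for i
  proof (cases "Suc i = length C")
    case True
    then have "i = length C - 1" "Suc i mod length C = 0" by auto
    then show ?thesis using len C0 by (simp add: last_conv_nth hd_conv_nth)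
  next
    case False
    then show ?thesis using that successively_nth[OF len(3)] by simp
  qed
  have lt: "c < length vs" if "c \<in> set C" for c
    using nxt that by (auto simp: in_set_conv_nth index_graph_def)
  have "inj_on ((!) vs) (set C)" using lt vs(1) by (auto simp: inj_on_def nth_eq_iff_index_eq)
  moreover have "Suc i mod length C < length C" for i using C0 by simp
  then have "\<forall>i<length ?C. (?C ! i, ?C ! (Suc i mod length ?C)) \<in> parcs G"
    using nxt by (simp add: index_graph_def)
  moreover have "set ?C \<subseteq> pverts G" unfolding vs(2)[symmetric] using lt by auto
  ultimately have "ugraph_cycle G ?C"
    unfolding ugraph_cycle_def using len by (simp add: distinct_map)
  moreover have "j = Suc i mod length C \<or> i = Suc j mod length C"
    if ij: "i < length C" "j < length C" and arc: "(vs ! (C ! i), vs ! (C ! j)) \<in> parcs G" for i j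
  proof -
    have E: "?E (C ! i) (C ! j)" using lt ij arc by (simp add: index_graph_def)
    \<comment> \<open>Two positions cut the list into the pieces in \<open>chordless_cycleD\<close>;
      emptiness of pieces then translates into cyclic adjacency of indices.\<close>
    have main: "j = Suc i \<or> i = 0 \<and> Suc j = length C"
      if "i < j" "j < length C" "?E (C ! i) (C ! j)" for i j
    proof -
      have "C = take i C @ C ! i # drop (Suc i) C" using that by (simp add: id_take_nth_drop)
      also have "drop (Suc i) C = take (j - Suc i) (drop (Suc i) C) @ C ! j # drop (Suc j) C"
        using that id_take_nth_drop[of "j - Suc i" "drop (Suc i) C"] by simp
      finally have "C = take i C @ C ! i # take (j - Suc i) (drop (Suc i) C) @ C ! j # drop (Suc j) C" .
      then have "take (j - Suc i) (drop (Suc i) C) = [] \<or> take i C = [] \<and> drop (Suc j) C = []"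
        using chordless_cycleD[of ?E "take i C" "C ! i" "take (j - Suc i) (drop (Suc i) C)" "C ! j" "drop (Suc j) C"]
          C that(3) by simp
      then show ?thesis using that C0 by auto
    qed
    have "i \<noteq> j" using E index_graph_props(2)[OF G, of vs] by (auto simp: irreflp_def)
    then consider "i < j" | "j < i" by linarith
    then show ?thesis
    proof cases
      case 1
      then show ?thesis using main[OF 1 ij(2) E] ij len by auto
    next
      case 2
      have "?E (C ! j) (C ! i)" using E index_graph_props(1)[OF G, of vs] by (rule sympD[rotated])
      then show ?thesis using main[OF 2 ij(1)] ij len by auto
    qed
  qed
  ultimately show ?thesis by (auto simp: induced_cycle_def)
qed

lemma thin_index_graph:
  assumes "5 \<le> k" "SC k G" "distinct vs" "set vs = pverts G"
  shows "thin (index_graph G vs)"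
proof (rule thin_if_cycle_length[OF _ _ \<open>5 \<le> k\<close>])
  have G: "pair_graph G" using assms(2) by (simp add: SC_def)
  show "symp (index_graph G vs)" using index_graph_props[OF G] by blast
  fix C assume "chordless_cycle (index_graph G vs) C"
  then have "induced_cycle G (map ((!) vs) C)" using chordless_cycle_index_graph[OF G assms(3,4)] by blast
  \<comment> \<open>This cycle rules out the acyclic alternative in \<open>SC\<close>.\<close>
  moreover from this have "ugraph_cycle G (map ((!) vs) C)" by (simp add: induced_cycle_def)
  ultimately show "length C = k" using assms(2) unfolding SC_def by (metis length_map)
qed

lemma run_cover_program:
  assumes k: "5 \<le> k" "SC k G" and vs: "distinct vs" "set vs = pverts G" and n: "n = length vs"
  shows "run cover_program (n * (n * (n * 7 + 20) + 37) + 27) (input_state G vs)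
    (\<lambda>s. optimal {..<n} (cover_cost n (index_graph G vs)) (arr s ''out'') \<and> reg s ''n'' = n)"
proof -
  let ?E = "index_graph G vs" and ?s = "input_state G vs"
  have G: "pair_graph G" using k(2) by (simp add: SC_def)
  note E = index_graph_props[OF G, of vs] thin_index_graph[OF k vs]
  have EN: "i < n \<and> j < n" if "?E i j" for i j using that by (simp add: index_graph_def n)
  have adj: "0 < arr ?s ''adj'' (i * n + j) \<longleftrightarrow> ?E i j" if "i < n" "j < n" for i j
  proof -
    have "i * n + j < n * n"
    proof -
      have "i * n + j < Suc i * n" using that by simp
      also have "\<dots> \<le> n * n" using that by (intro mult_right_mono) auto
      finally show ?thesis .
    qed
    moreover have "(i * n + j) div n = i" "(i * n + j) mod n = j" using that by simp_all
    ultimately show ?thesis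
      using that by (simp add: input_state_def index_graph_def n[symmetric])
  qed
  let ?T = "(10 * n + 20) + ((n * (n * 6 + 5) + 3) + ((n * (n * (n * 7 + 14) + 15) + 2) + (n * 7 + 2)))"
  have "run cover_program ?T ?s (\<lambda>s. optimal {..<n} (cover_cost n ?E) (arr s ''out'') \<and> reg s ''n'' = n)"
    unfolding cover_program_def
  proof (rule run_seq[OF run_read_rows run_seq[OF run_read_graph run_seq[OF run_eliminate_all run_backtrack]]])
    show "reg ?s ''n'' = n" by (simp add: input_state_def n)
    fix s1 assume s1: "env n s1 \<and> (\<forall>a. a \<noteq> ''row'' \<longrightarrow> arr s1 a = arr ?s a)"
    then show "env n s1" by simp
    show "0 < arr s1 ''adj'' (i * n + j) \<longleftrightarrow> ?E i j" if "i < n" "j < n" for i j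
      using adj[OF that] s1 by simp
    show "arr s1 a = (\<lambda>_. 0)" if "a \<in> {''dead'', ''out'', ''e'', ''W''}" for a
      using that s1 by (auto simp: input_state_def)
    show "irreflp ?E" "\<And>i j. ?E i j \<Longrightarrow> i < n \<and> j < n" using E EN by auto
    fix s2 assume s2: "env n s2 \<and> arr s2 ''dead'' = (\<lambda>_. 0) \<and>
       arr s2 ''out'' = (\<lambda>_. 0) \<and> (\<forall>i<n. \<forall>j<n. arr s2 ''e'' (addr n i j) \<noteq> 0 \<longleftrightarrow> ?E i j) \<and>
       (\<forall>l\<le>2 * n + 1. \<forall>k\<le>2 * n + 1. matrix n s2 l k = cover_cost n ?E l k)"
    have "elimination_invariant n (cover_cost n ?E) {..<n} ?E (matrix n s2) (arr s2 ''A'') (arr s2 ''D'') []"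
      by (rule elimination_invariant_init) (use E EN s2 in auto)
    then show "eliminated n (cover_cost n ?E) 0 s2"
      unfolding eliminated_def using s2 by (intro conjI exI[of _ "{..<n}"] exI[of _ ?E]) auto
  qed auto
  then show ?thesis by (rule run_mono) (simp_all add: algebra_simps)
qed

lemma output_vertex_cover:
  assumes G: "pair_graph G" and vs: "distinct vs" "set vs = pverts G"
    and opt: "optimal {..<length vs} (cover_cost (length vs) (index_graph G vs)) x"
  defines "S \<equiv> {vs ! i | i. i < length vs \<and> x i = 1}"
  shows "minimum_vertex_cover G S"
proof -
  let ?n = "length vs" and ?E = "index_graph G vs"
  interpret pair_graph G by fact
  have cover: "x i = 1 \<or> x j = 1" if "?E i j" for i j
    by (rule optimal_cover(1)[OF opt index_graph_props(2)[OF G] _ that]) (simp add: index_graph_def)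
  have inj: "inj_on ((!) vs) {i. i < ?n \<and> P i}" for P
    using vs(1) by (auto simp: inj_on_def nth_eq_iff_index_eq)
  have cardS: "card S = card {i. i < ?n \<and> x i = 1}"
  proof -
    have "S = (!) vs ` {i. i < ?n \<and> x i = 1}" by (auto simp: S_def)
    then show ?thesis using card_image[OF inj] by metis
  qed
  have arc: "\<exists>i j. i < ?n \<and> j < ?n \<and> u = vs ! i \<and> v = vs ! j \<and> ?E i j" if "(u, v) \<in> parcs G" for u v
  proof -
    have "u \<in> set vs" "v \<in> set vs" unfolding vs(2) using that by (rule in_arcsD1, rule in_arcsD2)
    then obtain i j where "i < ?n" "u = vs ! i" "j < ?n" "v = vs ! j" by (metis in_set_conv_nth)
    then show ?thesis using that by (intro exI[of _ i] exI[of _ j]) (simp add: index_graph_def)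
  qed
  have "S \<subseteq> pverts G" unfolding vs(2)[symmetric] by (auto simp: S_def)
  moreover have "u \<in> S \<or> v \<in> S" if uv: "(u, v) \<in> parcs G" for u v
  proof -
    obtain i j where ij: "i < ?n" "j < ?n" "u = vs ! i" "v = vs ! j" "?E i j" using arc[OF uv] by blast
    from cover[OF ij(5)] ij show ?thesis by (auto simp: S_def)
  qed
  moreover have "card S \<le> card T" if T: "vertex_cover G T" for T
  proof -
    let ?T = "{i. i < ?n \<and> vs ! i \<in> T}"
    have "card {i. i < ?n \<and> x i = 1} \<le> card ?T"
      by (rule optimal_cover(2)[OF opt index_graph_props(2)[OF G]])
        (use T in \<open>auto simp: vertex_cover_def index_graph_def\<close>)
    also have "card ?T = card ((!) vs ` ?T)" using card_image[OF inj] by metis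
    also have "(!) vs ` ?T = T"
    proof (intro equalityI subsetI)
      fix v assume "v \<in> T"
      then have "v \<in> set vs" using T vs(2) by (auto simp: vertex_cover_def)
      then obtain i where "i < ?n" "v = vs ! i" by (auto simp: in_set_conv_nth)
      with \<open>v \<in> T\<close> show "v \<in> (!) vs ` ?T" by blast
    qed auto
    finally show ?thesis using cardS by simp
  qed
  ultimately show ?thesis by (auto simp: minimum_vertex_cover_def vertex_cover_def)
qed

lemma independent_set_complement:
  assumes "pair_graph G" "S \<subseteq> pverts G"
  shows "independent_set G (pverts G - S) \<longleftrightarrow> vertex_cover G S"
proof -
  interpret pair_graph G by fact
  have "u \<in> pverts G" "v \<in> pverts G" if "(u, v) \<in> parcs G" for u v
    using in_arcsD1[OF that] in_arcsD2[OF that] .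
  then show ?thesis
    using assms(2) unfolding independent_set_def vertex_cover_def by blast
qed

lemma maximum_independent_set_complement:
  assumes G: "pair_graph G" and S: "minimum_vertex_cover G S"
  shows "maximum_independent_set G (pverts G - S)"
proof -
  interpret pair_graph G by fact
  have fin: "finite (pverts G)" by simp
  have SV: "S \<subseteq> pverts G" "vertex_cover G S" using S by (auto simp: minimum_vertex_cover_def vertex_cover_def)
  have "card T \<le> card (pverts G - S)" if T: "independent_set G T" for T
  proof -
    have TV: "T \<subseteq> pverts G" using T by (simp add: independent_set_def)
    then have "pverts G - (pverts G - T) = T" by auto
    then have "vertex_cover G (pverts G - T)" using independent_set_complement[OF G, of "pverts G - T"] T by auto
    then have "card S \<le> card (pverts G - T)" using S by (simp add: minimum_vertex_cover_def)
    moreover have "card (pverts G - T) = card (pverts G) - card T" "card (pverts G - S) = card (pverts G) - card S"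
      using TV SV(1) fin by (meson card_Diff_subset finite_subset)+
    ultimately show ?thesis using card_mono[OF fin TV] card_mono[OF fin SV(1)] by linarith
  qed
  then show ?thesis using independent_set_complement[OF G SV(1)] SV by (simp add: maximum_independent_set_def)
qed

theorem theorem3:
  fixes k :: nat
  assumes "5 \<le> k"
  shows "poly_time_computable {G :: nat pair_pre_digraph. SC k G} maximum_independent_set \<and>
         poly_time_computable {G :: nat pair_pre_digraph. SC k G} minimum_vertex_cover"
proof
  \<comment> \<open>Coefficients, constant term first, of the total of the four phases of the
    program.\<close>
  let ?p = "[:27, 37, 20, 7:] :: nat poly"
  have cover: "run cover_program (poly ?p (card (pverts G))) (input_state G vs)
      (\<lambda>s. reg s ''n'' = length vs \<and> binary (arr s ''out'') \<and> minimum_vertex_cover G (output_set vs s))"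
    if "SC k G" "distinct vs" "set vs = pverts G" for G :: "nat pair_pre_digraph" and vs
  proof (rule run_mono[OF run_cover_program[OF assms that refl]])
    have "card (pverts G) = length vs" using that distinct_card by metis
    then show "length vs * (length vs * (length vs * 7 + 20) + 37) + 27 \<le> poly ?p (card (pverts G))"
      by (simp add: algebra_simps)
    fix s :: state assume s: "optimal {..<length vs} (cover_cost (length vs) (index_graph G vs)) (arr s ''out'') \<and>
      reg s ''n'' = length vs"
    then have bin: "binary (arr s ''out'')" by (simp add: optimal_def)
    \<comment> \<open>\<open>output_set\<close> tests for nonzero entries, the cover is given by
      ones.\<close>
    have "arr s ''out'' i \<noteq> 0 \<longleftrightarrow> arr s ''out'' i = 1" for i using binaryD[OF bin, of i] by auto
    then have "output_set vs s = {vs ! i | i. i < length vs \<and> arr s ''out'' i = 1}" by (simp add: output_set_def)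
    then show "reg s ''n'' = length vs \<and> binary (arr s ''out'') \<and> minimum_vertex_cover G (output_set vs s)"
      using output_vertex_cover[OF _ that(2,3)] s bin that(1) by (auto simp: SC_def)
  qed
  then show "poly_time_computable {G :: nat pair_pre_digraph. SC k G} minimum_vertex_cover"
    unfolding poly_time_computable_def run_def by blast
  \<comment> \<open>Complementing the output takes at most three steps per vertex and two more for
    the loop.\<close>
  let ?q = "?p + [:2, 3:]"
  have "run independent_program (poly ?q (card (pverts G))) (input_state G vs)
      (\<lambda>s. maximum_independent_set G (output_set vs s))"
    if G: "SC k G" "distinct vs" "set vs = pverts G" for G :: "nat pair_pre_digraph" and vs
  proof -
    let ?n = "length vs"
    have n: "card (pverts G) = ?n" using G distinct_card by metis
    have "run independent_program (poly ?p ?n + (?n * (1 + 2) + 2)) (input_state G vs)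
      (\<lambda>s. maximum_independent_set G (output_set vs s))"
      unfolding independent_program_def
    proof (rule run_seq[OF cover[OF G, unfolded n]])
      fix s :: state assume s: "reg s ''n'' = ?n \<and> binary (arr s ''out'') \<and> minimum_vertex_cover G (output_set vs s)"
      let ?I = "\<lambda>m s' :: state. reg s' ''n'' = ?n \<and>
        (\<forall>i. arr s' ''out'' i = (if i < m then 1 - arr s ''out'' i else arr s ''out'' i))"
      have "run (for_loop ''i'' (Var ''n'') (Store ''out'' (Var ''i'') (Monus (Const 1) (Idx ''out'' (Var ''i'')))))
        (?n * (1 + 2) + 2) s (?I ?n)"
      proof (rule run_for[where I = ?I and T = 1])
        fix m and s :: state assume "m < ?n" "?I m s" "reg s ''i'' = m"
        then show "run (Store ''out'' (Var ''i'') (Monus (Const 1) (Idx ''out'' (Var ''i'')))) 1 s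
          (\<lambda>s'. reg s' ''i'' = m \<and> ?I (Suc m) (set_reg ''i'' (Suc m) s'))"
          by (intro run_straight) (auto simp: less_Suc_eq)
      qed (use s in auto)
      then show "run (for_loop ''i'' (Var ''n'') (Store ''out'' (Var ''i'') (Monus (Const 1) (Idx ''out'' (Var ''i'')))))
        (?n * (1 + 2) + 2) s (\<lambda>s. maximum_independent_set G (output_set vs s))"
      proof (rule run_mono)
        fix s' :: state assume s': "?I ?n s'"
        have "output_set vs s' = {vs ! i | i. i < ?n \<and> arr s ''out'' i = 0}"
          using s' by (auto simp: output_set_def) 
        also have "\<dots> = pverts G - output_set vs s"
          using G(2) by (auto simp: output_set_def G(3)[symmetric] in_set_conv_nth nth_eq_iff_index_eq) blast
        finally show "maximum_independent_set G (output_set vs s')"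
          using maximum_independent_set_complement[of G] s G(1) by (simp add: SC_def)
      qed simp
    qed
    then show ?thesis by (rule run_mono) (simp_all add: n algebra_simps)
  qed
  then show "poly_time_computable {G :: nat pair_pre_digraph. SC k G} maximum_independent_set"
    unfolding poly_time_computable_def run_def by blast
qed

end
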